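(* Let $n\ge3$. The infinitesimal Alexander invariant $\mathfrak B_n=\mathfrak B(P\Sigma_n^+)$ admits a minimal presentation of the form $$S^m\xrightarrow{\ \Psi\ }S^{\binom n3}\longrightarrow\mathfrak B_n\longrightarrow 0,\qquad m=\tfrac1{12}n(n^4-5n^3+7n^2-n-2).$$ The matrix of $\Psi$ is upper block triangular, with diagonal blocks the row vectors $\vec v_{ijk}$ ($1\le k<j<i\le n$), where the entries of $\vec v_{ijk}$ are: $x_{il}+x_{jl}+x_{kl}$ for $1\le l\le k-1$; $x_{ik}+x_{jk}$; and $x_{st}$ for all $1\le t<s\le n$ such that $\{s,t\}\not\subset\{i,j,k\}$ and $\{s,t\}\not\subset\{i,j,k,l\}$ for every $1\le l\le k-1$.
   Context: Let $F_n=\langle x_1,\dots,x_n\rangle$ be the free group; for $i\neq j$ let $\alpha_{ij}\in\mathrm{Aut}(F_n)$ send $x_i\mapsto x_jx_ix_j^{-1}$ and fix the other generators. The upper McCool group $P\Sigma_n^+$ is the subgroup of $\mathrm{Aut}(F_n)$ generated by the $\alpha_{ij}$ with $i>j$; its first homology is free abelian on their classes. Let $x_{ij}\in H_1(P\Sigma_n^+;\mathbb C)$ ($1\le j<i\le n$) be the class of $\alpha_{ij}$, and $S=\mathrm{Sym}(H_1(P\Sigma_n^+;\mathbb C))=\mathbb C[x_{ij}\mid1\le j<i\le n]$. (Known: with $u_{ij}$ the dual basis of $H^1$, $H^*(P\Sigma_n^+;\mathbb C)$ is the exterior algebra on the $u_{ij}$ modulo the relations $u_{ij}(u_{ik}-u_{jk})=0$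 for $k<j<i$.) For a finitely presented group $G$, the holonomy Lie algebra is $\mathfrak h(G)=\mathfrak{lie}(H_1(G;\mathbb C))/\langle\mathrm{im}\,\partial_G\rangle$, the free Lie algebra on $H_1(G;\mathbb C)$ modulo the Lie ideal generated by the image of $\partial_G\colon H^2(G;\mathbb C)^*\to H_1(G;\mathbb C)\wedge H_1(G;\mathbb C)$, the dual of the cup product. The infinitesimal Alexander invariant is $\mathfrak B(G)=\mathfrak h(G)'/\mathfrak h(G)''$, a graded $\mathrm{Sym}(H_1(G;\mathbb C))$-module via the adjoint action. The rows of the matrix, and the blocks of columns, are both indexed by the triples $(i,j,k)$ with $n\ge i>j>k\ge1$, listed in decreasing lexicographic order ($(n,n-1,n-2)$ first, $(3,2,1)$ last); the diagonal block at $(i,j,k)$ has one row and $\binom n2-2k$ columns. A presentation is minimal if the standard basis of $S^{\binom n3}$ maps to a minimal generating set of $\mathfrak B_n$ and no column of the matrix is redundant as a generator of $\mathrm{im}(\Psi)$. *)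

theory Defs
  imports
    "HOL-Algebra.Algebra"
    "HOL-Algebra.Algebraic_Closure_Type"
    "HOL-Library.Poly_Mapping"
begin

section \<open>Modules and algebras\<close>

text \<open>
  Both modules and (possibly non-associative) algebras are represented by the record
  \<^type>\<open>module_ext\<close> of HOL-Algebra. For modules the fields \<open>mult\<close> and \<open>one\<close> carry no information;
  for algebras \<open>mult\<close> is the product (the bracket, for Lie algebras) and \<open>one\<close> carries none.
\<close>

abbreviation Cx :: "complex ring"
  where "Cx \<equiv> ring_of_type_algebra"

definition lin_span :: "('a, 'r) ring_scheme \<Rightarrow> ('a, 'b, 'm) module_scheme \<Rightarrow> 'b set \<Rightarrow> 'b set"
  where "lin_span R M Z = \<Inter>{H. submodule H R M \<and> Z \<subseteq> H}"

definition mod_hom ::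
    "('a, 'r) ring_scheme \<Rightarrow> ('a, 'b, 'm) module_scheme \<Rightarrow> ('a, 'c, 'k) module_scheme \<Rightarrow> ('b \<Rightarrow> 'c) set"
  where "mod_hom R M N = {f \<in> carrier M \<rightarrow> carrier N.
    (\<forall>x\<in>carrier M. \<forall>y\<in>carrier M. f (x \<oplus>\<^bsub>M\<^esub> y) = f x \<oplus>\<^bsub>N\<^esub> f y) \<and>
    (\<forall>a\<in>carrier R. \<forall>x\<in>carrier M. f (a \<odot>\<^bsub>M\<^esub> x) = a \<odot>\<^bsub>N\<^esub> f x)}"

text \<open>The module \<open>R\<^sup>I\<close> of all functions from \<open>I\<close> to \<open>R\<close>; it is free if \<open>I\<close> is finite.\<close>

definition fun_module :: "('a, 'r) ring_scheme \<Rightarrow> 'i set \<Rightarrow> ('a, 'i \<Rightarrow> 'a) module"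
  where "fun_module R I = \<lparr>
    carrier = I \<rightarrow>\<^sub>E carrier R,
    monoid.mult = (\<lambda>f g. \<lambda>i\<in>I. f i \<otimes>\<^bsub>R\<^esub> g i),
    one = (\<lambda>i\<in>I. \<one>\<^bsub>R\<^esub>),
    ring.zero = (\<lambda>i\<in>I. \<zero>\<^bsub>R\<^esub>),
    add = (\<lambda>f g. \<lambda>i\<in>I. f i \<oplus>\<^bsub>R\<^esub> g i),
    module.smult = (\<lambda>a f. \<lambda>i\<in>I. a \<otimes>\<^bsub>R\<^esub> f i)\<rparr>"

definition std_vec :: "('a, 'r) ring_scheme \<Rightarrow> 'i set \<Rightarrow> 'i \<Rightarrow> 'i \<Rightarrow> 'a"
  where "std_vec R I i = (\<lambda>j\<in>I. if j = i then \<one>\<^bsub>R\<^esub> else \<zero>\<^bsub>R\<^esub>)"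

text \<open>
  Quotient of a module by a submodule, or of an algebra by a two-sided ideal: the ring quotient
  \<open>A Quot K\<close> with the induced scalar multiplication.
\<close>

definition mod_quot :: "('a, 'b, 'm) module_scheme \<Rightarrow> 'b set \<Rightarrow> ('a, 'b set) module"
  where "mod_quot A K = \<lparr>
    carrier = carrier (A Quot K),
    monoid.mult = monoid.mult (A Quot K),
    one = one (A Quot K),
    ring.zero = ring.zero (A Quot K),
    add = add (A Quot K),
    module.smult = (\<lambda>c Z. \<Union>x\<in>Z. K +>\<^bsub>A\<^esub> (c \<odot>\<^bsub>A\<^esub> x))\<rparr>"

definition alg_ideal :: "(complex, 'b, 'm) module_scheme \<Rightarrow> 'b set \<Rightarrow> 'b set"
  where "alg_ideal A Z = \<Inter>{K. submodule K Cx A \<and>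
    (\<forall>x\<in>carrier A. \<forall>k\<in>K. x \<otimes>\<^bsub>A\<^esub> k \<in> K \<and> k \<otimes>\<^bsub>A\<^esub> x \<in> K) \<and> Z \<subseteq> K}"

definition derived_alg :: "(complex, 'b, 'm) module_scheme \<Rightarrow> (complex, 'b, 'm) module_scheme"
  where "derived_alg L = L\<lparr>carrier :=
    lin_span Cx L {x \<otimes>\<^bsub>L\<^esub> y | x y. x \<in> carrier L \<and> y \<in> carrier L}\<rparr>"


section \<open>Presentations\<close>

definition mat_map ::
    "('a, 'r) ring_scheme \<Rightarrow> 'i set \<Rightarrow> 'j set \<Rightarrow> ('i \<Rightarrow> 'j \<Rightarrow> 'a) \<Rightarrow> ('j \<Rightarrow> 'a) \<Rightarrow> 'i \<Rightarrow> 'a"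
  where "mat_map R I J \<Psi> f = (\<lambda>i\<in>I. \<Oplus>\<^bsub>R\<^esub>j\<in>J. \<Psi> i j \<otimes>\<^bsub>R\<^esub> f j)"

definition mat_col :: "'i set \<Rightarrow> ('i \<Rightarrow> 'j \<Rightarrow> 'a) \<Rightarrow> 'j \<Rightarrow> 'i \<Rightarrow> 'a"
  where "mat_col I \<Psi> j = (\<lambda>i\<in>I. \<Psi> i j)"

text \<open>Exactness of \<open>R\<^sup>J \<rightarrow> R\<^sup>I \<rightarrow> M \<rightarrow> 0\<close>, the first map given by the matrix \<open>\<Psi>\<close> and the second by \<open>\<pi>\<close>.\<close>

definition presentation ::
    "('a, 'r) ring_scheme \<Rightarrow> ('a, 'b, 'm) module_scheme \<Rightarrow> 'i set \<Rightarrow> 'j set \<Rightarrow>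
     ('i \<Rightarrow> 'j \<Rightarrow> 'a) \<Rightarrow> (('i \<Rightarrow> 'a) \<Rightarrow> 'b) \<Rightarrow> bool"
  where "presentation R M I J \<Psi> \<pi> \<longleftrightarrow>
    (\<forall>i\<in>I. \<forall>j\<in>J. \<Psi> i j \<in> carrier R) \<and>
    \<pi> \<in> mod_hom R (fun_module R I) M \<and>
    \<pi> ` carrier (fun_module R I) = carrier M \<and>
    {f \<in> carrier (fun_module R I). \<pi> f = \<zero>\<^bsub>M\<^esub>} = mat_map R I J \<Psi> ` carrier (fun_module R J)"

definition minimal_presentation ::
    "('a, 'r) ring_scheme \<Rightarrow> ('a, 'b, 'm) module_scheme \<Rightarrow> 'i set \<Rightarrow> 'j set \<Rightarrow>
     ('i \<Rightarrow> 'j \<Rightarrow> 'a) \<Rightarrow> (('i \<Rightarrow> 'a) \<Rightarrow> 'b) \<Rightarrow> bool"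
  where "minimal_presentation R M I J \<Psi> \<pi> \<longleftrightarrow>
    presentation R M I J \<Psi> \<pi> \<and>
    (\<forall>i\<in>I. lin_span R M ((\<lambda>i'. \<pi> (std_vec R I i')) ` (I - {i})) \<noteq> carrier M) \<and>
    (\<forall>j\<in>J. lin_span R (fun_module R I) (mat_col I \<Psi> ` (J - {j}))
        \<noteq> mat_map R I J \<Psi> ` carrier (fun_module R J))"


section \<open>Group homology and cohomology in low degrees\<close>

text \<open>
  \<open>H\<^sub>1(G;\<complex>)\<close> from the bar complex: \<open>1\<close>-chains are finite formal sums of elements of \<open>G\<close>, all of them
  are cycles, and the boundary of the \<open>2\<close>-chain \<open>[g|h]\<close> is \<open>[h] - [gh] + [g]\<close>.
\<close>

definition chains1 :: "('g, 'm) monoid_scheme \<Rightarrow> (complex, 'g \<Rightarrow>\<^sub>0 complex) module"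
  where "chains1 G = \<lparr>
    carrier = {c. Poly_Mapping.keys c \<subseteq> carrier G},
    monoid.mult = (\<lambda>_ _. 0), one = 0, ring.zero = 0, add = (+),
    module.smult = (\<lambda>a. Poly_Mapping.map ((*) a))\<rparr>"

definition boundaries1 :: "('g, 'm) monoid_scheme \<Rightarrow> ('g \<Rightarrow>\<^sub>0 complex) set"
  where "boundaries1 G = lin_span Cx (chains1 G)
    {Poly_Mapping.single h 1 - Poly_Mapping.single (g \<otimes>\<^bsub>G\<^esub> h) 1 + Poly_Mapping.single g 1 | g h.
      g \<in> carrier G \<and> h \<in> carrier G}"

definition H_1 :: "('g, 'm) monoid_scheme \<Rightarrow> (complex, ('g \<Rightarrow>\<^sub>0 complex) set) module"
  where "H_1 G = mod_quot (chains1 G) (boundaries1 G)"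

definition class1 :: "('g, 'm) monoid_scheme \<Rightarrow> 'g \<Rightarrow> ('g \<Rightarrow>\<^sub>0 complex) set"
  where "class1 G g = boundaries1 G +>\<^bsub>chains1 G\<^esub> Poly_Mapping.single g 1"

text \<open>
  Cohomology from inhomogeneous cochains. With trivial coefficients the coboundary of a \<open>0\<close>-cochain
  vanishes, so \<open>H\<^sup>1\<close> is the space of \<open>1\<close>-cocycles.
\<close>

definition H1_coh :: "('g, 'm) monoid_scheme \<Rightarrow> ('g \<Rightarrow> complex) set"
  where "H1_coh G = {a \<in> carrier G \<rightarrow>\<^sub>E UNIV.
    \<forall>g\<in>carrier G. \<forall>h\<in>carrier G. a h - a (g \<otimes>\<^bsub>G\<^esub> h) + a g = 0}"

abbreviation cochains2 :: "('g, 'm) monoid_scheme \<Rightarrow> (complex, 'g \<times> 'g \<Rightarrow> complex) module"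
  where "cochains2 G \<equiv> fun_module Cx (carrier G \<times> carrier G)"

definition cocycles2 :: "('g, 'm) monoid_scheme \<Rightarrow> (complex, 'g \<times> 'g \<Rightarrow> complex) module"
  where "cocycles2 G = (cochains2 G)\<lparr>carrier := {f \<in> carrier (cochains2 G).
    \<forall>g\<in>carrier G. \<forall>h\<in>carrier G. \<forall>k\<in>carrier G.
      f (h, k) - f (g \<otimes>\<^bsub>G\<^esub> h, k) + f (g, h \<otimes>\<^bsub>G\<^esub> k) - f (g, h) = 0}\<rparr>"

definition coboundaries2 :: "('g, 'm) monoid_scheme \<Rightarrow> ('g \<times> 'g \<Rightarrow> complex) set"
  where "coboundaries2 G =
    {\<lambda>(g, h)\<in>carrier G \<times> carrier G. c h - c (g \<otimes>\<^bsub>G\<^esub> h) + c g | c. True}"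

definition H2_coh :: "('g, 'm) monoid_scheme \<Rightarrow> (complex, ('g \<times> 'g \<Rightarrow> complex) set) module"
  where "H2_coh G = mod_quot (cocycles2 G) (coboundaries2 G)"

definition cup :: "('g, 'm) monoid_scheme \<Rightarrow> ('g \<Rightarrow> complex) \<Rightarrow> ('g \<Rightarrow> complex) \<Rightarrow> ('g \<times> 'g \<Rightarrow> complex) set"
  where "cup G a b =
    coboundaries2 G +>\<^bsub>cocycles2 G\<^esub> (\<lambda>(g, h)\<in>carrier G \<times> carrier G. a g * b h)"

definition H2_dual :: "('g, 'm) monoid_scheme \<Rightarrow> (('g \<times> 'g \<Rightarrow> complex) set \<Rightarrow> complex) set"
  where "H2_dual G = {\<phi>.
    (\<forall>Z\<in>carrier (H2_coh G). \<forall>Y\<in>carrier (H2_coh G). \<phi> (Z \<oplus>\<^bsub>H2_coh G\<^esub> Y) = \<phi> Z + \<phi> Y) \<and>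
    (\<forall>c. \<forall>Z\<in>carrier (H2_coh G). \<phi> (c \<odot>\<^bsub>H2_coh G\<^esub> Z) = c * \<phi> Z)}"

text \<open>The pairing of \<open>H\<^sup>1\<close> with \<open>H\<^sub>1\<close>; the value is the same for all chains in the class.\<close>

definition pairing :: "('g \<Rightarrow> complex) \<Rightarrow> ('g \<Rightarrow>\<^sub>0 complex) set \<Rightarrow> complex"
  where "pairing a u =
    the_elem ((\<lambda>c. \<Sum>g\<in>Poly_Mapping.keys c. Poly_Mapping.lookup c g * a g) ` u)"

text \<open>
  The list \<open>[(u\<^sub>1, v\<^sub>1), \<dots>]\<close> of pairs in \<open>H\<^sub>1\<close> stands for the element \<open>u\<^sub>1 \<and> v\<^sub>1 + \<dots>\<close> of \<open>H\<^sub>1 \<and> H\<^sub>1\<close>.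
  The predicate says that this element is \<open>\<partial>\<^sub>G(\<phi>)\<close>: its value under every \<open>a \<and> b\<close>, with
  \<open>(a \<and> b)(u \<and> v) = a(u) b(v) - a(v) b(u)\<close>, is \<open>\<phi>(a \<union> b)\<close>. When \<open>H\<^sub>1\<close> is finite-dimensional (for
  instance, when \<open>G\<close> is finitely presented), \<open>H\<^sup>1 \<and> H\<^sup>1\<close> is the dual of \<open>H\<^sub>1 \<and> H\<^sub>1\<close>, so this determines
  the element, and every \<open>\<phi>\<close> has such a list.
\<close>

definition represents_dual_cup ::
    "('g, 'm) monoid_scheme \<Rightarrow> (('g \<times> 'g \<Rightarrow> complex) set \<Rightarrow> complex) \<Rightarrow>
     (('g \<Rightarrow>\<^sub>0 complex) set \<times> ('g \<Rightarrow>\<^sub>0 complex) set) list \<Rightarrow> bool"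
  where "represents_dual_cup G \<phi> ws \<longleftrightarrow>
    set ws \<subseteq> carrier (H_1 G) \<times> carrier (H_1 G) \<and>
    (\<forall>a\<in>H1_coh G. \<forall>b\<in>H1_coh G.
      \<phi> (cup G a b) = (\<Sum>(u, v)\<leftarrow>ws. pairing a u * pairing b v - pairing a v * pairing b u))"


section \<open>Free Lie algebras, holonomy and the infinitesimal Alexander invariant\<close>

datatype 'v mag = Gen 'v | Node "'v mag" "'v mag"

text \<open>The free non-associative complex algebra on the set \<open>Z\<close>: the algebra of the free magma.\<close>

definition free_nonassoc :: "'v set \<Rightarrow> (complex, 'v mag \<Rightarrow>\<^sub>0 complex) module"
  where "free_nonassoc Z = \<lparr>
    carrier = {p. \<forall>t\<in>Poly_Mapping.keys p. set_mag t \<subseteq> Z},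
    monoid.mult = (\<lambda>p q. \<Sum>s\<in>Poly_Mapping.keys p. \<Sum>t\<in>Poly_Mapping.keys q.
      Poly_Mapping.single (Node s t) (Poly_Mapping.lookup p s * Poly_Mapping.lookup q t)),
    one = 0, ring.zero = 0, add = (+),
    module.smult = (\<lambda>c. Poly_Mapping.map ((*) c))\<rparr>"

text \<open>
  The free Lie algebra on a vector space \<open>V\<close> (rather than on a set): the generators are all vectors
  of \<open>V\<close>, and the first two sets of relations make the map from \<open>V\<close> linear.
\<close>

definition lie_ideal :: "(complex, 'v, 'm) module_scheme \<Rightarrow> ('v mag \<Rightarrow>\<^sub>0 complex) set"
  where "lie_ideal V = (let A = free_nonassoc (carrier V); gen = (\<lambda>v. Poly_Mapping.single (Gen v) 1) in
    alg_ideal A (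
      {gen (u \<oplus>\<^bsub>V\<^esub> v) - gen u - gen v | u v. u \<in> carrier V \<and> v \<in> carrier V} \<union>
      {gen (c \<odot>\<^bsub>V\<^esub> u) - c \<odot>\<^bsub>A\<^esub> gen u | c u. u \<in> carrier V} \<union>
      {x \<otimes>\<^bsub>A\<^esub> x | x. x \<in> carrier A} \<union>
      {x \<otimes>\<^bsub>A\<^esub> (y \<otimes>\<^bsub>A\<^esub> z) + y \<otimes>\<^bsub>A\<^esub> (z \<otimes>\<^bsub>A\<^esub> x) + z \<otimes>\<^bsub>A\<^esub> (x \<otimes>\<^bsub>A\<^esub> y) | x y z.
        x \<in> carrier A \<and> y \<in> carrier A \<and> z \<in> carrier A}))"

definition free_lie :: "(complex, 'v, 'm) module_scheme \<Rightarrow> (complex, ('v mag \<Rightarrow>\<^sub>0 complex) set) module"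
  where "free_lie V = mod_quot (free_nonassoc (carrier V)) (lie_ideal V)"

definition lie_gen :: "(complex, 'v, 'm) module_scheme \<Rightarrow> 'v \<Rightarrow> ('v mag \<Rightarrow>\<^sub>0 complex) set"
  where "lie_gen V v =
    lie_ideal V +>\<^bsub>free_nonassoc (carrier V)\<^esub> Poly_Mapping.single (Gen v) 1"

text \<open>The image of \<open>u\<^sub>1 \<and> v\<^sub>1 + \<dots>\<close> under \<open>H\<^sub>1 \<and> H\<^sub>1 \<rightarrow> lie(H\<^sub>1)\<close>, \<open>u \<and> v \<mapsto> [u, v]\<close>.\<close>

definition wedge_to_lie :: "(complex, 'v, 'm) module_scheme \<Rightarrow> ('v \<times> 'v) list \<Rightarrow> ('v mag \<Rightarrow>\<^sub>0 complex) set"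
  where "wedge_to_lie V ws = foldr
    (\<lambda>(u, v) y. (lie_gen V u \<otimes>\<^bsub>free_lie V\<^esub> lie_gen V v) \<oplus>\<^bsub>free_lie V\<^esub> y) ws \<zero>\<^bsub>free_lie V\<^esub>"

type_synonym 'g lieH1 = "(('g \<Rightarrow>\<^sub>0 complex) set mag \<Rightarrow>\<^sub>0 complex) set"

definition holonomy_ideal :: "('g, 'm) monoid_scheme \<Rightarrow> 'g lieH1 set"
  where "holonomy_ideal G = alg_ideal (free_lie (H_1 G))
    {wedge_to_lie (H_1 G) ws | ws. \<exists>\<phi>\<in>H2_dual G. represents_dual_cup G \<phi> ws}"

definition holonomy :: "('g, 'm) monoid_scheme \<Rightarrow> (complex, 'g lieH1 set) module"
  where "holonomy G = mod_quot (free_lie (H_1 G)) (holonomy_ideal G)"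

definition holonomy_gen :: "('g, 'm) monoid_scheme \<Rightarrow> ('g \<Rightarrow>\<^sub>0 complex) set \<Rightarrow> 'g lieH1 set"
  where "holonomy_gen G u = holonomy_ideal G +>\<^bsub>free_lie (H_1 G)\<^esub> lie_gen (H_1 G) u"

abbreviation holonomy' :: "('g, 'm) monoid_scheme \<Rightarrow> (complex, 'g lieH1 set) module"
  where "holonomy' G \<equiv> derived_alg (holonomy G)"

abbreviation holonomy'' :: "('g, 'm) monoid_scheme \<Rightarrow> (complex, 'g lieH1 set) module"
  where "holonomy'' G \<equiv> derived_alg (holonomy' G)"

text \<open>The complex vector space \<open>\<hh>'/\<hh>''\<close>, and the adjoint action of \<open>H\<^sub>1\<close> on it.\<close>

definition alexander_space :: "('g, 'm) monoid_scheme \<Rightarrow> (complex, 'g lieH1 set set) module"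
  where "alexander_space G = mod_quot (holonomy' G) (carrier (holonomy'' G))"

definition alexander_ad ::
    "('g, 'm) monoid_scheme \<Rightarrow> ('g \<Rightarrow>\<^sub>0 complex) set \<Rightarrow> 'g lieH1 set set \<Rightarrow> 'g lieH1 set set"
  where "alexander_ad G u Z =
    (\<Union>y\<in>Z. carrier (holonomy'' G) +>\<^bsub>holonomy' G\<^esub> (holonomy_gen G u \<otimes>\<^bsub>holonomy G\<^esub> y))"

text \<open>
  Polynomials with variables in \<open>'v\<close> are finitely supported functions on the monomials, which in turn
  are finitely supported functions from \<open>'v\<close> to exponents; the product is the convolution product.
\<close>

type_synonym 'v cpoly = "('v \<Rightarrow>\<^sub>0 nat) \<Rightarrow>\<^sub>0 complex"

definition poly_ring :: "'v set \<Rightarrow> 'v cpoly ring"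
  where "poly_ring Z = ring_of_type_algebra
    \<lparr>carrier := {p. \<forall>m\<in>Poly_Mapping.keys p. Poly_Mapping.keys m \<subseteq> Z}\<rparr>"

definition poly_var :: "'v \<Rightarrow> 'v cpoly"
  where "poly_var v = Poly_Mapping.single (Poly_Mapping.single v 1) 1"

text \<open>
  The infinitesimal Alexander invariant as a module over \<open>\<complex>[vs]\<close>, the variable \<open>v\<close> acting as the adjoint
  action of the class \<open>x v\<close>. If \<open>x\<close> maps the distinct list \<open>vs\<close> to a basis of \<open>H\<^sub>1\<close>, then \<open>\<complex>[vs]\<close> is
  \<open>Sym(H\<^sub>1)\<close>. The operators \<^const>\<open>alexander_ad\<close> commute on \<open>\<hh>'/\<hh>''\<close>, so the order of \<open>vs\<close> is irrelevant.
\<close>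

definition inf_alexander ::
    "('g, 'm) monoid_scheme \<Rightarrow> 'v list \<Rightarrow> ('v \<Rightarrow> ('g \<Rightarrow>\<^sub>0 complex) set) \<Rightarrow>
     ('v cpoly, 'g lieH1 set set) module"
  where "inf_alexander G vs x = (let A = alexander_space G in \<lparr>
    carrier = carrier A, monoid.mult = monoid.mult A, one = one A, ring.zero = ring.zero A, add = add A,
    module.smult = (\<lambda>p b. \<Oplus>\<^bsub>A\<^esub>m\<in>Poly_Mapping.keys p. Poly_Mapping.lookup p m \<odot>\<^bsub>A\<^esub>
      foldr (\<lambda>v. alexander_ad G (x v) ^^ Poly_Mapping.lookup m v) vs b)\<rparr>)"


section \<open>The upper McCool groups\<close>

text \<open>
  The free group on \<open>x\<^sub>1, \<dots>, x\<^sub>n\<close> as the group of reduced words: the letter \<open>(i, True)\<close> is \<open>x\<^sub>i\<close> and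
  \<open>(i, False)\<close> is its inverse.
\<close>

type_synonym word = "(nat \<times> bool) list"

abbreviation inverse_letters :: "nat \<times> bool \<Rightarrow> nat \<times> bool \<Rightarrow> bool"
  where "inverse_letters a b \<equiv> fst a = fst b \<and> snd a \<noteq> snd b"

fun reduced :: "word \<Rightarrow> bool"
  where
    "reduced (a # b # w) \<longleftrightarrow> \<not> inverse_letters a b \<and> reduced (b # w)"
  | "reduced w \<longleftrightarrow> True"

fun push_letter :: "nat \<times> bool \<Rightarrow> word \<Rightarrow> word"
  where
    "push_letter a [] = [a]"
  | "push_letter a (b # w) = (if inverse_letters a b then w else a # b # w)"

definition free_group :: "nat \<Rightarrow> word monoid"
  where "free_group n = \<lparr>
    carrier = {w. reduced w \<and> fst ` set w \<subseteq> {1..n}},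
    monoid.mult = foldr push_letter,
    one = []\<rparr>"

definition word_eval :: "('g, 'm) monoid_scheme \<Rightarrow> (nat \<Rightarrow> 'g) \<Rightarrow> word \<Rightarrow> 'g"
  where "word_eval G f w =
    foldr (\<lambda>(i, e) y. (if e then f i else inv\<^bsub>G\<^esub> (f i)) \<otimes>\<^bsub>G\<^esub> y) w \<one>\<^bsub>G\<^esub>"

definition alpha :: "nat \<Rightarrow> nat \<Rightarrow> nat \<Rightarrow> word \<Rightarrow> word"
  where "alpha n i j = (\<lambda>w\<in>carrier (free_group n). word_eval (free_group n)
    (\<lambda>k. if k = i then [(j, True), (i, True), (j, False)] else [(k, True)]) w)"

definition upper_McCool :: "nat \<Rightarrow> (word \<Rightarrow> word) monoid"
  where "upper_McCool n =
    subgroup_generated (AutoGroup (free_group n)) {alpha n i j | i j. 1 \<le> j \<and> j < i \<and> i \<le> n}"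

definition index_pairs :: "nat \<Rightarrow> (nat \<times> nat) list"
  where "index_pairs n = [(i, j). i \<leftarrow> [1..<n + 1], j \<leftarrow> [1..<i]]"

definition S_ring :: "nat \<Rightarrow> (nat \<times> nat) cpoly ring"
  where "S_ring n = poly_ring (set (index_pairs n))"

abbreviation x_var :: "nat \<Rightarrow> nat \<Rightarrow> (nat \<times> nat) cpoly"
  where "x_var i j \<equiv> poly_var (i, j)"

definition B_module :: "nat \<Rightarrow> ((nat \<times> nat) cpoly, (word \<Rightarrow> word) lieH1 set set) module"
  where "B_module n = inf_alexander (upper_McCool n) (index_pairs n)
    (\<lambda>(i, j). class1 (upper_McCool n) (alpha n i j))"


section \<open>The block structure of the matrix\<close>

type_synonym triple = "nat \<times> nat \<times> nat"

definition triples :: "nat \<Rightarrow> triple set"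
  where "triples n = {(i, j, k). n \<ge> i \<and> i > j \<and> j > k \<and> k \<ge> 1}"

text \<open>\<open>precedes T T'\<close>: the triple \<open>T\<close> comes before \<open>T'\<close> in decreasing lexicographic order.\<close>

fun precedes :: "triple \<Rightarrow> triple \<Rightarrow> bool"
  where "precedes (i, j, k) (i', j', k') \<longleftrightarrow> i > i' \<or> (i = i' \<and> (j > j' \<or> (j = j' \<and> k > k')))"

fun block_width :: "nat \<Rightarrow> triple \<Rightarrow> nat"
  where "block_width n (i, j, k) = (n choose 2) - 2 * k"

text \<open>The column \<open>(T, q)\<close> is the \<open>q\<close>-th column, counted from \<open>0\<close>, of the block of columns at \<open>T\<close>.\<close>

definition columns :: "nat \<Rightarrow> (triple \<times> nat) set"
  where "columns n = (SIGMA T:triples n. {..<block_width n T})"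

fun v_row :: "nat \<Rightarrow> triple \<Rightarrow> (nat \<times> nat) cpoly list"
  where "v_row n (i, j, k) =
    [x_var i l + x_var j l + x_var k l. l \<leftarrow> [1..<k]] @
    [x_var i k + x_var j k] @
    [x_var s t. (s, t) \<leftarrow> index_pairs n,
      \<not> {s, t} \<subseteq> {i, j, k} \<and> (\<forall>l\<in>{1..<k}. \<not> {s, t} \<subseteq> {i, j, k, l})]"

definition block_upper_triangular :: "nat \<Rightarrow> (triple \<Rightarrow> triple \<times> nat \<Rightarrow> (nat \<times> nat) cpoly) \<Rightarrow> bool"
  where "block_upper_triangular n \<Psi> \<longleftrightarrow>
    (\<forall>T\<in>triples n. \<forall>(T', q)\<in>columns n. precedes T' T \<longrightarrow> \<Psi> T (T', q) = 0)"

definition diagonal_block :: "nat \<Rightarrow> (triple \<Rightarrow> triple \<times> nat \<Rightarrow> (nat \<times> nat) cpoly) \<Rightarrow> triple \<Rightarrow> (nat \<times> nat) cpoly list"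
  where "diagonal_block n \<Psi> T = [\<Psi> T (T, q). q \<leftarrow> [0..<block_width n T]]"

end

theory Submission
  imports Defs
begin

text \<open>
  The holonomy Lie algebra \<open>\<hh>\<close> of \<open>P\<Sigma>\<^sub>n\<^sup>+\<close> is quadratic, so everything rests on its
  quadratic relations, i.e. on the image of \<open>\<partial>\<close>, and this can be computed without the
  whole cohomology ring. A commuting pair \<open>g, h\<close> of group elements gives the functional
  \<open>f \<mapsto> f(g, h) - f(h, g)\<close> on \<open>H\<^sup>2\<close>, whence \<open>[x\<^sub>i\<^sub>j, x\<^sub>s\<^sub>t]\<close> (for disjoint indices),
  \<open>[x\<^sub>i\<^sub>k, x\<^sub>j\<^sub>k]\<close> and \<open>[x\<^sub>i\<^sub>j, x\<^sub>i\<^sub>k + x\<^sub>j\<^sub>k]\<close> lie in the image of \<open>\<partial>\<close>. Conversely,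
  Magnus coefficients of the conjugating words give cochains that bound
  \<open>u\<^sub>i\<^sub>j (u\<^sub>i\<^sub>k - u\<^sub>j\<^sub>k)\<close>, so there are no further relations.

  Hence \<open>\<hh>'/\<hh>''\<close> is generated over \<open>S\<close> by the classes of \<open>[x\<^sub>i\<^sub>j, x\<^sub>i\<^sub>k]\<close> for \<open>i > j > k\<close>, and
  its relations are the Jacobi identities on triples of generators; modulo each other these
  reduce to the columns of \<open>\<Psi>\<close>, one for every diagonal entry. That the columns generate
  all relations follows by mapping \<open>\<hh>\<close> into the metabelian Lie algebra
  \<open>H\<^sub>1 \<oplus> S\<^sup>T / im \<Psi>\<close>, with \<open>T\<close> the set of triples: this map is well defined because the
  Jacobi identities hold modulo the columns, and it sends the class of \<open>[x\<^sub>i\<^sub>j, x\<^sub>i\<^sub>k]\<close> to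
  a basis vector. All entries of \<open>\<Psi>\<close> are linear forms, so no generator is redundant; every
  diagonal entry contains a variable that no other diagonal entry of its block contains, so the
  columns are linearly independent over \<open>\<complex>\<close> and none of them is redundant.
\<close>

text \<open>The holonomy Lie algebra is a quotient of a quotient of the free non-associative
  algebra, so a map out of it is described by its kernel upstairs: \<open>model_kernel\<close> has
  to be an ideal that contains the Lie relations and lifts of the image of \<partial>, and the
  module \<open>S^T / im Psi\<close> is never formed. The bracket of the model is dictated by
  duality. Its component at \<open>(i, j, k)\<close> is the 2-form
  \<open>u_ij \<and> (u_ik - u_jk)\<close>, so it vanishes on the image of \<partial> because a cup
  product vanishes. That cup product is bounded by \<open>u_ij u_jk - m_ijk\<close>, where
  \<open>m_ijk\<close> is the coefficient of \<open>X_k X_j\<close> in the Magnus expansion of the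
  word that conjugates \<open>x_i\<close>. The three-term diagonal entries have the following
  origin. For \<open>l < k\<close> the Jacobi identities of \<open>[x_ij, x_ik]\<close> with
  \<open>x_il\<close>, \<open>x_jl\<close> and \<open>x_kl\<close> each involve generators at other
  triples; these cancel in the sum, which leaves \<open>x_il + x_jl + x_kl\<close> times the
  generator at \<open>(i, j, k)\<close>.\<close>

lemma Cx_simps [simp]:
  "carrier Cx = UNIV" "x \<otimes>\<^bsub>Cx\<^esub> y = x * y" "\<one>\<^bsub>Cx\<^esub> = 1" "\<zero>\<^bsub>Cx\<^esub> = 0" "x \<oplus>\<^bsub>Cx\<^esub> y = x + y"
  by (simp_all add: ring_of_type_algebra_def)

lemma Cx_minus_one [simp]: "\<ominus>\<^bsub>Cx\<^esub> x = - x"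
proof -
  interpret cring Cx by (rule cring_from_type_algebra)
  have "(- x) \<oplus>\<^bsub>Cx\<^esub> x = \<zero>\<^bsub>Cx\<^esub>" by simp
  thus ?thesis by (intro minus_equality) auto
qed

section \<open>Submodules and quotients\<close>

context module
begin

lemma submodule_abelian_subgroup: "submodule H R M \<Longrightarrow> abelian_subgroup H M"
  by (intro abelian_subgroupI3 additive_subgroupI)
    (auto simp: submodule_def M.abelian_group_axioms)

lemma submodule_zero: "submodule H R M \<Longrightarrow> \<zero>\<^bsub>M\<^esub> \<in> H"
  using subgroup.one_closed[of H "add_monoid M"] by (simp add: submodule_def)

lemma submodule_Inter:
  assumes "\<And>H. H \<in> F \<Longrightarrow> submodule H R M" "F \<noteq> {}"
  shows "submodule (\<Inter>F) R M"
proof -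
  obtain H where H: "H \<in> F" using assms by auto
  note S = submoduleE[OF assms(1)] submodule_zero[OF assms(1)]
  show ?thesis
  proof (rule submoduleI)
    show "\<Inter>F \<subseteq> carrier M" using H S(1) by blast
  qed (use S in auto)
qed

lemma lin_span_submodule:
  assumes "Z \<subseteq> carrier M" shows "submodule (lin_span R M Z) R M"
  unfolding lin_span_def using assms carrier_is_submodule by (intro submodule_Inter) auto

lemma lin_span_superset: "Z \<subseteq> lin_span R M Z"
  by (auto simp: lin_span_def)

lemma lin_span_least: "submodule H R M \<Longrightarrow> Z \<subseteq> H \<Longrightarrow> lin_span R M Z \<subseteq> H"
  by (auto simp: lin_span_def)

end

lemma mod_quot_simps:
  "carrier (mod_quot A K) = (\<lambda>x. K +>\<^bsub>A\<^esub> x) ` carrier A"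
  "\<zero>\<^bsub>mod_quot A K\<^esub> = K"
  "U \<oplus>\<^bsub>mod_quot A K\<^esub> V = add (A Quot K) U V"
  "U \<otimes>\<^bsub>mod_quot A K\<^esub> V = rcoset_mult A K U V"
  "c \<odot>\<^bsub>mod_quot A K\<^esub> U = (\<Union>x\<in>U. K +>\<^bsub>A\<^esub> (c \<odot>\<^bsub>A\<^esub> x))"
  by (auto simp: mod_quot_def FactRing_def A_RCOSETS_def')

locale module_quotient = module R M for R (structure) and M (structure) +
  fixes K assumes K: "submodule K R M"
begin

sublocale KS: abelian_subgroup K M by (rule submodule_abelian_subgroup[OF K])

lemma coset_in_carrier: "x \<in> carrier M \<Longrightarrow> K +>\<^bsub>M\<^esub> x \<in> carrier (mod_quot M K)"
  by (simp add: mod_quot_simps)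

lemma coset_eq_iff:
  assumes "x \<in> carrier M" "y \<in> carrier M"
  shows "K +>\<^bsub>M\<^esub> x = K +>\<^bsub>M\<^esub> y \<longleftrightarrow> x \<ominus>\<^bsub>M\<^esub> y \<in> K"
proof -
  have "K +>\<^bsub>M\<^esub> x = K +>\<^bsub>M\<^esub> y \<longleftrightarrow> x \<in> K +>\<^bsub>M\<^esub> y"
    using KS.a_rcos_self[OF assms(1)] M.a_repr_independence[OF _ assms(2) KS.a_subgroup]  by auto
  also have "\<dots> \<longleftrightarrow> x \<ominus>\<^bsub>M\<^esub> y \<in> K"
  proof
    assume "x \<in> K +>\<^bsub>M\<^esub> y"
    then obtain k where k: "k \<in> K" "x = k \<oplus>\<^bsub>M\<^esub> y" by (auto simp: a_r_coset_def')
    have "k \<in> carrier M" using k KS.a_subset by auto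
    then have "x \<ominus>\<^bsub>M\<^esub> y = k" using assms k by (simp add: M.minus_eq M.a_assoc M.r_neg)
    with k show "x \<ominus>\<^bsub>M\<^esub> y \<in> K" by simp
  next
    assume "x \<ominus>\<^bsub>M\<^esub> y \<in> K"
    moreover have "x = (x \<ominus>\<^bsub>M\<^esub> y) \<oplus>\<^bsub>M\<^esub> y" using assms by (simp add: M.minus_eq M.a_assoc M.l_neg)
    ultimately show "x \<in> K +>\<^bsub>M\<^esub> y" by (auto simp: a_r_coset_def')
  qed
  finally show ?thesis .
qed

lemma coset_rep:
  assumes "x \<in> carrier M" "y \<in> K +>\<^bsub>M\<^esub> x"
  shows "y \<in> carrier M" "K +>\<^bsub>M\<^esub> y = K +>\<^bsub>M\<^esub> x"
  using assms M.a_repr_independence[OF assms(2,1) KS.a_subgroup] KS.a_subset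
  by (auto simp: a_r_coset_def')

lemma coset_zero: "K +>\<^bsub>M\<^esub> \<zero>\<^bsub>M\<^esub> = K"
  by (simp add: KS.a_subset)

lemma coset_eq_zero_iff:
  assumes "x \<in> carrier M" shows "K +>\<^bsub>M\<^esub> x = K \<longleftrightarrow> x \<in> K"
  using M.a_coset_join1[OF _ assms KS.a_subgroup] M.a_coset_join2[OF assms KS.a_subgroup] by blast

lemma coset_add:
  "x \<in> carrier M \<Longrightarrow> y \<in> carrier M \<Longrightarrow>
    (K +>\<^bsub>M\<^esub> x) \<oplus>\<^bsub>mod_quot M K\<^esub> (K +>\<^bsub>M\<^esub> y) = K +>\<^bsub>M\<^esub> (x \<oplus>\<^bsub>M\<^esub> y)"
  by (simp add: mod_quot_simps FactRing_def KS.a_rcos_sum)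

text \<open>Scalar multiples, products and the adjoint action on quotients are all defined as unions
  over representatives. If the function under the union is constant on the coset, the union
  collapses to one value; this is the form in which well-definedness is checked each time.\<close>

lemma coset_UN:
  assumes "x \<in> carrier M" "\<And>y. y \<in> carrier M \<Longrightarrow> K +>\<^bsub>M\<^esub> y = K +>\<^bsub>M\<^esub> x \<Longrightarrow> f y = f x"
  shows "(\<Union>y\<in>K +>\<^bsub>M\<^esub> x. f y) = f x"
proof -
  have "f y = f x" if "y \<in> K +>\<^bsub>M\<^esub> x" for y using coset_rep[OF assms(1) that] assms(2) by blast
  moreover have "K +>\<^bsub>M\<^esub> x \<noteq> {}" using KS.a_rcos_self[OF assms(1)] by blast
  ultimately show ?thesis by (intro SUP_eq_const)
qed

lemma coset_smult:
  assumes "a \<in> carrier R" "x \<in> carrier M"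
  shows "a \<odot>\<^bsub>mod_quot M K\<^esub> (K +>\<^bsub>M\<^esub> x) = K +>\<^bsub>M\<^esub> (a \<odot>\<^bsub>M\<^esub> x)"
  unfolding mod_quot_simps(5)
proof (rule coset_UN[OF assms(2), of "\<lambda>x. K +>\<^bsub>M\<^esub> (a \<odot>\<^bsub>M\<^esub> x)"])
  fix y assume y: "y \<in> carrier M" "K +>\<^bsub>M\<^esub> y = K +>\<^bsub>M\<^esub> x"
  have "y \<ominus>\<^bsub>M\<^esub> x \<in> K" using y(2) by (rule iffD1[OF coset_eq_iff[OF y(1) assms(2)]])
  then have "a \<odot>\<^bsub>M\<^esub> (y \<ominus>\<^bsub>M\<^esub> x) \<in> K" by (rule submoduleE(4)[OF K assms(1)])
  then show "K +>\<^bsub>M\<^esub> (a \<odot>\<^bsub>M\<^esub> y) = K +>\<^bsub>M\<^esub> (a \<odot>\<^bsub>M\<^esub> x)"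
    using y assms by (simp add: coset_eq_iff M.minus_eq smult_r_distr smult_r_minus)
qed

lemma quotient_module: "module R (mod_quot M K)"
proof (rule moduleI)
  show "abelian_group (mod_quot M K)"
  proof (rule abelian_groupI)
    fix Z assume "Z \<in> carrier (mod_quot M K)"
    then obtain x where x: "x \<in> carrier M" "Z = K +>\<^bsub>M\<^esub> x" by (auto simp: mod_quot_simps(1))
    show "\<exists>Y\<in>carrier (mod_quot M K). Y \<oplus>\<^bsub>mod_quot M K\<^esub> Z = \<zero>\<^bsub>mod_quot M K\<^esub>"
      by (rule bexI[of _ "K +>\<^bsub>M\<^esub> (\<ominus>\<^bsub>M\<^esub> x)"])
        (use x in \<open>simp_all add: coset_add M.l_neg coset_zero mod_quot_simps(2) coset_in_carrier\<close>)
    show "\<zero>\<^bsub>mod_quot M K\<^esub> \<oplus>\<^bsub>mod_quot M K\<^esub> Z = Z"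
      using coset_add[of "\<zero>\<^bsub>M\<^esub>" x] x by (simp add: coset_zero mod_quot_simps(2))
  next
    show "\<zero>\<^bsub>mod_quot M K\<^esub> \<in> carrier (mod_quot M K)"
      using coset_in_carrier[of "\<zero>\<^bsub>M\<^esub>"] by (simp add: coset_zero mod_quot_simps(2))
  qed (unfold mod_quot_simps(1), (elim imageE, simp add: coset_add M.a_ac)+)
qed (unfold mod_quot_simps(1), (rule R.cring_axioms |
      elim imageE, simp add: coset_smult coset_add smult_l_distr smult_r_distr smult_assoc1)+)

lemma coset_minus:
  assumes "x \<in> carrier M" shows "\<ominus>\<^bsub>mod_quot M K\<^esub> (K +>\<^bsub>M\<^esub> x) = K +>\<^bsub>M\<^esub> (\<ominus>\<^bsub>M\<^esub> x)"
proof -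
  interpret Q: module R "mod_quot M K" by (rule quotient_module)
  have "(K +>\<^bsub>M\<^esub> (\<ominus>\<^bsub>M\<^esub> x)) \<oplus>\<^bsub>mod_quot M K\<^esub> (K +>\<^bsub>M\<^esub> x) = \<zero>\<^bsub>mod_quot M K\<^esub>"
    using assms by (simp add: coset_add M.l_neg coset_zero mod_quot_simps(2))
  then show ?thesis using assms by (intro Q.M.minus_equality coset_in_carrier) auto
qed

end

text \<open>Neither associativity nor a Lie identity is assumed, so that one quotient construction
  serves the free magma algebra, the free Lie algebra and the derived algebra modulo its own derived
  algebra.\<close>

locale nonassoc_algebra = module Cx A for A :: "(complex, 'b, 'm) module_scheme" (structure) +
  assumes mult_closed [simp, intro]: "x \<in> carrier A \<Longrightarrow> y \<in> carrier A \<Longrightarrow> x \<otimes> y \<in> carrier A"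
    and mult_l_distr: "x \<in> carrier A \<Longrightarrow> y \<in> carrier A \<Longrightarrow> z \<in> carrier A \<Longrightarrow> (x \<oplus> y) \<otimes> z = x \<otimes> z \<oplus> y \<otimes> z"
    and mult_r_distr: "x \<in> carrier A \<Longrightarrow> y \<in> carrier A \<Longrightarrow> z \<in> carrier A \<Longrightarrow> z \<otimes> (x \<oplus> y) = z \<otimes> x \<oplus> z \<otimes> y"
    and smult_mult_l: "x \<in> carrier A \<Longrightarrow> y \<in> carrier A \<Longrightarrow> (c \<odot> x) \<otimes> y = c \<odot> (x \<otimes> y)"
    and smult_mult_r: "x \<in> carrier A \<Longrightarrow> y \<in> carrier A \<Longrightarrow> x \<otimes> (c \<odot> y) = c \<odot> (x \<otimes> y)"
begin

lemma smult_zero [simp]: "x \<in> carrier A \<Longrightarrow> 0 \<odot> x = \<zero>"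
  using smult_l_null[of x] by simp

lemma smult_minus_one: assumes "x \<in> carrier A" shows "(- 1) \<odot> x = \<ominus> x"
  using smult_l_minus[of 1 x] smult_one[OF assms] assms by simp

lemma mult_minus_l:
  assumes "x \<in> carrier A" "y \<in> carrier A" shows "(\<ominus> x) \<otimes> y = \<ominus> (x \<otimes> y)"
  using smult_mult_l[OF assms, of "-1"] assms by (simp only: smult_minus_one mult_closed)

lemma mult_minus_r:
  assumes "x \<in> carrier A" "y \<in> carrier A" shows "x \<otimes> (\<ominus> y) = \<ominus> (x \<otimes> y)"
  using smult_mult_r[OF assms, of "-1"] assms by (simp only: smult_minus_one mult_closed)

lemma mult_zero_l [simp]: assumes "x \<in> carrier A" shows "\<zero> \<otimes> x = \<zero>"
  using smult_mult_l[OF M.zero_closed assms, of 0] assms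
  by (simp only: smult_zero mult_closed M.zero_closed)

lemma mult_zero_r [simp]: assumes "x \<in> carrier A" shows "x \<otimes> \<zero> = \<zero>"
  using smult_mult_r[OF assms M.zero_closed, of 0] assms
  by (simp only: smult_zero mult_closed M.zero_closed)

end

definition alg_ideal_of :: "(complex, 'b, 'm) module_scheme \<Rightarrow> 'b set \<Rightarrow> bool"
  where "alg_ideal_of A K \<longleftrightarrow> submodule K Cx A \<and>
    (\<forall>x\<in>carrier A. \<forall>k\<in>K. x \<otimes>\<^bsub>A\<^esub> k \<in> K \<and> k \<otimes>\<^bsub>A\<^esub> x \<in> K)"

context nonassoc_algebra
begin

lemma alg_ideal_is_ideal:
  assumes "Z \<subseteq> carrier A" shows "alg_ideal_of A (alg_ideal A Z)"
proof -
  have "submodule (alg_ideal A Z) Cx A"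
    unfolding alg_ideal_def using assms carrier_is_submodule by (intro submodule_Inter) auto
  then show ?thesis unfolding alg_ideal_of_def by (auto simp: alg_ideal_def)
qed

lemma alg_ideal_superset: "Z \<subseteq> alg_ideal A Z"
  by (auto simp: alg_ideal_def)

lemma alg_ideal_least: "alg_ideal_of A K \<Longrightarrow> Z \<subseteq> K \<Longrightarrow> alg_ideal A Z \<subseteq> K"
  by (auto simp: alg_ideal_def alg_ideal_of_def)

end

locale algebra_quotient = nonassoc_algebra A for A :: "(complex, 'b, 'm) module_scheme" (structure) +
  fixes K assumes ideal: "alg_ideal_of A K"
begin

sublocale module_quotient Cx A K
  by (intro module_quotient.intro module_quotient_axioms.intro module_axioms
    conjunct1[OF ideal[unfolded alg_ideal_of_def]])

lemma coset_mult:
  assumes "x \<in> carrier A" "y \<in> carrier A"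
  shows "(K +> x) \<otimes>\<^bsub>mod_quot A K\<^esub> (K +> y) = K +> (x \<otimes> y)"
proof -
  have *: "K +> (x' \<otimes> y') = K +> (x \<otimes> y)"
    if "x' \<in> carrier A" "K +> x' = K +> x" "y' \<in> carrier A" "K +> y' = K +> y" for x' y'
  proof -
    have "x' \<ominus> x \<in> K" "y' \<ominus> y \<in> K"
      using that assms iffD1[OF coset_eq_iff] by blast+
    then have "(x' \<ominus> x) \<otimes> y' \<in> K" "x \<otimes> (y' \<ominus> y) \<in> K"
      using that(1,3) assms ideal unfolding alg_ideal_of_def by blast+
    then have "(x' \<ominus> x) \<otimes> y' \<oplus> x \<otimes> (y' \<ominus> y) \<in> K" by (rule KS.a_closed)
    also have "(x' \<ominus> x) \<otimes> y' \<oplus> x \<otimes> (y' \<ominus> y) = (x' \<otimes> y' \<ominus> x \<otimes> y') \<oplus> (x \<otimes> y' \<ominus> x \<otimes> y)"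
      using that(1,3) assms by (simp add: M.minus_eq mult_l_distr mult_r_distr mult_minus_l mult_minus_r)
    also have "\<dots> = x' \<otimes> y' \<ominus> x \<otimes> y"
      using that(1,3) assms by (simp add: M.minus_eq M.a_assoc M.r_neg1)
    finally show ?thesis using that(1,3) assms by (simp add: coset_eq_iff)
  qed
  have inner: "(\<Union>b\<in>K +> y. K +> (a \<otimes> b)) = K +> (x \<otimes> y)"
    if a: "a \<in> carrier A" "K +> a = K +> x" for a
  proof -
    have "(\<Union>b\<in>K +> y. K +> (a \<otimes> b)) = K +> (a \<otimes> y)"
      by (rule coset_UN[OF assms(2)]) (metis * a assms)
    with * a assms(2) show ?thesis by simp
  qed
  show ?thesis
    unfolding mod_quot_simps rcoset_mult_def
    by (subst coset_UN[OF assms(1)]) (simp_all add: inner assms)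
qed

lemma quotient_algebra: "nonassoc_algebra (mod_quot A K)"
proof (intro nonassoc_algebra.intro quotient_module nonassoc_algebra_axioms.intro)
qed (unfold mod_quot_simps(1), (elim imageE, simp add: coset_mult coset_add coset_smult
  mult_l_distr mult_r_distr smult_mult_l smult_mult_r)+)

end

section \<open>Formal linear combinations and the free non-associative algebra\<close>

abbreviation supp :: "('a \<Rightarrow>\<^sub>0 'b::zero) \<Rightarrow> 'a set"
  where "supp \<equiv> Poly_Mapping.keys"

abbreviation coef :: "('a \<Rightarrow>\<^sub>0 'b::zero) \<Rightarrow> 'a \<Rightarrow> 'b"
  where "coef \<equiv> Poly_Mapping.lookup"

abbreviation pm_scale :: "complex \<Rightarrow> ('a \<Rightarrow>\<^sub>0 complex) \<Rightarrow> 'a \<Rightarrow>\<^sub>0 complex"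
  where "pm_scale c \<equiv> Poly_Mapping.map ((*) c)"

lemma lookup_pm_scale [simp]: "coef (pm_scale c p) k = c * coef p k"
  by (simp add: Poly_Mapping.map.rep_eq when_def)

lemma keys_pm_scale: "supp (pm_scale c p) \<subseteq> supp p"
  by (auto simp: in_keys_iff)

lemma pm_scale_add: "pm_scale c (p + q) = pm_scale c p + pm_scale c q"
  by (intro poly_mapping_eqI) (simp add: lookup_add algebra_simps)

lemma pm_scale_add_left: "pm_scale (c + d) p = pm_scale c p + pm_scale d p"
  by (intro poly_mapping_eqI) (simp add: lookup_add algebra_simps)

lemma pm_scale_mult: "pm_scale (c * d) p = pm_scale c (pm_scale d p)"
  by (intro poly_mapping_eqI) (simp add: algebra_simps)

lemma pm_scale_one [simp]: "pm_scale 1 p = p"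
  by (intro poly_mapping_eqI) simp

lemma pm_sum_monomials: "(\<Sum>t\<in>supp p. Poly_Mapping.single t (coef p t)) = p"
proof (rule poly_mapping_eqI)
  fix k
  have "coef (\<Sum>t\<in>supp p. Poly_Mapping.single t (coef p t)) k
      = (\<Sum>t\<in>supp p. if k = t then coef p t else 0)"
    unfolding lookup_sum by (intro sum.cong) (auto simp: lookup_single when_def)
  then show "coef (\<Sum>t\<in>supp p. Poly_Mapping.single t (coef p t)) k = coef p k"
    by (simp add: in_keys_iff)
qed

lemma keys_minus_subset: "supp (p - q) \<subseteq> supp p \<union> supp (q :: 'a \<Rightarrow>\<^sub>0 'b::ab_group_add)"
  by (auto simp: in_keys_iff lookup_minus)

lemma chains1_simps [simp]:
  "carrier (chains1 G) = {c. supp c \<subseteq> carrier G}" "c \<oplus>\<^bsub>chains1 G\<^esub> d = c + d"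
  "\<zero>\<^bsub>chains1 G\<^esub> = 0" "a \<odot>\<^bsub>chains1 G\<^esub> c = pm_scale a c"
  by (simp_all add: chains1_def)

lemma free_nonassoc_simps [simp]:
  "carrier (free_nonassoc Z) = {p. \<forall>t\<in>supp p. set_mag t \<subseteq> Z}" "p \<oplus>\<^bsub>free_nonassoc Z\<^esub> q = p + q"
  "\<zero>\<^bsub>free_nonassoc Z\<^esub> = 0" "a \<odot>\<^bsub>free_nonassoc Z\<^esub> p = pm_scale a p"
  by (simp_all add: free_nonassoc_def)

lemma pm_abelian_group:
  assumes "add M = (+)" "\<zero>\<^bsub>M\<^esub> = 0" "carrier M = {p :: 'a \<Rightarrow>\<^sub>0 complex. supp p \<subseteq> K}"
  shows "abelian_group M"
proof (rule abelian_groupI)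
  fix p assume "p \<in> carrier M"
  then show "\<exists>y\<in>carrier M. y \<oplus>\<^bsub>M\<^esub> p = \<zero>\<^bsub>M\<^esub>"
    using assms by (intro bexI[of _ "- p"]) auto
next
  fix p q assume "p \<in> carrier M" "q \<in> carrier M"
  then show "p \<oplus>\<^bsub>M\<^esub> q \<in> carrier M"
    using assms Poly_Mapping.keys_add[of p q] by auto
qed (use assms in \<open>auto simp: algebra_simps\<close>)

lemma pm_module:
  assumes "add M = (+)" "\<zero>\<^bsub>M\<^esub> = 0" "carrier M = {p :: 'a \<Rightarrow>\<^sub>0 complex. supp p \<subseteq> K}"
    "module.smult M = pm_scale"
  shows "module Cx M"
proof (rule moduleI)
  show "cring Cx" by (rule cring_from_type_algebra)
  show "abelian_group M" by (rule pm_abelian_group[OF assms(1-3)])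
qed (use assms in \<open>auto simp: pm_scale_add pm_scale_add_left pm_scale_mult
      dest!: subsetD subsetD[OF keys_pm_scale]\<close>)

lemma chains1_module: "module Cx (chains1 G)"
  by (rule pm_module[where K = "carrier G"]) (simp_all add: chains1_def)

lemma lookup_free_nonassoc_mult:
  "coef (p \<otimes>\<^bsub>free_nonassoc Z\<^esub> q) t = (case t of Gen v \<Rightarrow> 0 | Node s t \<Rightarrow> coef p s * coef q t)"
proof (cases t)
  case (Gen v)
  then show ?thesis by (simp add: free_nonassoc_def lookup_sum lookup_single)
next
  case (Node a b)
  have "coef (p \<otimes>\<^bsub>free_nonassoc Z\<^esub> q) t =
      (\<Sum>s\<in>supp p. \<Sum>t'\<in>supp q. if a = s \<and> b = t' then coef p s * coef q t' else 0)"
    using Node by (auto simp: free_nonassoc_def lookup_sum lookup_single when_def intro!: sum.cong)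
  also have "\<dots> = (\<Sum>s\<in>supp p. if a = s then coef p s * coef q b else 0)"
    by (intro sum.cong refl) (auto simp: in_keys_iff)
  also have "\<dots> = coef p a * coef q b" by (auto simp: in_keys_iff)
  finally show ?thesis using Node by simp
qed

lemma free_nonassoc_algebra: "nonassoc_algebra (free_nonassoc Z)"
proof (intro nonassoc_algebra.intro nonassoc_algebra_axioms.intro)
  show "module Cx (free_nonassoc Z)"
    by (rule pm_module[where K = "{t. set_mag t \<subseteq> Z}"]) (auto simp: free_nonassoc_def)
next
  fix p q assume *: "p \<in> carrier (free_nonassoc Z)" "q \<in> carrier (free_nonassoc Z)"
  have "set_mag t \<subseteq> Z" if "t \<in> supp (p \<otimes>\<^bsub>free_nonassoc Z\<^esub> q)" for t
    using that * by (cases t) (auto simp: in_keys_iff lookup_free_nonassoc_mult)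
  then show "p \<otimes>\<^bsub>free_nonassoc Z\<^esub> q \<in> carrier (free_nonassoc Z)" by simp
qed (auto intro!: poly_mapping_eqI
      simp: lookup_add lookup_free_nonassoc_mult algebra_simps split: mag.splits)

lemma free_nonassoc_single_mult:
  "Poly_Mapping.single s c \<otimes>\<^bsub>free_nonassoc Z\<^esub> Poly_Mapping.single t d = Poly_Mapping.single (Node s t) (c * d)"
  by (rule poly_mapping_eqI)
    (auto simp: lookup_free_nonassoc_mult lookup_single when_def split: mag.splits)

text \<open>A finitely supported function is the finite sum of its monomials. The rule serves for
  chains, for sums of trees and for polynomials alike; a bilinear identity is proved by applying it
  once in each argument.\<close>

lemma pm_span_induct:
  assumes "supp p \<subseteq> K" "0 \<in> H" "\<And>p q. p \<in> H \<Longrightarrow> q \<in> H \<Longrightarrow> p + q \<in> H"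
    and "\<And>c p. p \<in> H \<Longrightarrow> pm_scale c p \<in> H" and "\<And>t. t \<in> K \<Longrightarrow> Poly_Mapping.single t 1 \<in> H"
  shows "p \<in> H"
proof -
  have single: "Poly_Mapping.single t (coef p t) \<in> H" if "t \<in> supp p" for t
    using assms(4)[OF assms(5), of t "coef p t"] that assms(1) by auto
  have "(\<Sum>t\<in>A. Poly_Mapping.single t (coef p t)) \<in> H" if "A \<subseteq> supp p" "finite A" for A
    using that(2,1) by (induction A rule: finite_induct) (auto intro: assms single)
  from this[of "supp p"] show ?thesis by (simp add: pm_sum_monomials)
qed

section \<open>Linear extension of polynomial-valued functions on a basis\<close>

definition const_poly :: "complex \<Rightarrow> 'v cpoly"
  where "const_poly c = Poly_Mapping.single 0 c"

lemma const_poly_simps [simp]: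
  "const_poly 0 = 0" "const_poly 1 = 1" "const_poly (c + d) = const_poly c + const_poly d"
  "const_poly (c * d) = const_poly c * const_poly d" "const_poly (- c) = - const_poly c"
  "const_poly (c - d) = const_poly c - const_poly d"
  by (simp_all add: const_poly_def single_add mult_single single_uminus single_diff)

definition lin_ext :: "('k \<Rightarrow> 'v cpoly) \<Rightarrow> ('k \<Rightarrow>\<^sub>0 complex) \<Rightarrow> 'v cpoly"
  where "lin_ext f p = (\<Sum>k\<in>supp p. const_poly (coef p k) * f k)"

lemma lin_ext_superset:
  assumes "finite A" "supp p \<subseteq> A" shows "lin_ext f p = (\<Sum>k\<in>A. const_poly (coef p k) * f k)"
  unfolding lin_ext_def using assms by (intro sum.mono_neutral_left) (auto simp: in_keys_iff)

lemma lin_ext_add: "lin_ext f (p + q) = lin_ext f p + lin_ext f q"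
  unfolding lin_ext_def by (rule setsum_keys_plus_distrib) (auto simp: algebra_simps)

lemma lin_ext_scale: "lin_ext f (pm_scale c p) = const_poly c * lin_ext f p"
  using lin_ext_superset[OF finite_keys keys_pm_scale, of f c p]
  by (simp add: lin_ext_def sum_distrib_left mult.assoc)

lemma lin_ext_zero [simp]: "lin_ext f 0 = 0"
  by (simp add: lin_ext_def)

lemma lin_ext_uminus: "lin_ext f (- p) = - lin_ext f p"
  using lin_ext_add[of f p "- p"] by (simp add: eq_neg_iff_add_eq_0 add.commute)

lemma lin_ext_diff: "lin_ext f (p - q) = lin_ext f p - lin_ext f q"
  using lin_ext_add[of f p "- q"] by (simp add: lin_ext_uminus)

lemma lin_ext_single [simp]: "lin_ext f (Poly_Mapping.single k c) = const_poly c * f k"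
  by (cases "c = 0") (auto simp: lin_ext_def)

lemma lin_ext_sum: "lin_ext f (sum g A) = (\<Sum>a\<in>A. lin_ext f (g a))"
  by (induction A rule: infinite_finite_induct) (auto simp: lin_ext_add)

lemma lin_ext_mult:
  "lin_ext f (p \<otimes>\<^bsub>free_nonassoc Z\<^esub> q) =
    (\<Sum>s\<in>supp p. \<Sum>t\<in>supp q. const_poly (coef p s) * const_poly (coef q t) * f (Node s t))"
  by (simp add: free_nonassoc_def lin_ext_sum)

section \<open>The free group of reduced words\<close>

abbreviation inv_letter :: "nat \<times> bool \<Rightarrow> nat \<times> bool"
  where "inv_letter a \<equiv> (fst a, \<not> snd a)"

definition inv_word :: "word \<Rightarrow> word"
  where "inv_word w = rev (map inv_letter w)"

lemma reduced_Cons: "reduced (a # w) \<longleftrightarrow> reduced w \<and> (w \<noteq> [] \<longrightarrow> \<not> inverse_letters a (hd w))"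
  by (cases w) auto

lemma reduced_push_letter: "reduced w \<Longrightarrow> reduced (push_letter a w)"
  by (cases w) (auto simp: reduced_Cons)

lemma reduced_foldr_push_letter: "reduced w \<Longrightarrow> reduced (foldr push_letter u w)"
  by (induction u) (auto intro: reduced_push_letter)

lemma push_letter_reduced_Cons: "reduced (a # w) \<Longrightarrow> push_letter a w = a # w"
  by (cases w) auto

text \<open>Letters act on the set of reduced words, and inverse letters act by mutually inverse
  maps. This is van der Waerden's device: associativity of the product of reduced words is inherited
  from the composition of these maps.\<close>

lemma push_letter_cancel:
  assumes "reduced w" "inverse_letters a b" shows "push_letter a (push_letter b w) = w"
proof (cases w)
  case (Cons c v)
  show ?thesis
  proof (cases "inverse_letters b c")
    case True
    with assms(2) have "a = c" by (auto simp: prod_eq_iff)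
    with True Cons assms(1) show ?thesis by (simp add: push_letter_reduced_Cons)
  qed (use Cons assms in auto)
qed (use assms in auto)

lemma set_push_letter: "set (push_letter a w) \<subseteq> insert a (set w)"
  by (cases w) auto

lemma set_foldr_push_letter: "set (foldr push_letter u w) \<subseteq> set u \<union> set w"
  by (induction u) (use set_push_letter in fastforce)+

lemma letters_foldr_push_letter:
  "fst ` set u \<subseteq> S \<Longrightarrow> fst ` set w \<subseteq> S \<Longrightarrow> fst ` set (foldr push_letter u w) \<subseteq> S"
  using set_foldr_push_letter[of u w] by blast

lemma foldr_push_letter_assoc:
  assumes "reduced w"
  shows "foldr push_letter (push_letter a v) w = push_letter a (foldr push_letter v w)"
proof (cases v)
  case (Cons b v')
  then show ?thesis
    using push_letter_cancel[OF reduced_foldr_push_letter[OF assms, of v'], of a b] by auto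
qed simp

lemma foldr_foldr_push_letter:
  "reduced w \<Longrightarrow> foldr push_letter (foldr push_letter u v) w = foldr push_letter u (foldr push_letter v w)"
  by (induction u) (auto simp: foldr_push_letter_assoc)

lemma foldr_inv_word: "reduced w \<Longrightarrow> foldr push_letter (inv_word w) w = []"
proof (induction w)
  case (Cons a w)
  then have "push_letter (inv_letter a) (a # w) = w" by simp
  with Cons show ?case by (simp add: inv_word_def reduced_Cons)
qed (simp add: inv_word_def)

lemma free_group_carrier: "carrier (free_group n) = {w. reduced w \<and> fst ` set w \<subseteq> {1..n}}"
  and free_group_mult: "u \<otimes>\<^bsub>free_group n\<^esub> v = foldr push_letter u v"
  and free_group_one: "\<one>\<^bsub>free_group n\<^esub> = []"
  by (simp_all add: free_group_def)

lemma foldr_push_letter_carrier: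
  assumes "fst ` set u \<subseteq> {1..n}" "w \<in> carrier (free_group n)"
  shows "foldr push_letter u w \<in> carrier (free_group n)"
  using assms letters_foldr_push_letter[of u _ w] by (simp add: free_group_carrier reduced_foldr_push_letter)

lemma free_group_group: "group (free_group n)"
proof (rule groupI)
  fix u v w assume *: "u \<in> carrier (free_group n)" "v \<in> carrier (free_group n)" "w \<in> carrier (free_group n)"
  show "u \<otimes>\<^bsub>free_group n\<^esub> v \<otimes>\<^bsub>free_group n\<^esub> w = u \<otimes>\<^bsub>free_group n\<^esub> (v \<otimes>\<^bsub>free_group n\<^esub> w)"
    using * by (simp add: free_group_mult foldr_foldr_push_letter free_group_carrier)
next
  fix w assume w: "w \<in> carrier (free_group n)"
  \<comment> \<open>Pushing the letters of \<open>inv_word w\<close> onto the empty word yields a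
    reduced word, whether or not \<open>inv_word w\<close> is known to be reduced.\<close>
  let ?v = "foldr push_letter (inv_word w) []"
  have "?v \<in> carrier (free_group n)"
    using w by (intro foldr_push_letter_carrier) (auto simp: free_group_carrier inv_word_def)
  moreover have "?v \<otimes>\<^bsub>free_group n\<^esub> w = \<one>\<^bsub>free_group n\<^esub>"
    using w by (simp add: free_group_mult free_group_one free_group_carrier foldr_foldr_push_letter foldr_inv_word)
  ultimately show "\<exists>y\<in>carrier (free_group n). y \<otimes>\<^bsub>free_group n\<^esub> w = \<one>\<^bsub>free_group n\<^esub>" by blast
next
  fix u v assume "u \<in> carrier (free_group n)" "v \<in> carrier (free_group n)"
  then show "u \<otimes>\<^bsub>free_group n\<^esub> v \<in> carrier (free_group n)"
    unfolding free_group_mult by (intro foldr_push_letter_carrier) (auto simp: free_group_carrier)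
qed (auto simp: free_group_mult free_group_one free_group_carrier)

interpretation F: group "free_group n" for n by (rule free_group_group)

lemma letter_carrier: "fst a \<in> {1..n} \<Longrightarrow> [a] \<in> carrier (free_group n)"
  by (simp add: free_group_carrier)

lemma inv_letter_word: "fst a \<in> {1..n} \<Longrightarrow> inv\<^bsub>free_group n\<^esub> [a] = [inv_letter a]"
  by (rule F.inv_equality) (auto simp: letter_carrier free_group_mult free_group_one)

section \<open>Evaluation of words in a group, and freeness\<close>

definition letter_val :: "('g, 'm) monoid_scheme \<Rightarrow> (nat \<Rightarrow> 'g) \<Rightarrow> nat \<times> bool \<Rightarrow> 'g"
  where "letter_val G f a = (if snd a then f (fst a) else inv\<^bsub>G\<^esub> (f (fst a)))"

lemma word_eval_simps [simp]:
  "word_eval G f [] = \<one>\<^bsub>G\<^esub>" "word_eval G f (a # w) = letter_val G f a \<otimes>\<^bsub>G\<^esub> word_eval G f w"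
  by (auto simp: word_eval_def letter_val_def split: prod.split)

context group
begin

lemma letter_val_closed: "f \<in> {1..n} \<rightarrow> carrier G \<Longrightarrow> fst a \<in> {1..n} \<Longrightarrow> letter_val G f a \<in> carrier G"
  by (auto simp: letter_val_def)

lemma word_eval_closed:
  "f \<in> {1..n} \<rightarrow> carrier G \<Longrightarrow> fst ` set w \<subseteq> {1..n} \<Longrightarrow> word_eval G f w \<in> carrier G"
  by (induction w) (auto simp: letter_val_closed)

lemma word_eval_push_letter:
  assumes "f \<in> {1..n} \<rightarrow> carrier G" "fst ` set (a # w) \<subseteq> {1..n}"
  shows "word_eval G f (push_letter a w) = letter_val G f a \<otimes> word_eval G f w"
proof (cases w)
  case (Cons b v)
  have c: "letter_val G f a \<in> carrier G" "letter_val G f b \<in> carrier G" "word_eval G f v \<in> carrier G"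
    using assms(2) Cons by (simp_all add: letter_val_closed[OF assms(1)] word_eval_closed[OF assms(1)])
  have "letter_val G f a \<otimes> letter_val G f b = \<one>" if "inverse_letters a b"
  proof -
    have "f (fst b) \<in> carrier G" using assms Cons by auto
    with that show ?thesis by (auto simp: letter_val_def)
  qed
  with Cons c show ?thesis by (auto simp: m_assoc[symmetric])
qed simp

lemma word_eval_foldr_push_letter:
  assumes "f \<in> {1..n} \<rightarrow> carrier G" "fst ` set u \<subseteq> {1..n}" "fst ` set w \<subseteq> {1..n}"
  shows "word_eval G f (foldr push_letter u w) = word_eval G f u \<otimes> word_eval G f w"
  using assms(2)
proof (induction u)
  case Nil
  then show ?case using word_eval_closed[OF assms(1,3)] by simp
next
  case (Cons a u)
  have "fst ` set (a # foldr push_letter u w) \<subseteq> {1..n}"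
    using letters_foldr_push_letter[of u _ w] Cons.prems assms(3) by auto
  then show ?case
    using Cons assms(1,3) by (simp add: word_eval_push_letter[OF assms(1)] m_assoc letter_val_closed word_eval_closed)
qed

lemma word_eval_hom:
  assumes "f \<in> {1..n} \<rightarrow> carrier G" shows "word_eval G f \<in> hom (free_group n) G"
  using assms by (intro homI) (auto simp: free_group_carrier free_group_mult word_eval_closed word_eval_foldr_push_letter)

end

text \<open>A reduced word \<open>a # w\<close> is the product of \<open>[a]\<close> and
  \<open>w\<close> without cancellation, so induction on the word recovers the homomorphism from its
  values on the letters. This is the uniqueness half of freeness; \<open>word_eval_hom\<close> is
  the existence half.\<close>

lemma hom_eq_word_eval:
  assumes "group G" "h \<in> hom (free_group n) G" "w \<in> carrier (free_group n)"
  shows "h w = word_eval G (\<lambda>k. h [(k, True)]) w"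
proof -
  interpret group G by fact
  interpret h: group_hom "free_group n" G h
    using assms(2) by unfold_locales
  show ?thesis using assms(3)
  proof (induction w)
    case (Cons a w)
    then have w: "w \<in> carrier (free_group n)" "fst a \<in> {1..n}" and r: "reduced (a # w)"
      by (auto simp: free_group_carrier reduced_Cons)
    have "a # w = [a] \<otimes>\<^bsub>free_group n\<^esub> w"
      using push_letter_reduced_Cons[OF r] by (simp add: free_group_mult)
    then have "h (a # w) = h [a] \<otimes>\<^bsub>G\<^esub> h w" using w letter_carrier by simp
    moreover have "h [a] = letter_val G (\<lambda>k. h [(k, True)]) a"
      using inv_letter_word[of "(fst a, True)" n] w letter_carrier[of "(fst a, True)" n]
      by (cases a) (auto simp: letter_val_def h.hom_inv[symmetric])
    ultimately show ?case using Cons w by simp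
  qed (use h.hom_one in \<open>simp add: free_group_one\<close>)
qed

lemma hom_eqI:
  assumes "group G" "h \<in> hom (free_group n) G" "h' \<in> hom (free_group n) G"
    and "\<And>k. k \<in> {1..n} \<Longrightarrow> h [(k, True)] = h' [(k, True)]" and w: "w \<in> carrier (free_group n)"
  shows "h w = h' w"
proof -
  have "word_eval G (\<lambda>k. h [(k, True)]) v = word_eval G (\<lambda>k. h' [(k, True)]) v"
    if "fst ` set v \<subseteq> {1..n}" for v
    using that by (induction v) (auto simp: letter_val_def assms(4))
  then show ?thesis
    using hom_eq_word_eval[OF assms(1,2) w] hom_eq_word_eval[OF assms(1,3) w] w
    by (simp add: free_group_carrier)
qed

section \<open>The upper McCool groups\<close>

text \<open>The Boolean selects conjugation by \<open>x_j\<close> or by its inverse, so that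
  \<open>alpha\<close> and its inverse are treated at once.\<close>

definition conj_gen :: "nat \<Rightarrow> nat \<Rightarrow> bool \<Rightarrow> nat \<Rightarrow> word"
  where "conj_gen i j e k = (if k = i then [(j, e), (i, True), (j, \<not> e)] else [(k, True)])"

definition conj_aut :: "nat \<Rightarrow> nat \<Rightarrow> nat \<Rightarrow> bool \<Rightarrow> word \<Rightarrow> word"
  where "conj_aut n i j e = (\<lambda>w\<in>carrier (free_group n). word_eval (free_group n) (conj_gen i j e) w)"

lemma alpha_eq_conj_aut: "alpha n i j = conj_aut n i j True"
  by (simp add: alpha_def conj_aut_def conj_gen_def[abs_def] cong: if_cong)

lemma inv_word_free_group:
  assumes "w \<in> carrier (free_group n)" "inv_word w \<in> carrier (free_group n)"
  shows "inv\<^bsub>free_group n\<^esub> w = inv_word w"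
  using assms by (intro F.inv_equality) (auto simp: free_group_mult free_group_one free_group_carrier foldr_inv_word)

lemma conj_gen_carrier:
  "i \<noteq> j \<Longrightarrow> j \<in> {1..n} \<Longrightarrow> k \<in> {1..n} \<Longrightarrow> conj_gen i j e k \<in> carrier (free_group n)"
  by (auto simp: conj_gen_def free_group_carrier)

lemma letter_val_conj_gen:
  assumes "i \<noteq> j" "j \<in> {1..n}" "fst a \<in> {1..n}"
  shows "letter_val (free_group n) (conj_gen i j e) a =
    (if fst a = i then [(j, e), a, (j, \<not> e)] else [a])"
proof -
  have "inv\<^bsub>free_group n\<^esub> (conj_gen i j e k) =
      (if k = i then [(j, e), (i, False), (j, \<not> e)] else [(k, False)])" if "k \<in> {1..n}" for k
    using that assms conj_gen_carrier[of i j n k e]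
    by (subst inv_word_free_group) (auto simp: conj_gen_def inv_word_def free_group_carrier)
  from this[OF assms(3)] show ?thesis by (cases a) (auto simp: letter_val_def conj_gen_def)
qed

lemma conj_aut_letter:
  assumes "i \<noteq> j" "j \<in> {1..n}" "fst a \<in> {1..n}"
  shows "conj_aut n i j e [a] = (if fst a = i then [(j, e), a, (j, \<not> e)] else [a])"
  using assms letter_val_conj_gen[OF assms]
  by (auto simp: conj_aut_def free_group_carrier free_group_mult free_group_one)

lemma conj_aut_hom:
  assumes "i \<noteq> j" "j \<in> {1..n}" shows "conj_aut n i j e \<in> hom (free_group n) (free_group n)"
proof -
  have "word_eval (free_group n) (conj_gen i j e) \<in> hom (free_group n) (free_group n)"
    using assms conj_gen_carrier by (intro F.word_eval_hom) auto
  then show ?thesis unfolding conj_aut_def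
    by (auto simp: hom_def Pi_def F.m_closed)
qed

text \<open>On an explicit word, evaluation becomes substitution followed by free reduction, which
  simplification can carry out. The identities between automorphisms are verified in this way on the
  generators.\<close>

lemma conj_aut_apply:
  assumes "i \<noteq> j" "j \<in> {1..n}" "w \<in> carrier (free_group n)"
  shows "conj_aut n i j e w = foldr push_letter (concat (map (\<lambda>a. if fst a = i then [(j, e), a, (j, \<not> e)] else [a]) w)) []"
proof -
  have "word_eval (free_group n) (conj_gen i j e) w =
     foldr push_letter (concat (map (\<lambda>a. if fst a = i then [(j, e), a, (j, \<not> e)] else [a]) w)) []"
    if "fst ` set w \<subseteq> {1..n}" for w
    using that
    by (induction w) (simp_all add: letter_val_conj_gen[OF assms(1,2)] free_group_one free_group_mult)
  then show ?thesis using assms(3) by (simp add: conj_aut_def free_group_carrier)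
qed

lemma conj_aut_inverse:
  assumes "i \<noteq> j" "i \<in> {1..n}" "j \<in> {1..n}" "w \<in> carrier (free_group n)"
  shows "conj_aut n i j e (conj_aut n i j (\<not> e) w) = w"
proof -
  have h: "conj_aut n i j e \<circ> conj_aut n i j (\<not> e) \<in> hom (free_group n) (free_group n)"
    using conj_aut_hom[OF assms(1,3)] by (intro hom_compose)
  have "id w = (conj_aut n i j e \<circ> conj_aut n i j (\<not> e)) w"
  proof (rule hom_eqI[OF free_group_group _ h _ assms(4)])
    fix k assume "k \<in> {1..n}"
    then show "id [(k, True)] = (conj_aut n i j e \<circ> conj_aut n i j (\<not> e)) [(k, True)]"
      using assms(1-3)
      by (auto simp: conj_aut_letter conj_aut_apply free_group_carrier)
  qed (auto simp: hom_def)
  then show ?thesis by simp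
qed

lemma conj_aut_auto:
  assumes "i \<noteq> j" "i \<in> {1..n}" "j \<in> {1..n}"
  shows "conj_aut n i j e \<in> auto (free_group n)"
proof -
  have c: "conj_aut n i j e w \<in> carrier (free_group n)" if "w \<in> carrier (free_group n)" for w e
    using conj_aut_hom[OF assms(1,3)] that by (auto simp: hom_def)
  have "bij_betw (conj_aut n i j e) (carrier (free_group n)) (carrier (free_group n))"
    by (rule bij_betw_byWitness[where f' = "conj_aut n i j (\<not> e)"])
      (use conj_aut_inverse[OF assms, of _ e] conj_aut_inverse[OF assms, of _ "\<not> e"] c in auto)
  moreover have "conj_aut n i j e \<in> extensional (carrier (free_group n))" by (simp add: conj_aut_def)
  ultimately show ?thesis
    using conj_aut_hom[OF assms(1,3)] by (simp add: auto_def Bij_def)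
qed

abbreviation Aut_F :: "nat \<Rightarrow> (word \<Rightarrow> word) monoid"
  where "Aut_F n \<equiv> AutoGroup (free_group n)"

lemma Aut_F_carrier: "carrier (Aut_F n) = auto (free_group n)"
  by (simp add: AutoGroup_def)

lemma Aut_F_mult:
  assumes "f \<in> auto (free_group n)" "g \<in> auto (free_group n)"
  shows "f \<otimes>\<^bsub>Aut_F n\<^esub> g = compose (carrier (free_group n)) f g"
  using assms by (simp add: AutoGroup_def BijGroup_def auto_def)

lemma Aut_F_one: "\<one>\<^bsub>Aut_F n\<^esub> = (\<lambda>w\<in>carrier (free_group n). w)"
  by (simp add: AutoGroup_def BijGroup_def)

lemma Aut_F_group: "group (Aut_F n)"
  by (rule group.AutoGroup[OF free_group_group])

interpretation AutF: group "Aut_F n" for n by (rule Aut_F_group)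

lemma inv_alpha:
  assumes "i \<noteq> j" "i \<in> {1..n}" "j \<in> {1..n}"
  shows "inv\<^bsub>Aut_F n\<^esub> (alpha n i j) = conj_aut n i j False"
proof (rule AutF.inv_equality)
  show "conj_aut n i j False \<otimes>\<^bsub>Aut_F n\<^esub> alpha n i j = \<one>\<^bsub>Aut_F n\<^esub>"
    unfolding alpha_eq_conj_aut Aut_F_mult[OF conj_aut_auto[OF assms] conj_aut_auto[OF assms]] Aut_F_one
    using conj_aut_inverse[OF assms, of _ False] by (auto simp: compose_def)
qed (auto simp: alpha_eq_conj_aut Aut_F_carrier conj_aut_auto[OF assms])

abbreviation edges :: "nat \<Rightarrow> (nat \<times> nat) set"
  where "edges n \<equiv> set (index_pairs n)"

lemma edges_iff [simp]: "(i, j) \<in> edges n \<longleftrightarrow> 1 \<le> j \<and> j < i \<and> i \<le> n"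
proof -
  have "edges n = (\<Union>i\<in>{1..<n + 1}. Pair i ` {1..<i})" by (simp add: index_pairs_def del: upt_Suc)
  then show ?thesis by (auto simp: image_iff simp del: One_nat_def)
qed

lemma distinct_index_pairs: "distinct (index_pairs n)"
proof (induction n)
  case (Suc n)
  have "index_pairs (Suc n) = index_pairs n @ map (Pair (Suc n)) [1..<Suc n]"
    by (simp add: index_pairs_def del: upt_Suc) (simp add: upt_Suc)
  with Suc show ?case by (auto simp: distinct_map inj_on_def simp del: upt_Suc)
qed (simp add: index_pairs_def)

lemma upper_McCool_carrier:
  "carrier (upper_McCool n) = generate (Aut_F n) {alpha n i j | i j. 1 \<le> j \<and> j < i \<and> i \<le> n}"
proof -
  have "{alpha n i j | i j. 1 \<le> j \<and> j < i \<and> i \<le> n} \<subseteq> carrier (Aut_F n)"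
    by (auto simp: alpha_eq_conj_aut Aut_F_carrier intro!: conj_aut_auto)
  then show ?thesis
    by (simp add: upper_McCool_def carrier_subgroup_generated Int_absorb1)
qed

lemma upper_McCool_group: "group (upper_McCool n)"
  unfolding upper_McCool_def by (rule AutF.group_subgroup_generated)

lemma upper_McCool_mult: "g \<otimes>\<^bsub>upper_McCool n\<^esub> h = g \<otimes>\<^bsub>Aut_F n\<^esub> h"
  by (simp add: upper_McCool_def)

lemma upper_McCool_auto: "g \<in> carrier (upper_McCool n) \<Longrightarrow> g \<in> auto (free_group n)"
  using AutF.carrier_subgroup_generated_subset by (auto simp: upper_McCool_def Aut_F_carrier[symmetric])

lemma alpha_carrier: "(i, j) \<in> edges n \<Longrightarrow> alpha n i j \<in> carrier (upper_McCool n)"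
  unfolding upper_McCool_carrier by (rule generate.incl) auto

text \<open>The unit and the inverse generators appear in the cases as explicit maps of words, not
  as abstract elements of a generated subgroup, so that Magnus coefficients can be read off by
  evaluation.\<close>

lemma upper_McCool_induct [consumes 1, case_names one alpha inv mult]:
  assumes "g \<in> carrier (upper_McCool n)"
    and "P (\<one>\<^bsub>Aut_F n\<^esub>)" "\<And>i j. (i, j) \<in> edges n \<Longrightarrow> P (alpha n i j)"
    and "\<And>i j. (i, j) \<in> edges n \<Longrightarrow> P (conj_aut n i j False)"
    and "\<And>g h. g \<in> carrier (upper_McCool n) \<Longrightarrow> h \<in> carrier (upper_McCool n) \<Longrightarrow> P g \<Longrightarrow> P h \<Longrightarrow>
      P (g \<otimes>\<^bsub>upper_McCool n\<^esub> h)"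
  shows "P g"
  using assms(1) unfolding upper_McCool_carrier
proof (induction g rule: generate.induct)
  case one
  then show ?case by (rule assms(2))
next
  case (incl h)
  then show ?case using assms(3) by auto
next
  case (inv h)
  then obtain i j where "h = alpha n i j" "1 \<le> j" "j < i" "i \<le> n" by auto
  then show ?case using assms(4)[of i j] by (simp add: inv_alpha)
next
  case (eng g h)
  then show ?case using assms(5)[of g h] by (simp add: upper_McCool_carrier upper_McCool_mult)
qed

lemma Aut_F_eqI:
  assumes "f \<in> auto (free_group n)" "g \<in> auto (free_group n)"
    and "\<And>k. k \<in> {1..n} \<Longrightarrow> f [(k, True)] = g [(k, True)]"
  shows "f = g"
proof (rule extensionalityI[of _ "carrier (free_group n)"])
  have h: "f \<in> hom (free_group n) (free_group n)" "g \<in> hom (free_group n) (free_group n)"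
    using assms(1,2) by (simp_all add: auto_def)
  show "f w = g w" if "w \<in> carrier (free_group n)" for w
    by (rule hom_eqI[OF free_group_group h assms(3) that])
  show "f \<in> extensional (carrier (free_group n))" "g \<in> extensional (carrier (free_group n))"
    using assms(1,2) by (simp_all add: auto_def Bij_def)
qed

lemma conj_aut_mult_apply:
  assumes "i \<noteq> j" "i \<in> {1..n}" "j \<in> {1..n}" "g \<in> auto (free_group n)" "w \<in> carrier (free_group n)"
  shows "(conj_aut n i j e \<otimes>\<^bsub>Aut_F n\<^esub> g) w = conj_aut n i j e (g w)"
  using assms(5) by (simp only: Aut_F_mult[OF conj_aut_auto[OF assms(1-3)] assms(4)] compose_def restrict_apply')

lemma Aut_F_mult_auto:
  "f \<in> auto (free_group n) \<Longrightarrow> g \<in> auto (free_group n) \<Longrightarrow> f \<otimes>\<^bsub>Aut_F n\<^esub> g \<in> auto (free_group n)"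
  using AutF.m_closed[of f n g] by (simp add: Aut_F_carrier)

lemmas conj_aut_simps = conj_aut_mult_apply conj_aut_auto Aut_F_mult_auto letter_carrier
  alpha_eq_conj_aut conj_aut_letter conj_aut_apply free_group_carrier

context
  fixes n :: nat
begin

lemma alpha_auto: "(i, j) \<in> edges n \<Longrightarrow> alpha n i j \<in> auto (free_group n)"
  by (intro upper_McCool_auto alpha_carrier)

lemma alpha_commute_disjoint:
  assumes "(i, j) \<in> edges n" "(s, t) \<in> edges n" "{i, j} \<inter> {s, t} = {}"
  shows "alpha n i j \<otimes>\<^bsub>upper_McCool n\<^esub> alpha n s t = alpha n s t \<otimes>\<^bsub>upper_McCool n\<^esub> alpha n i j"
  unfolding upper_McCool_mult
proof (rule Aut_F_eqI)
  fix k assume "k \<in> {1..n}"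
  then show "(alpha n i j \<otimes>\<^bsub>Aut_F n\<^esub> alpha n s t) [(k, True)] = (alpha n s t \<otimes>\<^bsub>Aut_F n\<^esub> alpha n i j) [(k, True)]"
    using assms by (auto simp: conj_aut_simps)
qed (intro Aut_F_mult_auto alpha_auto assms)+

lemma alpha_commute_target:
  assumes "(i, k) \<in> edges n" "(j, k) \<in> edges n"
  shows "alpha n i k \<otimes>\<^bsub>upper_McCool n\<^esub> alpha n j k = alpha n j k \<otimes>\<^bsub>upper_McCool n\<^esub> alpha n i k"
  unfolding upper_McCool_mult
proof (rule Aut_F_eqI)
  fix m assume "m \<in> {1..n}"
  then show "(alpha n i k \<otimes>\<^bsub>Aut_F n\<^esub> alpha n j k) [(m, True)] = (alpha n j k \<otimes>\<^bsub>Aut_F n\<^esub> alpha n i k) [(m, True)]"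
    using assms by (auto simp: conj_aut_simps)
qed (intro Aut_F_mult_auto alpha_auto assms)+

text \<open>The product of \<alpha>\<open>_ik\<close> and \<alpha>\<open>_jk\<close> conjugates both
  \<open>x_i\<close> and \<open>x_j\<close> by \<open>x_k\<close>. It acts on the subgroup generated
  by \<open>x_i\<close> and \<open>x_j\<close> as a conjugation, while \<alpha>\<open>_ij\<close>
  preserves this subgroup and fixes \<open>x_k\<close>; hence the two commute.\<close>

lemma alpha_commute_triangle:
  assumes "(i, j) \<in> edges n" "(j, k) \<in> edges n"
  shows "alpha n i j \<otimes>\<^bsub>upper_McCool n\<^esub> (alpha n i k \<otimes>\<^bsub>upper_McCool n\<^esub> alpha n j k) =
    (alpha n i k \<otimes>\<^bsub>upper_McCool n\<^esub> alpha n j k) \<otimes>\<^bsub>upper_McCool n\<^esub> alpha n i j"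
proof -
  have ik: "(i, k) \<in> edges n" using assms by auto
  note au = alpha_auto[OF assms(1)] alpha_auto[OF assms(2)] alpha_auto[OF ik]
  have "(alpha n i k \<otimes>\<^bsub>Aut_F n\<^esub> alpha n j k) \<otimes>\<^bsub>Aut_F n\<^esub> alpha n i j = alpha n i k \<otimes>\<^bsub>Aut_F n\<^esub> (alpha n j k \<otimes>\<^bsub>Aut_F n\<^esub> alpha n i j)"
    using au by (intro AutF.m_assoc) (simp_all add: Aut_F_carrier)
  moreover have "alpha n i j \<otimes>\<^bsub>Aut_F n\<^esub> (alpha n i k \<otimes>\<^bsub>Aut_F n\<^esub> alpha n j k) = alpha n i k \<otimes>\<^bsub>Aut_F n\<^esub> (alpha n j k \<otimes>\<^bsub>Aut_F n\<^esub> alpha n i j)"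
  proof (rule Aut_F_eqI)
    fix m assume "m \<in> {1..n}"
    then show "(alpha n i j \<otimes>\<^bsub>Aut_F n\<^esub> (alpha n i k \<otimes>\<^bsub>Aut_F n\<^esub> alpha n j k)) [(m, True)] =
      (alpha n i k \<otimes>\<^bsub>Aut_F n\<^esub> (alpha n j k \<otimes>\<^bsub>Aut_F n\<^esub> alpha n i j)) [(m, True)]"
      using assms by (auto simp: conj_aut_simps)
  qed (intro Aut_F_mult_auto au)+
  ultimately show ?thesis by (simp add: upper_McCool_mult)
qed

end

section \<open>Magnus coefficients\<close>

definition letter_exp :: "nat \<Rightarrow> nat \<times> bool \<Rightarrow> complex"
  where "letter_exp i a = (if fst a = i then if snd a then 1 else - 1 else 0)"

text \<open>The coefficients of \<open>X\<^sub>i\<close>, \<open>X\<^sub>j X\<^sub>i\<close> and \<open>X\<^sub>k X\<^sub>j X\<^sub>i\<close> in the image of a word under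
  \<open>x\<^sub>m \<mapsto> 1 + X\<^sub>m\<close>; the recursions are valid if adjacent indices are different.\<close>

fun magnus1 :: "nat \<Rightarrow> word \<Rightarrow> complex"
  where
    "magnus1 i [] = 0"
  | "magnus1 i (a # w) = letter_exp i a + magnus1 i w"

fun magnus2 :: "nat \<Rightarrow> nat \<Rightarrow> word \<Rightarrow> complex"
  where
    "magnus2 j i [] = 0"
  | "magnus2 j i (a # w) = letter_exp j a * magnus1 i w + magnus2 j i w"

fun magnus3 :: "nat \<Rightarrow> nat \<Rightarrow> nat \<Rightarrow> word \<Rightarrow> complex"
  where
    "magnus3 k j i [] = 0"
  | "magnus3 k j i (a # w) = letter_exp k a * magnus2 j i w + magnus3 k j i w"

lemma letter_exp_simps [simp]:
  "letter_exp i (i, True) = 1" "letter_exp i (i, False) = - 1" "i \<noteq> j \<Longrightarrow> letter_exp i (j, e) = 0"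
  "letter_exp i (j, \<not> e) = - letter_exp i (j, e)"
  by (auto simp: letter_exp_def)

lemma magnus1_push_letter: "magnus1 i (push_letter a w) = letter_exp i a + magnus1 i w"
  by (cases w) (auto simp: letter_exp_def)

text \<open>If \<open>a\<close> cancels against the first letter \<open>b\<close> of
  \<open>w\<close>, the recursion produces one surplus term,
  \<open>letter_exp j a * letter_exp i b\<close>. Both letters have the same index, so this term
  vanishes for \<open>i \<noteq> j\<close>.\<close>

lemma magnus2_push_letter:
  "i \<noteq> j \<Longrightarrow> magnus2 j i (push_letter a w) = letter_exp j a * magnus1 i w + magnus2 j i w"
  by (cases w) (auto simp: letter_exp_def)

lemma magnus3_push_letter:
  "i \<noteq> j \<Longrightarrow> j \<noteq> k \<Longrightarrow> magnus3 k j i (push_letter a w) = letter_exp k a * magnus2 j i w + magnus3 k j i w"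
  by (cases w) (auto simp: letter_exp_def)

lemma magnus1_mult: "magnus1 i (foldr push_letter u v) = magnus1 i u + magnus1 i v"
  by (induction u) (auto simp: magnus1_push_letter)

text \<open>Coefficients of a product of power series: the monomial is cut in every possible way
  into a left factor, taken from \<open>u\<close>, and a right factor, taken from
  \<open>v\<close>.\<close>

lemma magnus2_mult:
  "i \<noteq> j \<Longrightarrow> magnus2 j i (foldr push_letter u v) = magnus2 j i u + magnus1 j u * magnus1 i v + magnus2 j i v"
  by (induction u) (auto simp: magnus2_push_letter magnus1_mult algebra_simps)

lemma magnus3_mult:
  "i \<noteq> j \<Longrightarrow> j \<noteq> k \<Longrightarrow> magnus3 k j i (foldr push_letter u v) =
    magnus3 k j i u + magnus2 k j u * magnus1 i v + magnus1 k u * magnus2 j i v + magnus3 k j i v"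
  by (induction u) (auto simp: magnus3_push_letter magnus2_mult magnus1_mult algebra_simps)

text \<open>An endomorphism that maps each \<open>x\<^sub>m\<close> to its conjugate by a word in \<open>x\<^sub>1, \<dots>, x\<^sub>m\<^sub>-\<^sub>1\<close> has these
  vanishing Magnus coefficients, and they suffice for the composition formulas.\<close>

definition magnus_triangular :: "nat \<Rightarrow> (word \<Rightarrow> word) \<Rightarrow> bool"
  where "magnus_triangular n g \<longleftrightarrow> g \<in> hom (free_group n) (free_group n) \<and> (\<forall>m\<in>{1..n}.
    (\<forall>i. magnus1 i (g [(m, True)]) = (if i = m then 1 else 0)) \<and>
    (\<forall>i j. j < i \<longrightarrow> m \<noteq> i \<longrightarrow> magnus2 j i (g [(m, True)]) = 0) \<and>
    (\<forall>i j k. k < j \<longrightarrow> j < i \<longrightarrow> m \<noteq> i \<longrightarrow> magnus3 k j i (g [(m, True)]) = 0))"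

text \<open>If \<open>g\<close> maps \<open>x_i\<close> to its conjugate by a word \<open>w\<close>
  in the generators of smaller index, then for \<open>k < j < i\<close> the number
  \<open>mc2 i j g\<close> is the exponent sum of \<open>x_j\<close> in \<open>w\<close>, and
  \<open>mc3 i j k g\<close> is the coefficient of \<open>X_k X_j\<close> in the Magnus expansion of
  \<open>w\<close>.\<close>

definition mc2 :: "nat \<Rightarrow> nat \<Rightarrow> (word \<Rightarrow> word) \<Rightarrow> complex"
  where "mc2 i j g = magnus2 j i (g [(i, True)])"

definition mc3 :: "nat \<Rightarrow> nat \<Rightarrow> nat \<Rightarrow> (word \<Rightarrow> word) \<Rightarrow> complex"
  where "mc3 i j k g = magnus3 k j i (g [(i, True)])"

lemma magnus_triangular_letter:
  assumes "magnus_triangular n g" "fst a \<in> {1..n}"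
  shows "magnus1 i (g [a]) = letter_exp i a"
    and "j < i \<Longrightarrow> magnus2 j i (g [a]) = letter_exp i a * mc2 i j g"
    and "k < j \<Longrightarrow> j < i \<Longrightarrow> magnus3 k j i (g [a]) = letter_exp i a * mc3 i j k g"
proof -
  obtain m e where a: "a = (m, e)" "m \<in> {1..n}" using assms(2) by (cases a) auto
  have g: "g \<in> hom (free_group n) (free_group n)" using assms(1) by (simp add: magnus_triangular_def)
  interpret g: group_hom "free_group n" "free_group n" g using g by unfold_locales
  have M1: "magnus1 i (g [(m, True)]) = (if i = m then 1 else 0)" for i
    using assms(1) a(2) by (auto simp: magnus_triangular_def)
  have M2: "magnus2 j i (g [(m, True)]) = (if i = m then mc2 i j g else 0)" if "j < i" for i j
    using assms(1) a(2) that by (auto simp: magnus_triangular_def mc2_def)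
  have M3: "magnus3 k j i (g [(m, True)]) = (if i = m then mc3 i j k g else 0)" if "k < j" "j < i" for i j k
    using assms(1) a(2) that by (auto simp: magnus_triangular_def mc3_def)
  \<comment> \<open>The values at the inverse letter follow by expanding
    \<open>1 = g(x_m) g(x_m)^-1\<close> with the product formulas. A mixed term would require two
    different indices to be equal to \<open>m\<close>, so all mixed terms vanish.\<close>
  have inv: "foldr push_letter (g [(m, True)]) (g [(m, False)]) = []"
  proof -
    have "g ([(m, True)] \<otimes>\<^bsub>free_group n\<^esub> [(m, False)]) = g [(m, True)] \<otimes>\<^bsub>free_group n\<^esub> g [(m, False)]"
      using a(2) by (intro g.hom_mult) (auto simp: letter_carrier)
    then show ?thesis using g.hom_one by (simp add: free_group_mult free_group_one)
  qed
  have N1: "magnus1 i (g [(m, False)]) = (if i = m then - 1 else 0)" for i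
    using magnus1_mult[of i "g [(m, True)]" "g [(m, False)]"] M1[of i]
    by (auto simp: inv eq_neg_iff_add_eq_0 add.commute)
  have N2: "magnus2 j i (g [(m, False)]) = (if i = m then - mc2 i j g else 0)" if "j < i" for i j
    using magnus2_mult[of i j "g [(m, True)]" "g [(m, False)]"] M1[of j] N1[of i] M2[OF that] that
    by (auto simp: inv eq_neg_iff_add_eq_0 add.commute split: if_splits)
  have N3: "magnus3 k j i (g [(m, False)]) = (if i = m then - mc3 i j k g else 0)" if "k < j" "j < i" for i j k
    using magnus3_mult[of i j k "g [(m, True)]" "g [(m, False)]"] M1[of k] N1[of i] M2[OF that(1)] M3[OF that] N2[OF that(2)] that
    by (auto simp: inv eq_neg_iff_add_eq_0 add.commute split: if_splits)
  show "magnus1 i (g [a]) = letter_exp i a"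
    using M1 N1 by (cases e) (auto simp: a letter_exp_def)
  show "magnus2 j i (g [a]) = letter_exp i a * mc2 i j g" if "j < i"
    using M2[OF that] N2[OF that] by (cases e) (auto simp: a letter_exp_def)
  show "magnus3 k j i (g [a]) = letter_exp i a * mc3 i j k g" if "k < j" "j < i"
    using M3[OF that] N3[OF that] by (cases e) (auto simp: a letter_exp_def)
qed

text \<open>A chain rule: \<open>g\<close> substitutes power series for the variables. The monomial
  \<open>X_k X_j X_i\<close> arises from itself, from \<open>X_i\<close> as a whole, from
  \<open>X_j X_i\<close> by expanding \<open>X_j\<close> into \<open>X_k X_j\<close>, and from
  \<open>X_k X_i\<close> by expanding \<open>X_i\<close> into \<open>X_j X_i\<close>.\<close>

lemma magnus_triangular_word:
  assumes g: "magnus_triangular n g" and "w \<in> carrier (free_group n)"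
  shows "magnus1 i (g w) = magnus1 i w"
    and "j < i \<Longrightarrow> magnus2 j i (g w) = magnus2 j i w + mc2 i j g * magnus1 i w"
    and "k < j \<Longrightarrow> j < i \<Longrightarrow> magnus3 k j i (g w) =
      magnus3 k j i w + mc3 i j k g * magnus1 i w + mc2 j k g * magnus2 j i w + mc2 i j g * magnus2 k i w"
proof -
  have "g \<in> hom (free_group n) (free_group n)" using assms(1) by (simp add: magnus_triangular_def)
  then interpret g: group_hom "free_group n" "free_group n" g by unfold_locales
  have "magnus1 i (g w) = magnus1 i w \<and>
    (j < i \<longrightarrow> magnus2 j i (g w) = magnus2 j i w + mc2 i j g * magnus1 i w) \<and>
    (k < j \<longrightarrow> j < i \<longrightarrow> magnus3 k j i (g w) =
      magnus3 k j i w + mc3 i j k g * magnus1 i w + mc2 j k g * magnus2 j i w + mc2 i j g * magnus2 k i w)" for i j k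
    using assms(2)
  proof (induction w arbitrary: i j k)
    case Nil
    then show ?case using g.hom_one by (simp add: free_group_one)
  next
    case (Cons a w)
    then have w: "w \<in> carrier (free_group n)" "fst a \<in> {1..n}" and r: "reduced (a # w)"
      by (auto simp: free_group_carrier reduced_Cons)
    have "a # w = [a] \<otimes>\<^bsub>free_group n\<^esub> w"
      using push_letter_reduced_Cons[OF r] by (simp add: free_group_mult)
    then have eq: "g (a # w) = foldr push_letter (g [a]) (g w)"
      using w letter_carrier[OF w(2)] by (metis free_group_mult g.hom_mult)
    note IH = Cons.IH[OF w(1)]
    note letter = magnus_triangular_letter[OF g w(2)]
    have 1: "magnus1 i (g (a # w)) = magnus1 i (a # w)"
      using IH[of i] by (simp add: eq magnus1_mult letter)
    have 2: "magnus2 j i (g (a # w)) = magnus2 j i (a # w) + mc2 i j g * magnus1 i (a # w)" if "j < i"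
      using IH[of i j] that by (simp add: eq magnus2_mult letter algebra_simps)
    have 3: "magnus3 k j i (g (a # w)) = magnus3 k j i (a # w) + mc3 i j k g * magnus1 i (a # w)
       + mc2 j k g * magnus2 j i (a # w) + mc2 i j g * magnus2 k i (a # w)" if "k < j" "j < i"
      using IH[of i j k] that by (simp add: eq magnus3_mult letter algebra_simps)
    show ?case using 1 2 3 by blast
  qed
  then show "magnus1 i (g w) = magnus1 i w"
    "j < i \<Longrightarrow> magnus2 j i (g w) = magnus2 j i w + mc2 i j g * magnus1 i w"
    "k < j \<Longrightarrow> j < i \<Longrightarrow> magnus3 k j i (g w) =
      magnus3 k j i w + mc3 i j k g * magnus1 i w + mc2 j k g * magnus2 j i w + mc2 i j g * magnus2 k i w"
    by blast+
qed

lemma magnus_triangular_letter_closed: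
  "magnus_triangular n g \<Longrightarrow> m \<in> {1..n} \<Longrightarrow> g [(m, True)] \<in> carrier (free_group n)"
  by (auto simp: magnus_triangular_def hom_def letter_carrier)

lemma Aut_F_mult_letter:
  assumes "g \<in> auto (free_group n)" "h \<in> auto (free_group n)" "m \<in> {1..n}"
  shows "(g \<otimes>\<^bsub>Aut_F n\<^esub> h) [(m, True)] = g (h [(m, True)])"
  using assms(3) by (simp add: Aut_F_mult[OF assms(1,2)] compose_def letter_carrier)

lemma magnus_triangular_mult:
  assumes "magnus_triangular n g" "magnus_triangular n h" "g \<in> auto (free_group n)" "h \<in> auto (free_group n)"
  shows "magnus_triangular n (g \<otimes>\<^bsub>Aut_F n\<^esub> h)"
proof -
  have "g \<otimes>\<^bsub>Aut_F n\<^esub> h \<in> hom (free_group n) (free_group n)"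
    using Aut_F_mult_auto[OF assms(3,4)] by (simp add: auto_def)
  moreover note W = magnus_triangular_word[OF assms(1) magnus_triangular_letter_closed[OF assms(2)]]
  note L = magnus_triangular_letter[OF assms(2), of "(_, True)", unfolded fst_conv]
  ultimately show ?thesis
    unfolding magnus_triangular_def
    by (auto simp: Aut_F_mult_letter[OF assms(3,4)] W L simp del: atLeastAtMost_iff)
qed

lemma mc2_mult:
  assumes "magnus_triangular n g" "magnus_triangular n h" "g \<in> auto (free_group n)" "h \<in> auto (free_group n)"
    and "(i, j) \<in> edges n"
  shows "mc2 i j (g \<otimes>\<^bsub>Aut_F n\<^esub> h) = mc2 i j g + mc2 i j h"
proof -
  have i: "i \<in> {1..n}" "j < i" using assms(5) by auto
  then show ?thesis
    using magnus_triangular_word(2)[OF assms(1) magnus_triangular_letter_closed[OF assms(2) i(1)] i(2)]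
      magnus_triangular_letter(1)[OF assms(2), of "(i, True)" i] i
    by (simp add: mc2_def Aut_F_mult_letter[OF assms(3,4) i(1)])
qed

text \<open>The chain rule is applied to the word \<open>h(x_i)\<close>, in which \<open>X_i\<close>
  has coefficient 1. The two quadratic terms measure the failure of additivity, and they are the
  reason why \<open>u_ij (u_ik - u_jk)\<close> becomes a coboundary.\<close>

lemma mc3_mult:
  assumes "magnus_triangular n g" "magnus_triangular n h" "g \<in> auto (free_group n)" "h \<in> auto (free_group n)"
    and "(i, j) \<in> edges n" "(j, k) \<in> edges n"
  shows "mc3 i j k (g \<otimes>\<^bsub>Aut_F n\<^esub> h) = mc3 i j k g + mc3 i j k h + mc2 j k g * mc2 i j h + mc2 i j g * mc2 i k h"
proof -
  have i: "i \<in> {1..n}" "j < i" "k < j" using assms(5,6) by auto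
  then show ?thesis
    using magnus_triangular_word(3)[OF assms(1) magnus_triangular_letter_closed[OF assms(2) i(1)] i(3,2)]
      magnus_triangular_letter(1)[OF assms(2), of "(i, True)" i] i
    by (simp add: mc2_def mc3_def Aut_F_mult_letter[OF assms(3,4) i(1)])
qed

lemma magnus_triangular_conj_aut:
  assumes "(s, t) \<in> edges n" shows "magnus_triangular n (conj_aut n s t e)"
  unfolding magnus_triangular_def
  using assms conj_aut_hom[of s t n e] by (auto simp: conj_aut_letter letter_exp_def)

lemma mc2_alpha:
  assumes "(s, t) \<in> edges n" "(i, j) \<in> edges n"
  shows "mc2 i j (alpha n s t) = (if (i, j) = (s, t) then 1 else 0)"
  using assms by (auto simp: mc2_def alpha_eq_conj_aut conj_aut_letter letter_exp_def)

lemma upper_McCool_triangular: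
  assumes "g \<in> carrier (upper_McCool n)" shows "magnus_triangular n g"
  using assms
proof (induction rule: upper_McCool_induct)
  case one
  then show ?case
    by (auto simp: magnus_triangular_def Aut_F_one letter_carrier letter_exp_def hom_def F.m_closed)
next
  case (alpha i j)
  then show ?case unfolding alpha_eq_conj_aut by (rule magnus_triangular_conj_aut)
next
  case (inv i j)
  then show ?case by (rule magnus_triangular_conj_aut)
next
  case (mult g h)
  then show ?case unfolding upper_McCool_mult by (intro magnus_triangular_mult upper_McCool_auto)
qed

lemma upper_McCool_mc2_mult:
  assumes "(i, j) \<in> edges n" "g \<in> carrier (upper_McCool n)" "h \<in> carrier (upper_McCool n)"
  shows "mc2 i j (g \<otimes>\<^bsub>upper_McCool n\<^esub> h) = mc2 i j g + mc2 i j h"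
  unfolding upper_McCool_mult using assms by (intro mc2_mult upper_McCool_triangular upper_McCool_auto)

lemma upper_McCool_mc3_mult:
  assumes "(i, j) \<in> edges n" "(j, k) \<in> edges n" "g \<in> carrier (upper_McCool n)" "h \<in> carrier (upper_McCool n)"
  shows "mc3 i j k (g \<otimes>\<^bsub>upper_McCool n\<^esub> h) =
    mc3 i j k g + mc3 i j k h + mc2 j k g * mc2 i j h + mc2 i j g * mc2 i k h"
  unfolding upper_McCool_mult using assms by (intro mc3_mult upper_McCool_triangular upper_McCool_auto)

section \<open>Low-dimensional homology and cohomology\<close>

lemma fun_module_simps [simp]:
  "carrier (fun_module R I) = I \<rightarrow>\<^sub>E carrier R"
  "f \<oplus>\<^bsub>fun_module R I\<^esub> g = (\<lambda>i\<in>I. f i \<oplus>\<^bsub>R\<^esub> g i)"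
  "\<zero>\<^bsub>fun_module R I\<^esub> = (\<lambda>i\<in>I. \<zero>\<^bsub>R\<^esub>)"
  "a \<odot>\<^bsub>fun_module R I\<^esub> f = (\<lambda>i\<in>I. a \<otimes>\<^bsub>R\<^esub> f i)"
  by (simp_all add: fun_module_def)

lemma fun_module_module:
  assumes "cring R" shows "module R (fun_module R I)"
proof -
  interpret cring R by fact
  have mem [simp]: "f i \<in> carrier R" if "f \<in> I \<rightarrow>\<^sub>E carrier R" "i \<in> I" for f i
    using that by (rule PiE_mem)
  show ?thesis
  proof (rule moduleI)
    show "abelian_group (fun_module R I)"
    proof (rule abelian_groupI)
      fix f assume f: "f \<in> carrier (fun_module R I)"
      show "\<exists>g\<in>carrier (fun_module R I). g \<oplus>\<^bsub>fun_module R I\<^esub> f = \<zero>\<^bsub>fun_module R I\<^esub>"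
        by (rule bexI[of _ "\<lambda>i\<in>I. \<ominus>\<^bsub>R\<^esub> f i"]) (use f in \<open>auto simp: l_neg intro!: restrict_ext\<close>)
      show "\<zero>\<^bsub>fun_module R I\<^esub> \<oplus>\<^bsub>fun_module R I\<^esub> f = f"
        using f by (intro extensionalityI[of _ I]) (auto simp: PiE_def)
    qed (auto simp: a_ac intro!: restrict_ext)
    show "\<one>\<^bsub>R\<^esub> \<odot>\<^bsub>fun_module R I\<^esub> f = f" if "f \<in> carrier (fun_module R I)" for f
      using that by (intro extensionalityI[of _ I]) (auto simp: PiE_def)
  qed (use assms in \<open>auto simp: l_distr r_distr m_assoc intro!: restrict_ext\<close>)
qed

definition pm_eval :: "('g \<Rightarrow> complex) \<Rightarrow> ('g \<Rightarrow>\<^sub>0 complex) \<Rightarrow> complex"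
  where "pm_eval a c = (\<Sum>g\<in>supp c. coef c g * a g)"

lemma pm_eval_add: "pm_eval a (c + d) = pm_eval a c + pm_eval a d"
  unfolding pm_eval_def by (rule setsum_keys_plus_distrib) (auto simp: algebra_simps)

lemma pm_eval_scale: "pm_eval a (pm_scale x c) = x * pm_eval a c"
proof -
  have "pm_eval a (pm_scale x c) = (\<Sum>g\<in>supp c. coef (pm_scale x c) g * a g)"
    unfolding pm_eval_def using keys_pm_scale by (intro sum.mono_neutral_left) (auto simp: in_keys_iff)
  then show ?thesis by (simp add: pm_eval_def sum_distrib_left mult.assoc)
qed

lemma pm_eval_zero [simp]: "pm_eval a 0 = 0"
  by (simp add: pm_eval_def)

lemma pm_eval_uminus: "pm_eval a (- c) = - pm_eval a c"
  using pm_eval_add[of a c "- c"] by (simp add: eq_neg_iff_add_eq_0 add.commute)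

lemma pm_eval_diff: "pm_eval a (c - d) = pm_eval a c - pm_eval a d"
  using pm_eval_add[of a c "- d"] by (simp add: pm_eval_uminus)

lemma pm_eval_single [simp]: "pm_eval a (Poly_Mapping.single g x) = x * a g"
  by (cases "x = 0") (auto simp: pm_eval_def)

lemma chains1_minus: "supp c \<subseteq> carrier G \<Longrightarrow> \<ominus>\<^bsub>chains1 G\<^esub> c = - c"
proof -
  interpret module Cx "chains1 G" by (rule chains1_module)
  show "supp c \<subseteq> carrier G \<Longrightarrow> \<ominus>\<^bsub>chains1 G\<^esub> c = - c" by (rule M.minus_equality) auto
qed

text \<open>The quotient modules cannot be registered as sublocales of \<^locale>\<open>group\<close>: their additive groups
  would trigger the registration again.\<close>

locale group_homology = group G for G (structure)
begin

abbreviation bdry :: "'a \<Rightarrow> 'a \<Rightarrow> 'a \<Rightarrow>\<^sub>0 complex"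
  where "bdry g h \<equiv> Poly_Mapping.single h 1 - Poly_Mapping.single (g \<otimes> h) 1 + Poly_Mapping.single g 1"

lemma bdry_closed: "g \<in> carrier G \<Longrightarrow> h \<in> carrier G \<Longrightarrow> supp (bdry g h) \<subseteq> carrier G"
  using Poly_Mapping.keys_add[of "Poly_Mapping.single h 1 - Poly_Mapping.single (g \<otimes> h) (1::complex)" "Poly_Mapping.single g 1"]
    keys_minus_subset[of "Poly_Mapping.single h 1" "Poly_Mapping.single (g \<otimes> h) (1::complex)"] by auto

lemma boundaries1_submodule: "submodule (boundaries1 G) Cx (chains1 G)"
proof -
  interpret module Cx "chains1 G" by (rule chains1_module)
  show ?thesis unfolding boundaries1_def using bdry_closed by (intro lin_span_submodule) auto
qed

lemma bdry_boundary: "g \<in> carrier G \<Longrightarrow> h \<in> carrier G \<Longrightarrow> bdry g h \<in> boundaries1 G"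
  unfolding boundaries1_def lin_span_def by auto

sublocale H1Q: module_quotient Cx "chains1 G" "boundaries1 G"
  by (intro module_quotient.intro chains1_module module_quotient_axioms.intro boundaries1_submodule)

lemma H_1_module: "module Cx (H_1 G)"
  unfolding H_1_def by (rule H1Q.quotient_module)

lemma H_1_carrier: "carrier (H_1 G) = (\<lambda>c. boundaries1 G +>\<^bsub>chains1 G\<^esub> c) ` {c. supp c \<subseteq> carrier G}"
  by (simp add: H_1_def mod_quot_simps(1))

lemma class1_closed: "g \<in> carrier G \<Longrightarrow> class1 G g \<in> carrier (H_1 G)"
  by (auto simp: class1_def H_1_carrier)

lemma class1_mult:
  assumes "g \<in> carrier G" "h \<in> carrier G" shows "class1 G (g \<otimes> h) = class1 G g \<oplus>\<^bsub>H_1 G\<^esub> class1 G h"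
proof -
  have c: "Poly_Mapping.single x 1 \<in> carrier (chains1 G)" if "x \<in> carrier G" for x using that by simp
  have s: "supp (Poly_Mapping.single g 1 + Poly_Mapping.single h (1::complex)) \<subseteq> carrier G"
    using Poly_Mapping.keys_add[of "Poly_Mapping.single g 1" "Poly_Mapping.single h (1::complex)"] assms by auto
  have "(Poly_Mapping.single g 1 + Poly_Mapping.single h 1) \<ominus>\<^bsub>chains1 G\<^esub> Poly_Mapping.single (g \<otimes> h) 1 = bdry g h"
    unfolding a_minus_def using assms by (subst chains1_minus) auto
  then have "boundaries1 G +>\<^bsub>chains1 G\<^esub> (Poly_Mapping.single g 1 + Poly_Mapping.single h 1)
      = boundaries1 G +>\<^bsub>chains1 G\<^esub> Poly_Mapping.single (g \<otimes> h) 1"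
    using assms s bdry_boundary by (subst H1Q.coset_eq_iff) auto
  moreover have "class1 G g \<oplus>\<^bsub>H_1 G\<^esub> class1 G h = boundaries1 G +>\<^bsub>chains1 G\<^esub> (Poly_Mapping.single g 1 + Poly_Mapping.single h 1)"
    using H1Q.coset_add[OF c[OF assms(1)] c[OF assms(2)]] by (simp add: H_1_def class1_def)
  ultimately show ?thesis by (simp add: class1_def)
qed

lemma H_1_span:
  assumes W: "submodule W Cx (H_1 G)" and "\<And>g. g \<in> carrier G \<Longrightarrow> class1 G g \<in> W"
  shows "W = carrier (H_1 G)"
proof
  interpret H: module Cx "H_1 G" by (rule H_1_module)
  note S = H.submoduleE[OF W]
  show "W \<subseteq> carrier (H_1 G)" by (rule S(1))
  have "c \<in> {c. supp c \<subseteq> carrier G \<and> boundaries1 G +>\<^bsub>chains1 G\<^esub> c \<in> W}" if "supp c \<subseteq> carrier G" for c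
    using that
  proof (rule pm_span_induct)
    show "0 \<in> {c. supp c \<subseteq> carrier G \<and> boundaries1 G +>\<^bsub>chains1 G\<^esub> c \<in> W}"
      using H.submodule_zero[OF W] H1Q.coset_zero by (simp add: H_1_def mod_quot_simps)
  next
    fix c d assume *: "c \<in> {c. supp c \<subseteq> carrier G \<and> boundaries1 G +>\<^bsub>chains1 G\<^esub> c \<in> W}"
      "d \<in> {c. supp c \<subseteq> carrier G \<and> boundaries1 G +>\<^bsub>chains1 G\<^esub> c \<in> W}"
    then have "(boundaries1 G +>\<^bsub>chains1 G\<^esub> c) \<oplus>\<^bsub>H_1 G\<^esub> (boundaries1 G +>\<^bsub>chains1 G\<^esub> d) \<in> W"
      using S(5) by simp
    then show "c + d \<in> {c. supp c \<subseteq> carrier G \<and> boundaries1 G +>\<^bsub>chains1 G\<^esub> c \<in> W}"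
      using * H1Q.coset_add[of c d] Poly_Mapping.keys_add[of c d] by (auto simp: H_1_def)
  next
    fix x c assume *: "c \<in> {c. supp c \<subseteq> carrier G \<and> boundaries1 G +>\<^bsub>chains1 G\<^esub> c \<in> W}"
    then have "x \<odot>\<^bsub>H_1 G\<^esub> (boundaries1 G +>\<^bsub>chains1 G\<^esub> c) \<in> W"
      using S(4)[of x] by simp
    then show "pm_scale x c \<in> {c. supp c \<subseteq> carrier G \<and> boundaries1 G +>\<^bsub>chains1 G\<^esub> c \<in> W}"
      using * H1Q.coset_smult[of x c] keys_pm_scale[of x c] by (auto simp: H_1_def)
  next
    fix g assume "g \<in> carrier G"
    then show "Poly_Mapping.single g 1 \<in> {c. supp c \<subseteq> carrier G \<and> boundaries1 G +>\<^bsub>chains1 G\<^esub> c \<in> W}"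
      using assms(2)[of g] by (simp add: class1_def)
  qed
  then show "carrier (H_1 G) \<subseteq> W" by (auto simp: H_1_carrier)
qed

lemma H1_coh_mult:
  "a \<in> H1_coh G \<Longrightarrow> g \<in> carrier G \<Longrightarrow> h \<in> carrier G \<Longrightarrow> a (g \<otimes> h) = a g + a h"
  by (auto simp: H1_coh_def algebra_simps)

text \<open>A 1-cocycle is a homomorphism to the additive group of \<complex>, so it kills every
  \<open>[h] - [gh] + [g]\<close>. Consequently the set of values in the definition of
  \<open>pairing\<close> is a singleton.\<close>

lemma pm_eval_boundary:
  assumes "a \<in> H1_coh G" "c \<in> boundaries1 G" shows "pm_eval a c = 0"
proof -
  have "submodule {c. supp c \<subseteq> carrier G \<and> pm_eval a c = 0} Cx (chains1 G)"
  proof (rule H1Q.submoduleI)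
    fix c d assume "c \<in> {c. supp c \<subseteq> carrier G \<and> pm_eval a c = 0}" "d \<in> {c. supp c \<subseteq> carrier G \<and> pm_eval a c = 0}"
    then show "c \<oplus>\<^bsub>chains1 G\<^esub> d \<in> {c. supp c \<subseteq> carrier G \<and> pm_eval a c = 0}"
      using Poly_Mapping.keys_add[of c d] by (auto simp: pm_eval_add)
  next
    fix x c assume "c \<in> {c. supp c \<subseteq> carrier G \<and> pm_eval a c = 0}"
    then show "x \<odot>\<^bsub>chains1 G\<^esub> c \<in> {c. supp c \<subseteq> carrier G \<and> pm_eval a c = 0}"
      using keys_pm_scale[of x c] by (auto simp: pm_eval_scale)
  qed (auto simp: chains1_minus pm_eval_uminus)
  then have "boundaries1 G \<subseteq> {c. supp c \<subseteq> carrier G \<and> pm_eval a c = 0}"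
    unfolding boundaries1_def
  proof (rule H1Q.lin_span_least)
    show "{bdry g h | g h. g \<in> carrier G \<and> h \<in> carrier G} \<subseteq> {c. supp c \<subseteq> carrier G \<and> pm_eval a c = 0}"
      using bdry_closed assms(1) by (auto simp: pm_eval_add pm_eval_diff H1_coh_mult)
  qed
  with assms(2) show ?thesis by auto
qed

lemma pairing_coset:
  assumes "a \<in> H1_coh G" "supp c \<subseteq> carrier G"
  shows "pairing a (boundaries1 G +>\<^bsub>chains1 G\<^esub> c) = pm_eval a c"
proof -
  have "pm_eval a ` (boundaries1 G +>\<^bsub>chains1 G\<^esub> c) = {pm_eval a c}"
  proof -
    have "pm_eval a d = pm_eval a c" if "d \<in> boundaries1 G +>\<^bsub>chains1 G\<^esub> c" for d
      using that pm_eval_boundary[OF assms(1)] by (auto simp: a_r_coset_def' pm_eval_add)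
    moreover have "c \<in> boundaries1 G +>\<^bsub>chains1 G\<^esub> c"
      using assms(2) by (intro H1Q.KS.a_rcos_self) simp
    ultimately show ?thesis by blast
  qed
  then show ?thesis by (simp add: pairing_def pm_eval_def[abs_def])
qed

lemma pairing_class1: "a \<in> H1_coh G \<Longrightarrow> g \<in> carrier G \<Longrightarrow> pairing a (class1 G g) = a g"
  by (simp add: class1_def pairing_coset)

lemma pairing_add:
  assumes "a \<in> H1_coh G" "u \<in> carrier (H_1 G)" "v \<in> carrier (H_1 G)"
  shows "pairing a (u \<oplus>\<^bsub>H_1 G\<^esub> v) = pairing a u + pairing a v"
proof -
  obtain c d where c: "supp c \<subseteq> carrier G" "u = boundaries1 G +>\<^bsub>chains1 G\<^esub> c"
    and d: "supp d \<subseteq> carrier G" "v = boundaries1 G +>\<^bsub>chains1 G\<^esub> d"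
    using assms(2,3) by (auto simp: H_1_carrier)
  have "u \<oplus>\<^bsub>H_1 G\<^esub> v = boundaries1 G +>\<^bsub>chains1 G\<^esub> (c + d)"
    using H1Q.coset_add[of c d] c d by (simp add: H_1_def)
  moreover have "supp (c + d) \<subseteq> carrier G" using Poly_Mapping.keys_add[of c d] c d by auto
  ultimately show ?thesis using assms(1) c d by (simp add: pairing_coset pm_eval_add)
qed

lemma pairing_smult:
  assumes "a \<in> H1_coh G" "u \<in> carrier (H_1 G)"
  shows "pairing a (x \<odot>\<^bsub>H_1 G\<^esub> u) = x * pairing a u"
proof -
  obtain c where c: "supp c \<subseteq> carrier G" "u = boundaries1 G +>\<^bsub>chains1 G\<^esub> c"
    using assms(2) by (auto simp: H_1_carrier)
  have "x \<odot>\<^bsub>H_1 G\<^esub> u = boundaries1 G +>\<^bsub>chains1 G\<^esub> pm_scale x c"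
    using H1Q.coset_smult[of x c] c by (simp add: H_1_def)
  moreover have "supp (pm_scale x c) \<subseteq> carrier G" using keys_pm_scale[of x c] c by auto
  ultimately show ?thesis using assms(1) c by (simp add: pairing_coset pm_eval_scale)
qed

section \<open>Second cohomology, cup products and functionals from commuting pairs\<close>

abbreviation cocycle2 :: "('a \<times> 'a \<Rightarrow> complex) \<Rightarrow> bool"
  where "cocycle2 f \<equiv> (\<forall>g\<in>carrier G. \<forall>h\<in>carrier G. \<forall>k\<in>carrier G.
      f (h, k) - f (g \<otimes> h, k) + f (g, h \<otimes> k) - f (g, h) = 0)"

lemma cocycles2_carrier:
  "carrier (cocycles2 G) = {f \<in> carrier G \<times> carrier G \<rightarrow>\<^sub>E UNIV. cocycle2 f}"
  by (simp add: cocycles2_def)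

lemma cocycles2_simps:
  "f \<oplus>\<^bsub>cocycles2 G\<^esub> f' = (\<lambda>p\<in>carrier G \<times> carrier G. f p + f' p)"
  "\<zero>\<^bsub>cocycles2 G\<^esub> = (\<lambda>p\<in>carrier G \<times> carrier G. 0)"
  "c \<odot>\<^bsub>cocycles2 G\<^esub> f = (\<lambda>p\<in>carrier G \<times> carrier G. c * f p)"
  by (simp_all add: cocycles2_def fun_module_def)

lemma cochains2_minus:
  assumes "f \<in> carrier (cochains2 G)"
  shows "\<ominus>\<^bsub>cochains2 G\<^esub> f = (\<lambda>p\<in>carrier G \<times> carrier G. - f p)"
proof -
  interpret module Cx "cochains2 G" by (intro fun_module_module cring_from_type_algebra)
  show ?thesis using assms by (intro M.minus_equality) (auto intro!: restrict_ext)
qed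

lemma cocycles2_module: "module Cx (cocycles2 G)"
proof -
  interpret module Cx "cochains2 G" by (intro fun_module_module cring_from_type_algebra)
  have "submodule (carrier (cocycles2 G)) Cx (cochains2 G)"
  proof (rule submoduleI)
    fix f assume "f \<in> carrier (cocycles2 G)"
    then show "\<ominus>\<^bsub>cochains2 G\<^esub> f \<in> carrier (cocycles2 G)"
      by (subst cochains2_minus) (auto simp: cocycles2_carrier algebra_simps)
  next
    fix f g assume *: "f \<in> carrier (cocycles2 G)" "g \<in> carrier (cocycles2 G)"
    have "(f (h, k) + g (h, k)) - (f (x \<otimes> h, k) + g (x \<otimes> h, k)) + (f (x, h \<otimes> k) + g (x, h \<otimes> k)) - (f (x, h) + g (x, h)) = 0"
      if "x \<in> carrier G" "h \<in> carrier G" "k \<in> carrier G" for x h k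
    proof -
      have "f (h, k) - f (x \<otimes> h, k) + f (x, h \<otimes> k) - f (x, h) = 0" "g (h, k) - g (x \<otimes> h, k) + g (x, h \<otimes> k) - g (x, h) = 0"
        using * that by (auto simp: cocycles2_carrier)
      then show ?thesis by (simp add: algebra_simps)
    qed
    then show "f \<oplus>\<^bsub>cochains2 G\<^esub> g \<in> carrier (cocycles2 G)" by (simp add: cocycles2_carrier)
  next
    fix c f assume *: "f \<in> carrier (cocycles2 G)"
    have "c * f (h, k) - c * f (x \<otimes> h, k) + c * f (x, h \<otimes> k) - c * f (x, h) = 0"
      if "x \<in> carrier G" "h \<in> carrier G" "k \<in> carrier G" for x h k
    proof -
      have "c * (f (h, k) - f (x \<otimes> h, k) + f (x, h \<otimes> k) - f (x, h)) = 0" using * that by (auto simp: cocycles2_carrier)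
      then show ?thesis by (simp only: ring_distribs)
    qed
    then show "c \<odot>\<^bsub>cochains2 G\<^esub> f \<in> carrier (cocycles2 G)" by (simp add: cocycles2_carrier)
  qed (auto simp: cocycles2_carrier)
  from submodule.submodule_is_module[OF this module_axioms] show ?thesis
    by (simp add: cocycles2_def)
qed

abbreviation cobdry2 :: "('a \<Rightarrow> complex) \<Rightarrow> 'a \<times> 'a \<Rightarrow> complex"
  where "cobdry2 c \<equiv> (\<lambda>(g, h)\<in>carrier G \<times> carrier G. c h - c (g \<otimes> h) + c g)"

lemma coboundaries2_submodule: "submodule (coboundaries2 G) Cx (cocycles2 G)"
proof -
  interpret module Cx "cocycles2 G" by (rule cocycles2_module)
  have cobI: "cobdry2 c \<in> coboundaries2 G" for c by (auto simp: coboundaries2_def)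
  have cob: "coboundaries2 G = range cobdry2" by (auto simp: coboundaries2_def)
  have closed: "cobdry2 c \<in> carrier (cocycles2 G)" for c
    by (auto simp: cocycles2_carrier m_assoc)
  have smult: "x \<odot>\<^bsub>cocycles2 G\<^esub> cobdry2 c = cobdry2 (\<lambda>g. x * c g)" for x c
    by (auto simp: cocycles2_simps algebra_simps intro!: restrict_ext)
  show ?thesis
  proof (rule submoduleI)
    fix f g assume "f \<in> coboundaries2 G" "g \<in> coboundaries2 G"
    then obtain c d where "f = cobdry2 c" "g = cobdry2 d" by (auto simp: cob)
    then have "f \<oplus>\<^bsub>cocycles2 G\<^esub> g = cobdry2 (\<lambda>x. c x + d x)"
      by (auto simp: cocycles2_simps algebra_simps intro!: restrict_ext)
    then show "f \<oplus>\<^bsub>cocycles2 G\<^esub> g \<in> coboundaries2 G"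
      using cobI[of "\<lambda>x. c x + d x"] by (simp only:)
  next
    fix f assume "f \<in> coboundaries2 G"
    then obtain c where f: "f = cobdry2 c" by (auto simp: cob)
    have "\<ominus>\<^bsub>cocycles2 G\<^esub> f = (- 1) \<odot>\<^bsub>cocycles2 G\<^esub> f"
      using smult_l_minus[of 1 f] smult_one[of f] closed[of c] f by simp
    also have "\<dots> = cobdry2 (\<lambda>g. (- 1) * c g)" unfolding f by (rule smult)
    finally show "\<ominus>\<^bsub>cocycles2 G\<^esub> f \<in> coboundaries2 G"
      using cobI[of "\<lambda>g. (- 1) * c g"] by (simp only:)
  next
    have "\<zero>\<^bsub>cocycles2 G\<^esub> = cobdry2 (\<lambda>_. 0)" by (auto simp: cocycles2_simps intro!: restrict_ext)
    then show "\<zero>\<^bsub>cocycles2 G\<^esub> \<in> coboundaries2 G" using cobI[of "\<lambda>_. 0"] by (simp only:)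
  next
    show "coboundaries2 G \<subseteq> carrier (cocycles2 G)" using closed by (auto simp only: cob)
    fix x f assume "f \<in> coboundaries2 G"
    then obtain c where f: "f = cobdry2 c" by (auto simp: cob)
    show "x \<odot>\<^bsub>cocycles2 G\<^esub> f \<in> coboundaries2 G"
      using cobI[of "\<lambda>g. x * c g"] unfolding f smult by (simp only:)
  qed
qed

sublocale H2Q: module_quotient Cx "cocycles2 G" "coboundaries2 G"
  by (intro module_quotient.intro cocycles2_module module_quotient_axioms.intro coboundaries2_submodule)

lemma cup_cocycle:
  assumes "a \<in> H1_coh G" "b \<in> H1_coh G"
  shows "(\<lambda>(g, h)\<in>carrier G \<times> carrier G. a g * b h) \<in> carrier (cocycles2 G)"
  using assms by (auto simp: cocycles2_carrier H1_coh_mult algebra_simps)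

text \<open>Evaluation on the torus spanned by a commuting pair.\<close>

definition torus_class :: "'a \<Rightarrow> 'a \<Rightarrow> ('a \<times> 'a \<Rightarrow> complex) set \<Rightarrow> complex"
  where "torus_class g h Z = the_elem ((\<lambda>f. f (g, h) - f (h, g)) ` Z)"

text \<open>A coboundary \<open>c h - c (g h) + c g\<close> is symmetric in \<open>g\<close> and
  \<open>h\<close> when they commute, so the antisymmetrised value depends on the cohomology class
  only.\<close>

lemma torus_class_coset:
  assumes "g \<in> carrier G" "h \<in> carrier G" "g \<otimes> h = h \<otimes> g" "f \<in> carrier (cocycles2 G)"
  shows "torus_class g h (coboundaries2 G +>\<^bsub>cocycles2 G\<^esub> f) = f (g, h) - f (h, g)"
proof -
  have "f' (g, h) - f' (h, g) = f (g, h) - f (h, g)" if "f' \<in> coboundaries2 G +>\<^bsub>cocycles2 G\<^esub> f" for f'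
    using that assms(1-3) by (auto simp: a_r_coset_def' coboundaries2_def cocycles2_simps)
  moreover have "f \<in> coboundaries2 G +>\<^bsub>cocycles2 G\<^esub> f"
    using assms(4) by (intro H2Q.KS.a_rcos_self)
  ultimately have "(\<lambda>f. f (g, h) - f (h, g)) ` (coboundaries2 G +>\<^bsub>cocycles2 G\<^esub> f) = {f (g, h) - f (h, g)}"
    by blast
  then show ?thesis by (simp add: torus_class_def)
qed

lemma torus_class_H2_dual:
  assumes "g \<in> carrier G" "h \<in> carrier G" "g \<otimes> h = h \<otimes> g"
  shows "torus_class g h \<in> H2_dual G"
proof -
  note T = torus_class_coset[OF assms]
  have H2: "carrier (H2_coh G) = (\<lambda>f. coboundaries2 G +>\<^bsub>cocycles2 G\<^esub> f) ` carrier (cocycles2 G)"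
    by (simp add: H2_coh_def mod_quot_simps(1))
  have "torus_class g h ((coboundaries2 G +>\<^bsub>cocycles2 G\<^esub> f) \<oplus>\<^bsub>H2_coh G\<^esub> (coboundaries2 G +>\<^bsub>cocycles2 G\<^esub> f'))
    = torus_class g h (coboundaries2 G +>\<^bsub>cocycles2 G\<^esub> f) + torus_class g h (coboundaries2 G +>\<^bsub>cocycles2 G\<^esub> f')"
    if "f \<in> carrier (cocycles2 G)" "f' \<in> carrier (cocycles2 G)" for f f'
    using T[OF that(1)] T[OF that(2)] T[OF H2Q.M.a_closed[OF that]] assms(1,2)
    by (simp add: H2_coh_def H2Q.coset_add[OF that]) (simp add: cocycles2_simps)
  moreover have "torus_class g h (c \<odot>\<^bsub>H2_coh G\<^esub> (coboundaries2 G +>\<^bsub>cocycles2 G\<^esub> f))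
    = c * torus_class g h (coboundaries2 G +>\<^bsub>cocycles2 G\<^esub> f)" if "f \<in> carrier (cocycles2 G)" for c f
  proof -
    have "c \<odot>\<^bsub>cocycles2 G\<^esub> f \<in> carrier (cocycles2 G)" using that by (intro H2Q.smult_closed) simp_all
    from T[OF this] T[OF that] show ?thesis
      using assms(1,2) H2Q.coset_smult[OF _ that, of c]
      by (simp only: H2_coh_def Cx_simps UNIV_I) (simp add: cocycles2_simps right_diff_distrib)
  qed
  ultimately show ?thesis by (auto simp: H2_dual_def H2)
qed

text \<open>Antisymmetrising the cochain \<open>a g * b h\<close> of the cup product gives the value
  of \<open>a \<and> b\<close> on the wedge of the two classes. Thus each commuting pair contributes
  one decomposable element to the image of \<partial>.\<close>

lemma torus_class_represents:
  assumes "g \<in> carrier G" "h \<in> carrier G" "g \<otimes> h = h \<otimes> g"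
  shows "represents_dual_cup G (torus_class g h) [(class1 G g, class1 G h)]"
  using assms
  by (auto simp: represents_dual_cup_def class1_closed cup_def torus_class_coset cup_cocycle pairing_class1)

lemma H2_dual_cup_zero:
  assumes "\<phi> \<in> H2_dual G" "\<And>g h. g \<in> carrier G \<Longrightarrow> h \<in> carrier G \<Longrightarrow> a g * b h = c h - c (g \<otimes> h) + c g"
  shows "\<phi> (cup G a b) = 0"
proof -
  interpret Q: module Cx "H2_coh G" unfolding H2_coh_def by (rule H2Q.quotient_module)
  have "(\<lambda>(g, h)\<in>carrier G \<times> carrier G. a g * b h) = cobdry2 c"
    using assms(2) by (auto intro!: restrict_ext)
  moreover have "cobdry2 c \<in> coboundaries2 G" by (auto simp: coboundaries2_def)
  ultimately have "cup G a b = coboundaries2 G"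
    unfolding cup_def using H2Q.KS.a_subset H2Q.coset_eq_zero_iff by auto
  then have "cup G a b = \<zero>\<^bsub>H2_coh G\<^esub>" by (simp add: H2_coh_def mod_quot_simps)
  moreover have "\<phi> (0 \<odot>\<^bsub>H2_coh G\<^esub> \<zero>\<^bsub>H2_coh G\<^esub>) = 0 * \<phi> \<zero>\<^bsub>H2_coh G\<^esub>"
    using assms(1) Q.M.zero_closed by (simp only: H2_dual_def) blast
  ultimately show ?thesis using Q.smult_r_null[of 0] by simp
qed

end

section \<open>Lie algebras and their derived series\<close>

lemma (in nonassoc_algebra) subalgebra:
  assumes "submodule S Cx A" "\<And>x y. x \<in> S \<Longrightarrow> y \<in> S \<Longrightarrow> x \<otimes> y \<in> S"
  shows "nonassoc_algebra (A\<lparr>carrier := S\<rparr>)"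
proof (intro nonassoc_algebra.intro nonassoc_algebra_axioms.intro)
  show "module Cx (A\<lparr>carrier := S\<rparr>)"
    by (rule submodule.submodule_is_module[OF assms(1) module_axioms])
qed (use submoduleE(1)[OF assms(1)] assms(2) in
    \<open>auto simp: mult_l_distr mult_r_distr smult_mult_l smult_mult_r subset_iff\<close>)

locale lie_algebra = nonassoc_algebra A for A :: "(complex, 'b, 'm) module_scheme" (structure) +
  assumes mult_self: "x \<in> carrier A \<Longrightarrow> x \<otimes> x = \<zero>"
    and jacobi: "x \<in> carrier A \<Longrightarrow> y \<in> carrier A \<Longrightarrow> z \<in> carrier A \<Longrightarrow>
      x \<otimes> (y \<otimes> z) \<oplus> (y \<otimes> (z \<otimes> x) \<oplus> z \<otimes> (x \<otimes> y)) = \<zero>"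
begin

lemma mult_anticomm:
  assumes "x \<in> carrier A" "y \<in> carrier A" shows "y \<otimes> x = \<ominus> (x \<otimes> y)"
proof -
  have "(x \<oplus> y) \<otimes> (x \<oplus> y) = (x \<otimes> x \<oplus> y \<otimes> x) \<oplus> (x \<otimes> y \<oplus> y \<otimes> y)"
    using assms by (simp add: mult_l_distr mult_r_distr)
  then have "y \<otimes> x \<oplus> x \<otimes> y = \<zero>" using assms by (simp add: mult_self)
  then show ?thesis using assms by (metis M.minus_equality mult_closed)
qed

lemma jacobi_derivation:
  assumes "x \<in> carrier A" "y \<in> carrier A" "z \<in> carrier A"
  shows "x \<otimes> (y \<otimes> z) = (x \<otimes> y) \<otimes> z \<oplus> y \<otimes> (x \<otimes> z)"
proof -
  have "x \<otimes> (y \<otimes> z) = \<ominus> (y \<otimes> (z \<otimes> x) \<oplus> z \<otimes> (x \<otimes> y))"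
    using jacobi[OF assms] assms by (intro M.minus_equality[symmetric]) auto
  also have "\<dots> = \<ominus> (y \<otimes> (z \<otimes> x)) \<oplus> \<ominus> (z \<otimes> (x \<otimes> y))"
    using assms by (simp add: M.minus_add)
  also have "\<ominus> (z \<otimes> (x \<otimes> y)) = (x \<otimes> y) \<otimes> z"
    using mult_anticomm[of z "x \<otimes> y"] assms by simp
  also have "\<ominus> (y \<otimes> (z \<otimes> x)) = y \<otimes> (x \<otimes> z)"
    using mult_anticomm[of z x] assms by (simp add: mult_minus_r)
  finally show ?thesis using assms by (simp add: M.a_comm)
qed

abbreviation D1 :: "'b set" where "D1 \<equiv> carrier (derived_alg A)"
abbreviation D2 :: "'b set" where "D2 \<equiv> carrier (derived_alg (derived_alg A))"

lemma D1_eq: "D1 = lin_span Cx A {x \<otimes> y | x y. x \<in> carrier A \<and> y \<in> carrier A}"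
  by (simp add: derived_alg_def)

lemma D1_submodule: "submodule D1 Cx A"
  unfolding D1_eq by (rule lin_span_submodule) auto

lemma D1_subset: "x \<in> D1 \<Longrightarrow> x \<in> carrier A"
  using submoduleE(1)[OF D1_submodule] by blast

lemma mult_D1: "x \<in> carrier A \<Longrightarrow> y \<in> carrier A \<Longrightarrow> x \<otimes> y \<in> D1"
  unfolding D1_eq by (rule subsetD[OF lin_span_superset]) blast

lemma D1_simps:
  "x \<oplus>\<^bsub>derived_alg A\<^esub> y = x \<oplus> y" "\<zero>\<^bsub>derived_alg A\<^esub> = \<zero>" "x \<otimes>\<^bsub>derived_alg A\<^esub> y = x \<otimes> y"
  "c \<odot>\<^bsub>derived_alg A\<^esub> x = c \<odot> x"
  by (simp_all add: derived_alg_def)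

lemma derived_nonassoc_algebra: "nonassoc_algebra (derived_alg A)"
proof -
  have "derived_alg A = A\<lparr>carrier := D1\<rparr>" by (simp add: derived_alg_def)
  moreover have "nonassoc_algebra (A\<lparr>carrier := D1\<rparr>)"
    by (rule subalgebra[OF D1_submodule]) (simp add: mult_D1 D1_subset)
  ultimately show ?thesis by simp
qed

lemma D2_eq: "D2 = lin_span Cx (derived_alg A) {x \<otimes> y | x y. x \<in> D1 \<and> y \<in> D1}"
  by (simp add: derived_alg_def[of "derived_alg A"] D1_simps)

lemma D2_submodule: "submodule D2 Cx (derived_alg A)"
proof -
  interpret D: nonassoc_algebra "derived_alg A" by (rule derived_nonassoc_algebra)
  show ?thesis unfolding D2_eq by (rule D.lin_span_submodule) (auto intro!: mult_D1 dest: D1_subset)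
qed

lemma D2_subset: "x \<in> D2 \<Longrightarrow> x \<in> D1"
proof -
  interpret D: nonassoc_algebra "derived_alg A" by (rule derived_nonassoc_algebra)
  show "x \<in> D2 \<Longrightarrow> x \<in> D1" using D.submoduleE(1)[OF D2_submodule] by blast
qed

lemma mult_D2:
  assumes "x \<in> D1" "y \<in> D1" shows "x \<otimes> y \<in> D2"
proof -
  interpret D: nonassoc_algebra "derived_alg A" by (rule derived_nonassoc_algebra)
  show ?thesis unfolding D2_eq by (rule subsetD[OF D.lin_span_superset]) (use assms in blast)
qed

lemma D2_induct:
  assumes "submodule W Cx (derived_alg A)" "\<And>x y. x \<in> D1 \<Longrightarrow> y \<in> D1 \<Longrightarrow> x \<otimes> y \<in> W" "z \<in> D2"
  shows "z \<in> W"
proof -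
  interpret D: nonassoc_algebra "derived_alg A" by (rule derived_nonassoc_algebra)
  have "D2 \<subseteq> W" unfolding D2_eq by (rule D.lin_span_least[OF assms(1)]) (use assms(2) in blast)
  with assms(3) show ?thesis by blast
qed

sublocale D: algebra_quotient "derived_alg A" D2
proof (intro algebra_quotient.intro algebra_quotient_axioms.intro derived_nonassoc_algebra)
  show "alg_ideal_of (derived_alg A) D2"
    using D2_submodule mult_D2 D2_subset by (auto simp: alg_ideal_of_def D1_simps)
qed

lemma derived_submoduleI:
  assumes "W \<subseteq> D1" "\<zero> \<in> W" "\<And>x y. x \<in> W \<Longrightarrow> y \<in> W \<Longrightarrow> x \<oplus> y \<in> W" "\<And>c x. x \<in> W \<Longrightarrow> c \<odot> x \<in> W"
  shows "submodule W Cx (derived_alg A)"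
proof (rule D.submoduleI)
  fix x assume "x \<in> W"
  then show "\<ominus>\<^bsub>derived_alg A\<^esub> x \<in> W"
    using D.smult_minus_one[of x] assms(1) assms(4)[of x "-1"] by (auto simp: D1_simps)
qed (use assms in \<open>auto simp: D1_simps\<close>)

text \<open>Multiplication by \<open>x\<close> is a derivation and maps \<open>D1\<close> into
  itself, so a product of two elements of \<open>D1\<close> is sent to a sum of two such products.
  Stability of \<open>D2\<close> under the whole algebra is what lets the adjoint action descend to
  \<open>D1 / D2\<close>.\<close>

lemma mult_D2_left:
  assumes x: "x \<in> carrier A" and z: "z \<in> D2" shows "x \<otimes> z \<in> D2"
proof -
  have "z \<in> {z \<in> D1. x \<otimes> z \<in> D2}"
  proof (rule D2_induct[OF _ _ z], rule derived_submoduleI)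
    show "\<zero> \<in> {z \<in> D1. x \<otimes> z \<in> D2}"
      using D.M.zero_closed D.submodule_zero[OF D2_submodule] x by (simp add: D1_simps)
  next
    fix y z assume *: "y \<in> {z \<in> D1. x \<otimes> z \<in> D2}" "z \<in> {z \<in> D1. x \<otimes> z \<in> D2}"
    then have "y \<oplus> z \<in> D1" using D.M.a_closed[of y z] by (simp add: D1_simps)
    moreover have "x \<otimes> y \<oplus> x \<otimes> z \<in> D2" using * D.KS.a_closed[of "x \<otimes> y" "x \<otimes> z"] by (simp add: D1_simps)
    ultimately show "y \<oplus> z \<in> {z \<in> D1. x \<otimes> z \<in> D2}" using * x by (simp add: mult_r_distr D1_subset)
  next
    fix c z assume *: "z \<in> {z \<in> D1. x \<otimes> z \<in> D2}"
    then have "c \<odot> z \<in> D1" "c \<odot> (x \<otimes> z) \<in> D2"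
      using D.smult_closed[of c z] D.submoduleE(4)[OF D2_submodule, of c "x \<otimes> z"] by (auto simp: D1_simps)
    then show "c \<odot> z \<in> {z \<in> D1. x \<otimes> z \<in> D2}" using * x by (simp add: smult_mult_r D1_subset)
  next
    fix y z assume *: "y \<in> D1" "z \<in> D1"
    note c = D1_subset[OF *(1)] D1_subset[OF *(2)]
    have "x \<otimes> (y \<otimes> z) = (x \<otimes> y) \<otimes> z \<oplus> y \<otimes> (x \<otimes> z)" by (rule jacobi_derivation[OF x c])
    moreover have "(x \<otimes> y) \<otimes> z \<in> D2" "y \<otimes> (x \<otimes> z) \<in> D2"
      using * c x by (auto intro!: mult_D2 mult_D1)
    ultimately show "y \<otimes> z \<in> {z \<in> D1. x \<otimes> z \<in> D2}"
      using D.KS.a_closed[of "(x \<otimes> y) \<otimes> z" "y \<otimes> (x \<otimes> z)"] c by (simp add: D1_simps mult_D1)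
  qed auto
  then show ?thesis by simp
qed

section \<open>The derived algebra modulo its derived algebra, with the adjoint action\<close>

definition cls :: "'b \<Rightarrow> 'b set"
  where "cls y = D2 +>\<^bsub>derived_alg A\<^esub> y"

abbreviation D_quot :: "(complex, 'b set) module"
  where "D_quot \<equiv> mod_quot (derived_alg A) D2"

definition adj :: "'b \<Rightarrow> 'b set \<Rightarrow> 'b set"
  where "adj x Z = (\<Union>y\<in>Z. D2 +>\<^bsub>derived_alg A\<^esub> (x \<otimes> y))"

lemma cls_carrier: "carrier D_quot = cls ` D1"
  by (simp add: mod_quot_simps(1) cls_def[abs_def])

lemma cls_closed: "x \<in> D1 \<Longrightarrow> cls x \<in> carrier D_quot"
  by (simp add: cls_carrier)

lemma cls_add: "x \<in> D1 \<Longrightarrow> y \<in> D1 \<Longrightarrow> cls x \<oplus>\<^bsub>D_quot\<^esub> cls y = cls (x \<oplus> y)"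
  using D.coset_add[of x y] by (simp add: cls_def D1_simps)

lemma cls_smult: "x \<in> D1 \<Longrightarrow> c \<odot>\<^bsub>D_quot\<^esub> cls x = cls (c \<odot> x)"
  using D.coset_smult[of c x] by (simp add: cls_def D1_simps)

lemma cls_minus: "x \<in> D1 \<Longrightarrow> \<ominus>\<^bsub>D_quot\<^esub> cls x = cls (\<ominus> x)"
  using D.coset_minus[of x] D.smult_minus_one[of x] smult_minus_one[of x]
  by (simp add: cls_def D1_simps D1_subset)

lemma cls_eq_zero_iff: "x \<in> D1 \<Longrightarrow> cls x = \<zero>\<^bsub>D_quot\<^esub> \<longleftrightarrow> x \<in> D2"
  using D.coset_eq_zero_iff[of x] by (simp add: cls_def mod_quot_simps(2))

lemma cls_zero: "cls \<zero> = \<zero>\<^bsub>D_quot\<^esub>"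
  using D.coset_zero by (simp add: cls_def mod_quot_simps(2) D1_simps)

lemma adj_cls:
  assumes x: "x \<in> carrier A" and y: "y \<in> D1" shows "adj x (cls y) = cls (x \<otimes> y)"
  unfolding adj_def cls_def
proof (rule D.coset_UN[OF y, of "\<lambda>y. D2 +>\<^bsub>derived_alg A\<^esub> (x \<otimes> y)"])
  fix z assume z: "z \<in> D1" "D2 +>\<^bsub>derived_alg A\<^esub> z = D2 +>\<^bsub>derived_alg A\<^esub> y"
  from z(2) have "z \<ominus>\<^bsub>derived_alg A\<^esub> y \<in> D2" by (rule iffD1[OF D.coset_eq_iff[OF z(1) y]])
  then have "x \<otimes> (z \<ominus>\<^bsub>derived_alg A\<^esub> y) \<in> D2" by (rule mult_D2_left[OF x])
  moreover have m: "\<ominus>\<^bsub>derived_alg A\<^esub> w = \<ominus> w" if "w \<in> D1" for w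
    using D.smult_minus_one[OF that] smult_minus_one[OF D1_subset[OF that]] by (simp add: D1_simps)
  have "x \<otimes> (z \<ominus>\<^bsub>derived_alg A\<^esub> y) = (x \<otimes> z) \<ominus>\<^bsub>derived_alg A\<^esub> (x \<otimes> y)"
    using x z y by (simp add: a_minus_def m mult_D1 D1_subset D1_simps mult_r_distr mult_minus_r)
  ultimately show "D2 +>\<^bsub>derived_alg A\<^esub> (x \<otimes> z) = D2 +>\<^bsub>derived_alg A\<^esub> (x \<otimes> y)"
    using D.coset_eq_iff[OF mult_D1[OF x D1_subset[OF z(1)]] mult_D1[OF x D1_subset[OF y]]] by simp
qed

text \<open>By the Jacobi identity the commutator of the two operators is the action of
  \<open>x \<otimes> y\<close>. This element lies in \<open>D1\<close> and multiplies
  \<open>D1\<close> into \<open>D2\<close>, so it acts as zero on the quotient.\<close>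

lemma adj_commute:
  assumes x: "x \<in> carrier A" "y \<in> carrier A" and Z: "Z \<in> carrier D_quot"
  shows "adj x (adj y Z) = adj y (adj x Z)"
proof -
  obtain z where z: "z \<in> D1" "Z = cls z" using Z by (auto simp: cls_carrier)
  note zc = D1_subset[OF z(1)]
  have d: "x \<otimes> (y \<otimes> z) = (x \<otimes> y) \<otimes> z \<oplus> y \<otimes> (x \<otimes> z)" by (rule jacobi_derivation[OF x zc])
  have e: "(x \<otimes> y) \<otimes> z \<in> D2" using x z by (intro mult_D2 mult_D1)
  interpret Q: module Cx D_quot by (rule D.quotient_module)
  have "cls (x \<otimes> (y \<otimes> z)) = cls ((x \<otimes> y) \<otimes> z) \<oplus>\<^bsub>D_quot\<^esub> cls (y \<otimes> (x \<otimes> z))"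
    unfolding d using x zc by (subst cls_add) (auto intro!: mult_D1)
  also have "cls ((x \<otimes> y) \<otimes> z) = \<zero>\<^bsub>D_quot\<^esub>" using cls_eq_zero_iff[OF D2_subset[OF e]] e by simp
  also have "\<zero>\<^bsub>D_quot\<^esub> \<oplus>\<^bsub>D_quot\<^esub> cls (y \<otimes> (x \<otimes> z)) = cls (y \<otimes> (x \<otimes> z))"
    using x zc by (intro Q.M.l_zero cls_closed mult_D1) auto
  finally show ?thesis using x zc z by (simp add: adj_cls mult_D1)
qed

lemma adj_linear:
  assumes "x \<in> carrier A" "Z \<in> carrier D_quot" "Y \<in> carrier D_quot"
  shows "adj x Z \<in> carrier D_quot" "adj x (Z \<oplus>\<^bsub>D_quot\<^esub> Y) = adj x Z \<oplus>\<^bsub>D_quot\<^esub> adj x Y"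
    "adj x (c \<odot>\<^bsub>D_quot\<^esub> Z) = c \<odot>\<^bsub>D_quot\<^esub> adj x Z"
proof -
  obtain z y where z: "z \<in> D1" "Z = cls z" and y: "y \<in> D1" "Y = cls y" using assms by (auto simp: cls_carrier)
  have c: "z \<oplus> y \<in> D1" "c \<odot> z \<in> D1"
    using D.M.a_closed[OF z(1) y(1)] D.smult_closed[OF _ z(1), of c] by (simp_all add: D1_simps)
  note zc = D1_subset[OF z(1)] D1_subset[OF y(1)]
  show "adj x Z \<in> carrier D_quot" "adj x (Z \<oplus>\<^bsub>D_quot\<^esub> Y) = adj x Z \<oplus>\<^bsub>D_quot\<^esub> adj x Y"
    "adj x (c \<odot>\<^bsub>D_quot\<^esub> Z) = c \<odot>\<^bsub>D_quot\<^esub> adj x Z"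
    using z y zc c assms(1)
    by (simp_all add: adj_cls cls_add cls_smult cls_closed mult_D1 mult_r_distr smult_mult_r)
qed

end

section \<open>The holonomy Lie algebra\<close>

abbreviation gen :: "'v \<Rightarrow> 'v mag \<Rightarrow>\<^sub>0 complex"
  where "gen v \<equiv> Poly_Mapping.single (Gen v) 1"

definition lie_rels :: "(complex, 'v, 'm) module_scheme \<Rightarrow> ('v mag \<Rightarrow>\<^sub>0 complex) set"
  where "lie_rels V = (let A = free_nonassoc (carrier V) in
      {gen (u \<oplus>\<^bsub>V\<^esub> v) - gen u - gen v | u v. u \<in> carrier V \<and> v \<in> carrier V} \<union>
      {gen (c \<odot>\<^bsub>V\<^esub> u) - c \<odot>\<^bsub>A\<^esub> gen u | c u. u \<in> carrier V} \<union>
      {x \<otimes>\<^bsub>A\<^esub> x | x. x \<in> carrier A} \<union>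
      {x \<otimes>\<^bsub>A\<^esub> (y \<otimes>\<^bsub>A\<^esub> z) + y \<otimes>\<^bsub>A\<^esub> (z \<otimes>\<^bsub>A\<^esub> x) + z \<otimes>\<^bsub>A\<^esub> (x \<otimes>\<^bsub>A\<^esub> y) | x y z.
        x \<in> carrier A \<and> y \<in> carrier A \<and> z \<in> carrier A})"

lemma lie_ideal_eq: "lie_ideal V = alg_ideal (free_nonassoc (carrier V)) (lie_rels V)"
  by (simp add: lie_ideal_def lie_rels_def Let_def)

text \<open>A preimage of \<open>wedge_to_lie\<close> in the free non-associative algebra, so that
  membership of the holonomy relations in an ideal can be tested on explicit trees.\<close>

definition wedge_lift :: "('v \<times> 'v) list \<Rightarrow> 'v mag \<Rightarrow>\<^sub>0 complex"
  where "wedge_lift ws = (\<Sum>(u, v)\<leftarrow>ws. Poly_Mapping.single (Node (Gen u) (Gen v)) 1)"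

lemma free_nonassoc_minus:
  assumes "p \<in> carrier (free_nonassoc Z)" shows "\<ominus>\<^bsub>free_nonassoc Z\<^esub> p = - p"
proof -
  interpret nonassoc_algebra "free_nonassoc Z" by (rule free_nonassoc_algebra)
  show ?thesis using assms by (intro M.minus_equality) auto
qed

lemma free_nonassoc_diff_closed:
  "p \<in> carrier (free_nonassoc Z) \<Longrightarrow> q \<in> carrier (free_nonassoc Z) \<Longrightarrow> p - q \<in> carrier (free_nonassoc Z)"
  using keys_minus_subset[of p q] by auto

context group_homology
begin

abbreviation V :: "(complex, ('a \<Rightarrow>\<^sub>0 complex) set) module" where "V \<equiv> H_1 G"
abbreviation FN :: "(complex, ('a \<Rightarrow>\<^sub>0 complex) set mag \<Rightarrow>\<^sub>0 complex) module"
  where "FN \<equiv> free_nonassoc (carrier V)"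
abbreviation HL :: "(complex, 'a lieH1 set) module" where "HL \<equiv> holonomy G"

lemma gen_closed: "v \<in> carrier V \<Longrightarrow> gen v \<in> carrier FN"
  by simp

lemma lie_rels_closed: "lie_rels V \<subseteq> carrier FN"
proof -
  interpret N: nonassoc_algebra FN by (rule free_nonassoc_algebra)
  interpret H: module Cx V by (rule H_1_module)
  have plus: "p + q \<in> carrier FN" if "p \<in> carrier FN" "q \<in> carrier FN" for p q
    using N.M.a_closed[OF that] by simp
  have scale: "c \<odot>\<^bsub>FN\<^esub> p \<in> carrier FN" if "p \<in> carrier FN" for c p
    using N.smult_closed[OF _ that, of c] by simp
  show ?thesis
    unfolding lie_rels_def Let_def
    by (intro Un_least subsetI; elim CollectE exE conjE; hypsubst;
        intro plus free_nonassoc_diff_closed scale gen_closed N.mult_closed H.M.a_closed H.smult_closed)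
      (assumption | simp only: Cx_simps UNIV_I)+
qed

sublocale FNQ: algebra_quotient FN "lie_ideal V"
  unfolding lie_ideal_eq
  by (intro algebra_quotient.intro algebra_quotient_axioms.intro free_nonassoc_algebra
    nonassoc_algebra.alg_ideal_is_ideal lie_rels_closed)

lemma FL_algebra: "nonassoc_algebra (free_lie V)"
  unfolding free_lie_def by (rule FNQ.quotient_algebra)

abbreviation fl :: "(('a \<Rightarrow>\<^sub>0 complex) set mag \<Rightarrow>\<^sub>0 complex) \<Rightarrow> 'a lieH1"
  where "fl p \<equiv> lie_ideal V +>\<^bsub>FN\<^esub> p"

lemma FL_carrier: "carrier (free_lie V) = fl ` carrier FN"
  by (simp add: free_lie_def mod_quot_simps(1))

lemma wedge_to_lie_eq:
  assumes "set ws \<subseteq> carrier V \<times> carrier V"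
  shows "wedge_lift ws \<in> carrier FN" "wedge_to_lie V ws = fl (wedge_lift ws)"
proof -
  have "wedge_lift ws \<in> carrier FN \<and> wedge_to_lie V ws = fl (wedge_lift ws)" using assms
  proof (induction ws)
    case Nil
    then show ?case using FNQ.coset_zero
      by (simp add: wedge_lift_def wedge_to_lie_def free_lie_def mod_quot_simps)
  next
    case (Cons w ws)
    obtain u v where w: "w = (u, v)" "u \<in> carrier V" "v \<in> carrier V" using Cons.prems by (cases w) auto
    have m: "gen u \<otimes>\<^bsub>FN\<^esub> gen v = Poly_Mapping.single (Node (Gen u) (Gen v)) 1"
      by (simp add: free_nonassoc_single_mult)
    have c: "Poly_Mapping.single (Node (Gen u) (Gen v)) 1 \<in> carrier FN" using w by simp
    have IH: "wedge_lift ws \<in> carrier FN" "wedge_to_lie V ws = fl (wedge_lift ws)" using Cons by auto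
    have "wedge_to_lie V (w # ws) = (fl (gen u) \<otimes>\<^bsub>free_lie V\<^esub> fl (gen v)) \<oplus>\<^bsub>free_lie V\<^esub> fl (wedge_lift ws)"
      using IH(2) w(1) by (simp add: wedge_to_lie_def lie_gen_def)
    also have "fl (gen u) \<otimes>\<^bsub>free_lie V\<^esub> fl (gen v) = fl (Poly_Mapping.single (Node (Gen u) (Gen v)) 1)"
      unfolding m[symmetric] free_lie_def using w by (intro FNQ.coset_mult gen_closed)
    also have "\<dots> \<oplus>\<^bsub>free_lie V\<^esub> fl (wedge_lift ws) = fl (Poly_Mapping.single (Node (Gen u) (Gen v)) 1 \<oplus>\<^bsub>FN\<^esub> wedge_lift ws)"
      unfolding free_lie_def by (rule FNQ.coset_add[OF c IH(1)])
    finally have "wedge_to_lie V (w # ws) = fl (wedge_lift (w # ws))" using w(1) by (simp add: wedge_lift_def)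
    moreover have "wedge_lift (w # ws) \<in> carrier FN"
      using FNQ.M.a_closed[OF c IH(1)] w(1) by (simp add: wedge_lift_def)
    ultimately show ?case by blast
  qed
  then show "wedge_lift ws \<in> carrier FN" "wedge_to_lie V ws = fl (wedge_lift ws)" by blast+
qed

definition wedge_rels :: "(('a \<Rightarrow>\<^sub>0 complex) set \<times> ('a \<Rightarrow>\<^sub>0 complex) set) list set"
  where "wedge_rels = {ws. \<exists>\<phi>\<in>H2_dual G. represents_dual_cup G \<phi> ws}"

lemma wedge_rels_closed: "ws \<in> wedge_rels \<Longrightarrow> set ws \<subseteq> carrier V \<times> carrier V"
  by (auto simp: wedge_rels_def represents_dual_cup_def)

lemma holonomy_ideal_eq: "holonomy_ideal G = alg_ideal (free_lie V) ((\<lambda>ws. fl (wedge_lift ws)) ` wedge_rels)"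
proof -
  have "{wedge_to_lie V ws | ws. \<exists>\<phi>\<in>H2_dual G. represents_dual_cup G \<phi> ws} = wedge_to_lie V ` wedge_rels"
    by (auto simp: wedge_rels_def)
  also have "\<dots> = (\<lambda>ws. fl (wedge_lift ws)) ` wedge_rels"
    by (intro image_cong refl wedge_to_lie_eq wedge_rels_closed)
  finally show ?thesis by (simp add: holonomy_ideal_def)
qed

lemma wedge_rels_FL: "(\<lambda>ws. fl (wedge_lift ws)) ` wedge_rels \<subseteq> carrier (free_lie V)"
  unfolding FL_carrier using wedge_to_lie_eq(1) wedge_rels_closed by blast

sublocale HLQ: algebra_quotient "free_lie V" "holonomy_ideal G"
  unfolding holonomy_ideal_eq
  by (intro algebra_quotient.intro algebra_quotient_axioms.intro FL_algebra
    nonassoc_algebra.alg_ideal_is_ideal wedge_rels_FL)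

text \<open>The composite of the two quotient maps. Elements of the holonomy Lie algebra are handled
  through preimages under \<open>proj\<close>, so that calculations with nested cosets become
  calculations with formal sums of trees.\<close>

definition proj :: "(('a \<Rightarrow>\<^sub>0 complex) set mag \<Rightarrow>\<^sub>0 complex) \<Rightarrow> 'a lieH1 set"
  where "proj p = holonomy_ideal G +>\<^bsub>free_lie V\<^esub> fl p"

lemma fl_closed: "p \<in> carrier FN \<Longrightarrow> fl p \<in> carrier (free_lie V)"
  by (simp add: FL_carrier)

lemma HL_carrier: "carrier HL = proj ` carrier FN"
  by (simp add: holonomy_def mod_quot_simps(1) FL_carrier image_image proj_def[abs_def])

lemma proj_closed: "p \<in> carrier FN \<Longrightarrow> proj p \<in> carrier HL"
  by (simp add: HL_carrier)

lemma proj_add: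
  assumes "p \<in> carrier FN" "q \<in> carrier FN" shows "proj p \<oplus>\<^bsub>HL\<^esub> proj q = proj (p + q)"
  using HLQ.coset_add[OF fl_closed[OF assms(1)] fl_closed[OF assms(2)]] FNQ.coset_add[OF assms]
  by (simp add: proj_def holonomy_def free_lie_def)

lemma proj_smult:
  assumes "p \<in> carrier FN" shows "c \<odot>\<^bsub>HL\<^esub> proj p = proj (pm_scale c p)"
  using HLQ.coset_smult[OF _ fl_closed[OF assms], of c] FNQ.coset_smult[OF _ assms, of c]
  by (simp add: proj_def holonomy_def free_lie_def)

lemma proj_mult:
  assumes "p \<in> carrier FN" "q \<in> carrier FN" shows "proj p \<otimes>\<^bsub>HL\<^esub> proj q = proj (p \<otimes>\<^bsub>FN\<^esub> q)"
  using HLQ.coset_mult[OF fl_closed[OF assms(1)] fl_closed[OF assms(2)]] FNQ.coset_mult[OF assms]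
  by (simp add: proj_def holonomy_def free_lie_def)

lemma proj_zero: "proj 0 = \<zero>\<^bsub>HL\<^esub>"
  using HLQ.coset_zero FNQ.coset_zero by (simp add: proj_def holonomy_def mod_quot_simps free_lie_def)

lemma proj_lie_ideal:
  assumes "p \<in> lie_ideal V" shows "proj p = \<zero>\<^bsub>HL\<^esub>"
proof -
  have p: "p \<in> carrier FN" using assms FNQ.KS.a_subset by blast
  have "fl p = fl 0" using FNQ.coset_eq_zero_iff[OF p] FNQ.coset_zero assms by simp
  then show ?thesis using proj_zero by (simp add: proj_def)
qed

lemma holonomy_gen_eq: "holonomy_gen G u = proj (gen u)"
  by (simp add: holonomy_gen_def lie_gen_def proj_def)

lemma lie_rels_proj: "p \<in> lie_rels V \<Longrightarrow> proj p = \<zero>\<^bsub>HL\<^esub>"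
  using FNQ.alg_ideal_superset[of "lie_rels V"] by (intro proj_lie_ideal) (auto simp: lie_ideal_eq)

lemma HL_nonassoc_algebra: "nonassoc_algebra HL"
  unfolding holonomy_def by (rule HLQ.quotient_algebra)

sublocale HL: lie_algebra HL
proof (intro lie_algebra.intro lie_algebra_axioms.intro HL_nonassoc_algebra)
  fix x assume "x \<in> carrier HL"
  then obtain p where p: "p \<in> carrier FN" "x = proj p" by (auto simp: HL_carrier)
  have "p \<otimes>\<^bsub>FN\<^esub> p \<in> lie_rels V" unfolding lie_rels_def Let_def using p(1) by blast
  from lie_rels_proj[OF this] show "x \<otimes>\<^bsub>HL\<^esub> x = \<zero>\<^bsub>HL\<^esub>" by (simp only: p(2) proj_mult[OF p(1) p(1)])
next
  fix x y z assume "x \<in> carrier HL" "y \<in> carrier HL" "z \<in> carrier HL"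
  then obtain p q r where p: "p \<in> carrier FN" "x = proj p" and q: "q \<in> carrier FN" "y = proj q"
    and r: "r \<in> carrier FN" "z = proj r" by (auto simp: HL_carrier)
  have "p \<otimes>\<^bsub>FN\<^esub> (q \<otimes>\<^bsub>FN\<^esub> r) + q \<otimes>\<^bsub>FN\<^esub> (r \<otimes>\<^bsub>FN\<^esub> p) + r \<otimes>\<^bsub>FN\<^esub> (p \<otimes>\<^bsub>FN\<^esub> q) \<in> lie_rels V"
    unfolding lie_rels_def Let_def using p(1) q(1) r(1) by blast
  from lie_rels_proj[OF this]
  have "proj (p \<otimes>\<^bsub>FN\<^esub> (q \<otimes>\<^bsub>FN\<^esub> r) + (q \<otimes>\<^bsub>FN\<^esub> (r \<otimes>\<^bsub>FN\<^esub> p) + r \<otimes>\<^bsub>FN\<^esub> (p \<otimes>\<^bsub>FN\<^esub> q))) = \<zero>\<^bsub>HL\<^esub>"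
    by (simp only: add.assoc)
  moreover have "q \<otimes>\<^bsub>FN\<^esub> (r \<otimes>\<^bsub>FN\<^esub> p) + r \<otimes>\<^bsub>FN\<^esub> (p \<otimes>\<^bsub>FN\<^esub> q) \<in> carrier FN"
    using FNQ.M.a_closed[OF FNQ.mult_closed[OF q(1) FNQ.mult_closed[OF r(1) p(1)]]
        FNQ.mult_closed[OF r(1) FNQ.mult_closed[OF p(1) q(1)]]] by (simp only: free_nonassoc_simps)
  ultimately show "x \<otimes>\<^bsub>HL\<^esub> (y \<otimes>\<^bsub>HL\<^esub> z) \<oplus>\<^bsub>HL\<^esub> (y \<otimes>\<^bsub>HL\<^esub> (z \<otimes>\<^bsub>HL\<^esub> x) \<oplus>\<^bsub>HL\<^esub> z \<otimes>\<^bsub>HL\<^esub> (x \<otimes>\<^bsub>HL\<^esub> y)) = \<zero>\<^bsub>HL\<^esub>"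
    using p q r by (simp only: proj_mult FNQ.mult_closed proj_add)
qed

lemma holonomy_gen_closed: "u \<in> carrier V \<Longrightarrow> holonomy_gen G u \<in> carrier HL"
  by (simp add: holonomy_gen_eq proj_closed)

lemma holonomy_gen_add:
  assumes "u \<in> carrier V" "v \<in> carrier V"
  shows "holonomy_gen G (u \<oplus>\<^bsub>V\<^esub> v) = holonomy_gen G u \<oplus>\<^bsub>HL\<^esub> holonomy_gen G v"
proof -
  interpret H: module Cx V by (rule H_1_module)
  let ?r = "gen (u \<oplus>\<^bsub>V\<^esub> v) - gen u - gen v"
  have "?r \<in> lie_rels V" unfolding lie_rels_def Let_def using assms by blast
  from lie_rels_proj[OF this] subsetD[OF lie_rels_closed this]
  have r: "proj ?r = \<zero>\<^bsub>HL\<^esub>" "?r \<in> carrier FN" .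
  have s: "gen u + gen v \<in> carrier FN" "gen u \<in> carrier FN" "gen v \<in> carrier FN"
    using FNQ.M.a_closed[OF gen_closed[OF assms(1)] gen_closed[OF assms(2)]] assms by simp_all
  have "proj ?r \<oplus>\<^bsub>HL\<^esub> proj (gen u + gen v) = proj (?r + (gen u + gen v))" by (rule proj_add[OF r(2) s(1)])
  also have "?r + (gen u + gen v) = gen (u \<oplus>\<^bsub>V\<^esub> v)" by simp
  finally show ?thesis using s by (simp add: r(1) holonomy_gen_eq proj_add proj_closed)
qed

lemma holonomy_gen_smult:
  assumes "u \<in> carrier V"
  shows "holonomy_gen G (c \<odot>\<^bsub>V\<^esub> u) = c \<odot>\<^bsub>HL\<^esub> holonomy_gen G u"
proof -
  let ?r = "gen (c \<odot>\<^bsub>V\<^esub> u) - c \<odot>\<^bsub>FN\<^esub> gen u"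
  have "?r \<in> lie_rels V" unfolding lie_rels_def Let_def using assms by blast
  from lie_rels_proj[OF this] subsetD[OF lie_rels_closed this]
  have r: "proj ?r = \<zero>\<^bsub>HL\<^esub>" "?r \<in> carrier FN" .
  have s: "c \<odot>\<^bsub>FN\<^esub> gen u \<in> carrier FN" "gen u \<in> carrier FN"
    using FNQ.smult_closed[OF _ gen_closed[OF assms], of c] assms by simp_all
  have "proj ?r \<oplus>\<^bsub>HL\<^esub> proj (c \<odot>\<^bsub>FN\<^esub> gen u) = proj (?r + c \<odot>\<^bsub>FN\<^esub> gen u)" by (rule proj_add[OF r(2) s(1)])
  also have "?r + c \<odot>\<^bsub>FN\<^esub> gen u = gen (c \<odot>\<^bsub>V\<^esub> u)" by simp
  finally have "proj (c \<odot>\<^bsub>FN\<^esub> gen u) = proj (gen (c \<odot>\<^bsub>V\<^esub> u))"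
    by (simp only: r(1) HL.M.l_zero[OF proj_closed[OF s(1)]])
  then show ?thesis by (simp only: holonomy_gen_eq proj_smult[OF s(2)] free_nonassoc_simps(4))
qed

text \<open>The commuting pair spans a torus, and the functional \<open>torus_class g h\<close>
  exhibits the wedge of the two classes as a value of \<partial>. The bracket is therefore one of
  the generators of the holonomy ideal.\<close>

lemma holonomy_gen_commute:
  assumes "g \<in> carrier G" "h \<in> carrier G" "g \<otimes> h = h \<otimes> g"
  shows "holonomy_gen G (class1 G g) \<otimes>\<^bsub>HL\<^esub> holonomy_gen G (class1 G h) = \<zero>\<^bsub>HL\<^esub>"
proof -
  let ?ws = "[(class1 G g, class1 G h)]"
  have c: "gen (class1 G g) \<in> carrier FN" "gen (class1 G h) \<in> carrier FN"
    using assms by (simp_all add: class1_closed)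
  have ws: "?ws \<in> wedge_rels"
    unfolding wedge_rels_def using torus_class_H2_dual[OF assms] torus_class_represents[OF assms] by blast
  then have "fl (wedge_lift ?ws) \<in> holonomy_ideal G"
    unfolding holonomy_ideal_eq by (intro subsetD[OF HLQ.alg_ideal_superset]) blast
  moreover have w: "wedge_lift ?ws = gen (class1 G g) \<otimes>\<^bsub>FN\<^esub> gen (class1 G h)"
    by (simp add: wedge_lift_def free_nonassoc_single_mult)
  ultimately have "proj (wedge_lift ?ws) = holonomy_ideal G"
    unfolding proj_def using HLQ.coset_eq_zero_iff fl_closed[OF wedge_to_lie_eq(1)[OF wedge_rels_closed[OF ws]]] by blast
  then show ?thesis
    by (simp add: holonomy_gen_eq proj_mult[OF c] w) (simp add: holonomy_def mod_quot_simps)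
qed

text \<open>The universal property of the holonomy Lie algebra, phrased by means of kernels.\<close>

lemma proj_zero_in_ideal:
  assumes J: "alg_ideal_of FN J" and lie: "lie_rels V \<subseteq> J" and wedge: "\<And>ws. ws \<in> wedge_rels \<Longrightarrow> wedge_lift ws \<in> J"
    and p: "p \<in> carrier FN" "proj p = \<zero>\<^bsub>HL\<^esub>"
  shows "p \<in> J"
proof -
  note JS = conjunct1[OF J[unfolded alg_ideal_of_def]]
  note JE = FNQ.submoduleE[OF JS]
  have J_mult: "x \<otimes>\<^bsub>FN\<^esub> k \<in> J" "k \<otimes>\<^bsub>FN\<^esub> x \<in> J" if "x \<in> carrier FN" "k \<in> J" for x k
    using J that by (auto simp: alg_ideal_of_def)
  have JF: "k \<in> carrier FN" if "k \<in> J" for k using JE(1) that by blast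
  have LJ: "lie_ideal V \<subseteq> J"
    unfolding lie_ideal_eq by (rule FNQ.alg_ideal_least[OF J lie])
  \<comment> \<open>The image of \<open>J\<close> in the free Lie algebra is an ideal that contains
    the generators of the holonomy ideal, hence it contains \<open>fl p\<close>. So \<open>p\<close>
    agrees with an element of \<open>J\<close> up to the kernel of \<open>fl\<close>, and this
    kernel, the Lie ideal, also lies in \<open>J\<close>.\<close>
  have "alg_ideal_of (free_lie V) (fl ` J)"
    unfolding alg_ideal_of_def
  proof (intro conjI ballI)
    show "submodule (fl ` J) Cx (free_lie V)"
    proof (rule HLQ.submoduleI)
      show "fl ` J \<subseteq> carrier (free_lie V)" using JF fl_closed by blast
      have "\<zero>\<^bsub>free_lie V\<^esub> = fl \<zero>\<^bsub>FN\<^esub>" unfolding FNQ.coset_zero by (simp add: free_lie_def mod_quot_simps)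
      then show "\<zero>\<^bsub>free_lie V\<^esub> \<in> fl ` J" using FNQ.submodule_zero[OF JS] by blast
    next
      fix a assume "a \<in> fl ` J"
      then obtain k where k: "k \<in> J" "a = fl k" by blast
      have "\<ominus>\<^bsub>free_lie V\<^esub> a = fl (\<ominus>\<^bsub>FN\<^esub> k)"
        unfolding k(2) free_lie_def by (rule FNQ.coset_minus[OF JF[OF k(1)]])
      then show "\<ominus>\<^bsub>free_lie V\<^esub> a \<in> fl ` J" using JE(3)[OF k(1)] by blast
    next
      fix a b assume "a \<in> fl ` J" "b \<in> fl ` J"
      then obtain k l where k: "k \<in> J" "a = fl k" "l \<in> J" "b = fl l" by blast
      have "a \<oplus>\<^bsub>free_lie V\<^esub> b = fl (k \<oplus>\<^bsub>FN\<^esub> l)"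
        unfolding k(2,4) free_lie_def by (rule FNQ.coset_add[OF JF[OF k(1)] JF[OF k(3)]])
      then show "a \<oplus>\<^bsub>free_lie V\<^esub> b \<in> fl ` J" using JE(5)[OF k(1,3)] by blast
    next
      fix c a assume "a \<in> fl ` J"
      then obtain k where k: "k \<in> J" "a = fl k" by blast
      have "c \<odot>\<^bsub>free_lie V\<^esub> a = fl (c \<odot>\<^bsub>FN\<^esub> k)"
        unfolding k(2) free_lie_def by (rule FNQ.coset_smult[OF _ JF[OF k(1)]]) simp
      then show "c \<odot>\<^bsub>free_lie V\<^esub> a \<in> fl ` J" using JE(4)[OF _ k(1), of c] by simp
    qed
  next
    fix x a assume "x \<in> carrier (free_lie V)" "a \<in> fl ` J"
    then obtain y k where y: "y \<in> carrier FN" "x = fl y" and k: "k \<in> J" "a = fl k"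
      unfolding FL_carrier by blast
    have "x \<otimes>\<^bsub>free_lie V\<^esub> a = fl (y \<otimes>\<^bsub>FN\<^esub> k)" "a \<otimes>\<^bsub>free_lie V\<^esub> x = fl (k \<otimes>\<^bsub>FN\<^esub> y)"
      unfolding y(2) k(2) free_lie_def by (intro FNQ.coset_mult y JF[OF k(1)])+
    then show "x \<otimes>\<^bsub>free_lie V\<^esub> a \<in> fl ` J" "a \<otimes>\<^bsub>free_lie V\<^esub> x \<in> fl ` J"
      using J_mult[OF y(1) k(1)] by auto
  qed
  then have "holonomy_ideal G \<subseteq> fl ` J"
    unfolding holonomy_ideal_eq by (rule HLQ.alg_ideal_least) (use wedge in blast)
  moreover have "fl p \<in> holonomy_ideal G"
  proof -
    have "holonomy_ideal G +>\<^bsub>free_lie V\<^esub> fl p = holonomy_ideal G"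
      using p(2) by (simp add: proj_def holonomy_def mod_quot_simps(2))
    then show ?thesis using HLQ.coset_eq_zero_iff[OF fl_closed[OF p(1)]] by blast
  qed
  ultimately obtain k where k: "k \<in> J" "fl p = fl k" by blast
  then have "p \<ominus>\<^bsub>FN\<^esub> k \<in> lie_ideal V" by (intro iffD1[OF FNQ.coset_eq_iff[OF p(1) JF[OF k(1)]]])
  then have "p \<ominus>\<^bsub>FN\<^esub> k \<in> J" using LJ by blast
  then have "(p \<ominus>\<^bsub>FN\<^esub> k) \<oplus>\<^bsub>FN\<^esub> k \<in> J" using k(1) by (rule JE(5))
  moreover have "(p \<ominus>\<^bsub>FN\<^esub> k) \<oplus>\<^bsub>FN\<^esub> k = p"
    unfolding a_minus_def free_nonassoc_minus[OF JF[OF k(1)]] by simp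
  ultimately show ?thesis by simp
qed

lemma proj_spanning:
  assumes W: "submodule W Cx HL" and t: "\<And>t. set_mag t \<subseteq> carrier V \<Longrightarrow> proj (Poly_Mapping.single t 1) \<in> W"
  shows "W = carrier HL"
proof
  note WE = HL.submoduleE[OF W]
  show "W \<subseteq> carrier HL" by (rule WE(1))
  have "p \<in> {p \<in> carrier FN. proj p \<in> W}" if "p \<in> carrier FN" for p
  proof (rule pm_span_induct[where K = "{t. set_mag t \<subseteq> carrier V}"])
    show "supp p \<subseteq> {t. set_mag t \<subseteq> carrier V}" using that by auto
    show "0 \<in> {p \<in> carrier FN. proj p \<in> W}" using HL.submodule_zero[OF W] by (simp add: proj_zero)
  next
    fix p q assume "p \<in> {p \<in> carrier FN. proj p \<in> W}" "q \<in> {p \<in> carrier FN. proj p \<in> W}"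
    then have *: "p \<in> carrier FN" "q \<in> carrier FN" "proj p \<in> W" "proj q \<in> W" by blast+
    from FNQ.M.a_closed[OF *(1,2)] have "p + q \<in> carrier FN" by (simp only: free_nonassoc_simps(2))
    moreover from WE(5)[OF *(3,4)] have "proj (p + q) \<in> W" by (simp only: proj_add[OF *(1,2)])
    ultimately show "p + q \<in> {p \<in> carrier FN. proj p \<in> W}" by blast
  next
    fix c p assume "p \<in> {p \<in> carrier FN. proj p \<in> W}"
    then have *: "p \<in> carrier FN" "proj p \<in> W" by blast+
    from FNQ.smult_closed[OF _ *(1), of c] have "pm_scale c p \<in> carrier FN" by (simp only: free_nonassoc_simps(4) Cx_simps UNIV_I)
    moreover from WE(4)[OF _ *(2), of c] have "proj (pm_scale c p) \<in> W" by (simp only: proj_smult[OF *(1)] Cx_simps UNIV_I)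
    ultimately show "pm_scale c p \<in> {p \<in> carrier FN. proj p \<in> W}" by blast
  qed (use t in auto)
  then show "carrier HL \<subseteq> W" unfolding HL_carrier by blast
qed

end

section \<open>Polynomials acting through commuting operators\<close>

definition polys :: "'v set \<Rightarrow> 'v cpoly set"
  where "polys Z = {p. \<forall>m\<in>supp p. supp m \<subseteq> Z}"

lemma polys_zero [simp]: "0 \<in> polys Z"
  by (simp add: polys_def)

lemma polys_one [simp]: "1 \<in> polys Z"
  by (auto simp: polys_def)

lemma polys_add [intro]: "p \<in> polys Z \<Longrightarrow> q \<in> polys Z \<Longrightarrow> p + q \<in> polys Z"
  using Poly_Mapping.keys_add[of p q] by (auto simp: polys_def)

lemma polys_uminus [intro]: "p \<in> polys Z \<Longrightarrow> - p \<in> polys Z"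
  by (auto simp: polys_def in_keys_iff)

lemma polys_diff [intro]: "p \<in> polys Z \<Longrightarrow> q \<in> polys Z \<Longrightarrow> p - q \<in> polys Z"
  using polys_add[of p Z "- q"] polys_uminus[of q Z] by simp

lemma polys_mult [intro]:
  assumes "p \<in> polys Z" "q \<in> polys Z" shows "p * q \<in> polys Z"
  unfolding polys_def
proof (intro CollectI ballI)
  fix m assume "m \<in> supp (p * q)"
  then obtain a b where "m = a + b" "a \<in> supp p" "b \<in> supp q" using Poly_Mapping.keys_mult[of p q] by auto
  moreover from this have "supp a \<subseteq> Z" "supp b \<subseteq> Z" using assms by (auto simp: polys_def)
  ultimately show "supp m \<subseteq> Z" using Poly_Mapping.keys_add[of a b] by blast
qed

lemma polys_sum [intro]: "(\<And>a. a \<in> A \<Longrightarrow> f a \<in> polys Z) \<Longrightarrow> sum f A \<in> polys Z"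
  by (induction A rule: infinite_finite_induct) auto

lemma polys_const [simp]: "const_poly c \<in> polys Z"
  by (auto simp: polys_def const_poly_def)

lemma polys_var [simp]: "poly_var v \<in> polys Z \<longleftrightarrow> v \<in> Z"
  by (auto simp: polys_def poly_var_def)

lemma poly_ring_simps [simp]:
  "carrier (poly_ring Z) = polys Z" "p \<otimes>\<^bsub>poly_ring Z\<^esub> q = p * q" "\<one>\<^bsub>poly_ring Z\<^esub> = 1"
  "\<zero>\<^bsub>poly_ring Z\<^esub> = 0" "p \<oplus>\<^bsub>poly_ring Z\<^esub> q = p + q"
  by (simp_all add: poly_ring_def ring_of_type_algebra_def polys_def)

lemma poly_ring_cring: "cring (poly_ring Z)"
proof (rule cringI)
  show "abelian_group (poly_ring Z)"
  proof (rule abelian_groupI)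
    fix p assume "p \<in> carrier (poly_ring Z)"
    then show "\<exists>q\<in>carrier (poly_ring Z). q \<oplus>\<^bsub>poly_ring Z\<^esub> p = \<zero>\<^bsub>poly_ring Z\<^esub>"
      by (intro bexI[of _ "- p"]) auto
  qed (auto simp: algebra_simps)
  show "comm_monoid (poly_ring Z)"
    by (rule comm_monoidI) (auto simp: algebra_simps)
qed (auto simp: algebra_simps)

lemma poly_ring_finsum:
  assumes "finite A" "\<And>a. a \<in> A \<Longrightarrow> f a \<in> polys Z"
  shows "finsum (poly_ring Z) f A = sum f A"
proof -
  interpret cring "poly_ring Z" by (rule poly_ring_cring)
  show ?thesis using assms
  proof (induction A)
    case (insert a A)
    then have "f \<in> A \<rightarrow> carrier (poly_ring Z)" "f a \<in> carrier (poly_ring Z)" by auto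
    with insert show ?case by (simp add: finsum_insert)
  qed simp
qed

locale commuting_ops = module Cx M for M :: "(complex, 'b, 'm) module_scheme" (structure) +
  fixes vs :: "'v list" and D :: "'v \<Rightarrow> 'b \<Rightarrow> 'b"
  assumes D_closed: "v \<in> set vs \<Longrightarrow> x \<in> carrier M \<Longrightarrow> D v x \<in> carrier M"
    and D_add: "v \<in> set vs \<Longrightarrow> x \<in> carrier M \<Longrightarrow> y \<in> carrier M \<Longrightarrow> D v (x \<oplus> y) = D v x \<oplus> D v y"
    and D_smult: "v \<in> set vs \<Longrightarrow> x \<in> carrier M \<Longrightarrow> D v (c \<odot> x) = c \<odot> D v x"
    and D_commute: "v \<in> set vs \<Longrightarrow> w \<in> set vs \<Longrightarrow> x \<in> carrier M \<Longrightarrow> D v (D w x) = D w (D v x)"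
begin

definition mono_act :: "'v list \<Rightarrow> ('v \<Rightarrow>\<^sub>0 nat) \<Rightarrow> 'b \<Rightarrow> 'b"
  where "mono_act ws m = foldr (\<lambda>v. D v ^^ coef m v) ws"

definition act :: "'v cpoly \<Rightarrow> 'b \<Rightarrow> 'b"
  where "act p b = (\<Oplus>m\<in>supp p. coef p m \<odot> mono_act vs m b)"

lemma pow_closed: "v \<in> set vs \<Longrightarrow> x \<in> carrier M \<Longrightarrow> (D v ^^ k) x \<in> carrier M"
  by (induction k) (auto intro: D_closed)

lemma pow_add: "v \<in> set vs \<Longrightarrow> x \<in> carrier M \<Longrightarrow> y \<in> carrier M \<Longrightarrow> (D v ^^ k) (x \<oplus> y) = (D v ^^ k) x \<oplus> (D v ^^ k) y"
  by (induction k) (auto simp: D_add pow_closed)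

lemma pow_smult: "v \<in> set vs \<Longrightarrow> x \<in> carrier M \<Longrightarrow> (D v ^^ k) (c \<odot> x) = c \<odot> (D v ^^ k) x"
  by (induction k) (auto simp: D_smult pow_closed)

lemma D_pow_commute:
  "v \<in> set vs \<Longrightarrow> w \<in> set vs \<Longrightarrow> x \<in> carrier M \<Longrightarrow> D v ((D w ^^ k) x) = (D w ^^ k) (D v x)"
  by (induction k) (simp_all add: D_commute[of v w] pow_closed)

lemma pow_pow_commute:
  "v \<in> set vs \<Longrightarrow> w \<in> set vs \<Longrightarrow> x \<in> carrier M \<Longrightarrow> (D v ^^ k) ((D w ^^ l) x) = (D w ^^ l) ((D v ^^ k) x)"
  by (induction k) (simp_all add: D_pow_commute[of v w] pow_closed)

lemma mono_act_closed: "set ws \<subseteq> set vs \<Longrightarrow> x \<in> carrier M \<Longrightarrow> mono_act ws m x \<in> carrier M"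
  by (induction ws) (auto simp: mono_act_def pow_closed)

lemma mono_act_add:
  "set ws \<subseteq> set vs \<Longrightarrow> x \<in> carrier M \<Longrightarrow> y \<in> carrier M \<Longrightarrow>
    mono_act ws m (x \<oplus> y) = mono_act ws m x \<oplus> mono_act ws m y"
  by (induction ws) (use mono_act_closed in \<open>auto simp: mono_act_def pow_add\<close>)

lemma mono_act_smult:
  "set ws \<subseteq> set vs \<Longrightarrow> x \<in> carrier M \<Longrightarrow> mono_act ws m (c \<odot> x) = c \<odot> mono_act ws m x"
  by (induction ws) (use mono_act_closed in \<open>auto simp: mono_act_def pow_smult\<close>)

lemma mono_act_zero [simp]: "mono_act ws 0 x = x"
  by (induction ws) (auto simp: mono_act_def)

lemma mono_act_pow_commute:
  "set ws \<subseteq> set vs \<Longrightarrow> v \<in> set vs \<Longrightarrow> x \<in> carrier M \<Longrightarrow> mono_act ws m ((D v ^^ k) x) = (D v ^^ k) (mono_act ws m x)"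
  by (induction ws) (use mono_act_closed in \<open>auto simp: mono_act_def pow_pow_commute[of _ v]\<close>)

text \<open>The powers are composed in the fixed order of the list, and here commutativity enters:
  the power of \<open>v\<close> contributed by \<open>m'\<close> has to move past the remaining
  factors of \<open>m\<close>.\<close>

lemma mono_act_mult:
  "set ws \<subseteq> set vs \<Longrightarrow> x \<in> carrier M \<Longrightarrow> mono_act ws (m + m') x = mono_act ws m (mono_act ws m' x)"
proof (induction ws)
  case (Cons v ws)
  then have v: "v \<in> set vs" "set ws \<subseteq> set vs" by auto
  have step: "mono_act (v # ws) m x = (D v ^^ coef m v) (mono_act ws m x)" for m x
    by (simp add: mono_act_def)
  show ?case
    using Cons v by (simp add: step lookup_add funpow_add mono_act_pow_commute mono_act_closed)
qed (simp add: mono_act_def)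

lemma mono_act_var:
  assumes "distinct ws" "v \<in> set ws" shows "mono_act ws (Poly_Mapping.single v 1) x = D v x"
proof -
  have 0: "mono_act ws (Poly_Mapping.single v 1) x = x" if "v \<notin> set ws" for ws x
    using that by (induction ws) (auto simp: mono_act_def lookup_single when_def)
  show ?thesis using assms
  proof (induction ws)
    case (Cons w ws)
    have step: "mono_act (w # ws) m x = (D w ^^ coef m w) (mono_act ws m x)" for w ws m x
      by (simp add: mono_act_def)
    show ?case using Cons 0[of ws x] by (cases "w = v") (auto simp: step lookup_single)
  qed simp
qed

lemma act_superset:
  assumes "finite A" "supp p \<subseteq> A" "b \<in> carrier M"
  shows "act p b = (\<Oplus>m\<in>A. coef p m \<odot> mono_act vs m b)"
proof -
  have "(\<Oplus>m\<in>A. coef p m \<odot> mono_act vs m b) = (\<Oplus>m\<in>supp p \<union> (A - supp p). coef p m \<odot> mono_act vs m b)"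
    using assms(2) by (simp add: Un_absorb1)
  also have "\<dots> = act p b \<oplus> (\<Oplus>m\<in>A - supp p. coef p m \<odot> mono_act vs m b)"
    unfolding act_def using assms mono_act_closed by (intro M.finsum_Un_disjoint) auto
  also have "(\<Oplus>m\<in>A - supp p. coef p m \<odot> mono_act vs m b) = (\<Oplus>m\<in>A - supp p. \<zero>)"
    using smult_l_null assms mono_act_closed by (intro M.finsum_cong') (auto simp: in_keys_iff)
  also have "\<dots> = \<zero>" by simp
  finally show ?thesis using assms mono_act_closed by (auto simp: act_def)
qed

lemma act_closed [intro]: "b \<in> carrier M \<Longrightarrow> act p b \<in> carrier M"
  unfolding act_def using mono_act_closed by (intro M.finsum_closed) auto

lemma act_add_left:
  assumes b: "b \<in> carrier M" shows "act (p + q) b = act p b \<oplus> act q b"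
proof -
  let ?A = "supp p \<union> supp q"
  have c: "mono_act vs m b \<in> carrier M" for m using b mono_act_closed by auto
  have "act (p + q) b = (\<Oplus>m\<in>?A. coef p m \<odot> mono_act vs m b \<oplus> coef q m \<odot> mono_act vs m b)"
    using act_superset[OF _ Poly_Mapping.keys_add b, of p q] c smult_l_distr
    by (simp add: lookup_add)
  also have "\<dots> = (\<Oplus>m\<in>?A. coef p m \<odot> mono_act vs m b) \<oplus> (\<Oplus>m\<in>?A. coef q m \<odot> mono_act vs m b)"
    using c by (intro M.finsum_addf) auto
  also have "\<dots> = act p b \<oplus> act q b" using act_superset[of ?A _ b] b by simp
  finally show ?thesis .
qed

lemma act_single:
  assumes b: "b \<in> carrier M" shows "act (Poly_Mapping.single m c) b = c \<odot> mono_act vs m b"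
proof -
  have "act (Poly_Mapping.single m c) b = (\<Oplus>m'\<in>{m}. coef (Poly_Mapping.single m c) m' \<odot> mono_act vs m' b)"
    by (intro act_superset b) auto
  then show ?thesis using b mono_act_closed by simp
qed

lemma act_zero_left [simp]: "act 0 b = \<zero>"
  by (simp add: act_def)

lemma act_scale_left:
  assumes b: "b \<in> carrier M" shows "act (pm_scale c p) b = c \<odot> act p b"
proof -
  have m: "mono_act vs m b \<in> carrier M" for m using b mono_act_closed by auto
  have "act (pm_scale c p) b = (\<Oplus>m\<in>supp p. c \<odot> (coef p m \<odot> mono_act vs m b))"
    using act_superset[OF finite_keys keys_pm_scale b] m smult_assoc1 by simp
  also have "\<dots> = c \<odot> act p b"
    unfolding act_def using m by (intro finsum_smult_ldistr[symmetric]) auto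
  finally show ?thesis .
qed

lemma act_add_right:
  assumes "b \<in> carrier M" "b' \<in> carrier M" shows "act p (b \<oplus> b') = act p b \<oplus> act p b'"
proof -
  have c: "mono_act vs m b \<in> carrier M" "mono_act vs m b' \<in> carrier M" for m using assms mono_act_closed by auto
  have "act p (b \<oplus> b') = (\<Oplus>m\<in>supp p. coef p m \<odot> mono_act vs m b \<oplus> coef p m \<odot> mono_act vs m b')"
    unfolding act_def using c assms by (simp add: mono_act_add smult_r_distr)
  also have "\<dots> = act p b \<oplus> act p b'" unfolding act_def using c by (intro M.finsum_addf) auto
  finally show ?thesis .
qed

lemma act_one [simp]: "b \<in> carrier M \<Longrightarrow> act 1 b = b"
  using act_single[of b 0 1] smult_one by simp

lemma act_mult_monomial:
  assumes b: "b \<in> carrier M" shows "act (Poly_Mapping.single m 1 * q) b = mono_act vs m (act q b)"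
proof -
  have "q \<in> {q. act (Poly_Mapping.single m 1 * q) b = mono_act vs m (act q b)}"
  proof (rule pm_span_induct[of q UNIV])
    have "mono_act vs m \<zero> = \<zero>"
      using mono_act_smult[of vs "\<zero>" m 0] smult_l_null mono_act_closed[of vs "\<zero>" m] by simp
    then show "0 \<in> {q. act (Poly_Mapping.single m 1 * q) b = mono_act vs m (act q b)}" by simp
  next
    fix p q assume "p \<in> {q. act (Poly_Mapping.single m 1 * q) b = mono_act vs m (act q b)}"
      "q \<in> {q. act (Poly_Mapping.single m 1 * q) b = mono_act vs m (act q b)}"
    then show "p + q \<in> {q. act (Poly_Mapping.single m 1 * q) b = mono_act vs m (act q b)}"
      using b by (simp add: distrib_left act_add_left mono_act_add act_closed)
  next
    fix c p assume *: "p \<in> {q. act (Poly_Mapping.single m 1 * q) b = mono_act vs m (act q b)}"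
    have "Poly_Mapping.single m 1 * pm_scale c p = pm_scale c (Poly_Mapping.single m 1 * p)"
      by (simp add: mult_map_scale_conv_mult mult.left_commute)
    with * b show "pm_scale c p \<in> {q. act (Poly_Mapping.single m 1 * q) b = mono_act vs m (act q b)}"
      by (simp add: act_scale_left mono_act_smult act_closed)
  next
    fix t show "Poly_Mapping.single t 1 \<in> {q. act (Poly_Mapping.single m 1 * q) b = mono_act vs m (act q b)}"
      using b mono_act_closed smult_one by (simp add: mult_single act_single mono_act_mult)
  qed simp
  then show ?thesis by simp
qed

lemma act_mult:
  assumes b: "b \<in> carrier M" shows "act (p * q) b = act p (act q b)"
proof -
  have "p \<in> {p. act (p * q) b = act p (act q b)}"
  proof (rule pm_span_induct[of p UNIV])
    fix p p' assume "p \<in> {p. act (p * q) b = act p (act q b)}" "p' \<in> {p. act (p * q) b = act p (act q b)}"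
    then show "p + p' \<in> {p. act (p * q) b = act p (act q b)}"
      using b by (simp add: distrib_right act_add_left act_closed)
  next
    fix c p assume *: "p \<in> {p. act (p * q) b = act p (act q b)}"
    have "pm_scale c p * q = pm_scale c (p * q)"
      by (simp add: mult_map_scale_conv_mult mult.assoc)
    with * b show "pm_scale c p \<in> {p. act (p * q) b = act p (act q b)}"
      by (simp add: act_scale_left act_closed)
  next
    fix t show "Poly_Mapping.single t 1 \<in> {p. act (p * q) b = act p (act q b)}"
      using b act_closed[OF b, of q] smult_one mono_act_closed by (simp add: act_mult_monomial act_single)
  qed simp_all
  then show ?thesis by simp
qed

lemma act_var:
  "distinct vs \<Longrightarrow> v \<in> set vs \<Longrightarrow> b \<in> carrier M \<Longrightarrow> act (poly_var v) b = D v b"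
  unfolding poly_var_def using act_single[of b _ 1] mono_act_var[of vs v b] smult_one D_closed by simp

lemma act_const: "b \<in> carrier M \<Longrightarrow> act (const_poly c) b = c \<odot> b"
  unfolding const_poly_def by (simp add: act_single)

definition act_module :: "('v cpoly, 'b) module"
  where "act_module = \<lparr>carrier = carrier M, monoid.mult = monoid.mult M, one = one M,
    ring.zero = ring.zero M, add = add M, module.smult = act\<rparr>"

lemma act_module_simps [simp]:
  "carrier act_module = carrier M" "x \<oplus>\<^bsub>act_module\<^esub> y = x \<oplus> y" "\<zero>\<^bsub>act_module\<^esub> = \<zero>"
  "p \<odot>\<^bsub>act_module\<^esub> x = act p x"
  by (simp_all add: act_module_def)

lemma act_module_module: "module (poly_ring Z) act_module"
proof (rule moduleI)
  show "abelian_group act_module"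
  proof (rule abelian_groupI)
    fix x assume "x \<in> carrier act_module"
    then show "\<exists>y\<in>carrier act_module. y \<oplus>\<^bsub>act_module\<^esub> x = \<zero>\<^bsub>act_module\<^esub>"
      by (intro bexI[of _ "\<ominus> x"]) (auto simp: M.l_neg)
  qed (auto simp: M.a_ac)
qed (auto simp: poly_ring_cring act_add_left act_add_right act_mult)

end

lemma inf_alexander_act_module:
  assumes "commuting_ops (alexander_space G) vs (\<lambda>v. alexander_ad G (x v))"
  shows "inf_alexander G vs x = commuting_ops.act_module (alexander_space G) vs (\<lambda>v. alexander_ad G (x v))"
proof -
  interpret commuting_ops "alexander_space G" vs "\<lambda>v. alexander_ad G (x v)" by fact
  show ?thesis by (simp add: inf_alexander_def act_module_def Let_def act_def[abs_def] mono_act_def)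
qed

section \<open>The Jacobi relations and the columns of the matrix\<close>

definition unit_vec :: "triple \<Rightarrow> triple \<Rightarrow> (nat \<times> nat) cpoly"
  where "unit_vec T T' = (if T' = T then 1 else 0)"

text \<open>\<open>edge_bracket a b\<close> is the class of \<open>[x\<^sub>a, x\<^sub>b]\<close> in terms of the generators
  \<open>[x\<^sub>i\<^sub>j, x\<^sub>i\<^sub>k] = - [x\<^sub>i\<^sub>j, x\<^sub>j\<^sub>k]\<close> for \<open>i > j > k\<close>, all other brackets of edges being zero.\<close>

fun edge_bracket :: "nat \<times> nat \<Rightarrow> nat \<times> nat \<Rightarrow> triple \<Rightarrow> (nat \<times> nat) cpoly"
  where "edge_bracket (i, j) (i', j') =
    (if i = i' then
       if j' < j then unit_vec (i, j, j') else if j < j' then (\<lambda>T. - unit_vec (i, j', j) T) else (\<lambda>T. 0)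
     else if j = i' then (\<lambda>T. - unit_vec (i, j, j') T)
     else if j' = i then unit_vec (i', j', j)
     else (\<lambda>T. 0))"

text \<open>The Jacobi sum of \<open>x_a\<close>, \<open>x_b\<close>, \<open>x_c\<close> as a vector
  of polynomials indexed by the triples; the outer bracket with a generator has become
  multiplication by its variable.\<close>

definition jac :: "nat \<times> nat \<Rightarrow> nat \<times> nat \<Rightarrow> nat \<times> nat \<Rightarrow> triple \<Rightarrow> (nat \<times> nat) cpoly"
  where "jac a b c T = poly_var a * edge_bracket b c T + poly_var b * edge_bracket c a T + poly_var c * edge_bracket a b T"

text \<open>The labels of the columns in the block at \<open>(i, j, k)\<close>: a variable that occurs in the diagonal
  entry of the column, and in no other diagonal entry of the block.\<close>

fun labels :: "nat \<Rightarrow> triple \<Rightarrow> (nat \<times> nat) list"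
  where "labels n (i, j, k) = map (Pair k) [1..<k] @ [(j, k)] @
    filter (\<lambda>(s, t). \<not> {s, t} \<subseteq> {i, j, k} \<and> (\<forall>l\<in>{1..<k}. \<not> {s, t} \<subseteq> {i, j, k, l})) (index_pairs n)"

fun diag_entry :: "triple \<Rightarrow> nat \<times> nat \<Rightarrow> (nat \<times> nat) cpoly"
  where "diag_entry (i, j, k) (s, t) =
    (if s = k then x_var i t + x_var j t + x_var k t
     else if (s, t) = (j, k) then x_var i k + x_var j k
     else x_var s t)"

text \<open>For a label of the block, this is what is left of the Jacobi combination that serves as
  the column after its term at \<open>(i, j, k)\<close> has been split off. Every triple that can
  occur here comes before \<open>(i, j, k)\<close> in the order, which is the source of
  triangularity.\<close>

fun off_diag :: "triple \<Rightarrow> nat \<times> nat \<Rightarrow> triple \<Rightarrow> (nat \<times> nat) cpoly"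
  where "off_diag (i, j, k) (s, t) T =
    (if s = i \<and> k < t \<and> t < j then x_var j k * unit_vec (i, j, t) T
     else if s = j \<and> k < t then x_var i k * unit_vec (i, j, t) T
     else if s = i \<and> j < t then - (x_var j k * unit_vec (i, t, j) T)
     else if t = i then x_var j k * unit_vec (s, i, j) T
     else 0)"

definition colvec :: "triple \<Rightarrow> nat \<times> nat \<Rightarrow> triple \<Rightarrow> (nat \<times> nat) cpoly"
  where "colvec T e T' = diag_entry T e * unit_vec T T' + off_diag T e T'"

lemma triples_iff [simp]: "(i, j, k) \<in> triples n \<longleftrightarrow> i \<le> n \<and> j < i \<and> k < j \<and> 1 \<le> k"
  by (auto simp: triples_def)

text \<open>An edge inside \<open>{i, j, k, l}\<close> with \<open>l < k\<close> has its larger end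
  in \<open>{i, j, k}\<close>, since \<open>l\<close> is the smallest of the four indices. The
  quantifier over \<open>l\<close> therefore only excludes edges from the triple to an index below
  \<open>k\<close>.\<close>

lemma labels_iff:
  assumes "(i, j, k) \<in> triples n"
  shows "(s, t) \<in> set (labels n (i, j, k)) \<longleftrightarrow> s = k \<and> 1 \<le> t \<and> t < k \<or> (s, t) = (j, k) \<or>
    (s, t) \<in> edges n \<and> (s \<in> {i, j, k} \<longrightarrow> t \<notin> {i, j, k} \<and> k < t)"
proof -
  have "\<not> {s, t} \<subseteq> {i, j, k} \<and> (\<forall>l\<in>{1..<k}. \<not> {s, t} \<subseteq> {i, j, k, l}) \<longleftrightarrow>
    (s \<in> {i, j, k} \<longrightarrow> t \<notin> {i, j, k} \<and> k < t)" if "1 \<le> t" "t < s"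
  proof
    assume L: "\<not> {s, t} \<subseteq> {i, j, k} \<and> (\<forall>l\<in>{1..<k}. \<not> {s, t} \<subseteq> {i, j, k, l})"
    show "s \<in> {i, j, k} \<longrightarrow> t \<notin> {i, j, k} \<and> k < t"
    proof
      assume s: "s \<in> {i, j, k}"
      with L have t: "t \<notin> {i, j, k}" by blast
      have "t \<notin> {1..<k}" using L s by blast
      with t that(1) show "t \<notin> {i, j, k} \<and> k < t" by auto
    qed
  next
    assume R: "s \<in> {i, j, k} \<longrightarrow> t \<notin> {i, j, k} \<and> k < t"
    have "\<not> {s, t} \<subseteq> {i, j, k, l}" if l: "l \<in> {1..<k}" for l
    proof (cases "s \<in> {i, j, k}")
      case True
      with R l show ?thesis by auto
    next
      case False
      then show ?thesis using l assms \<open>t < s\<close> by auto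
    qed
    with R show "\<not> {s, t} \<subseteq> {i, j, k} \<and> (\<forall>l\<in>{1..<k}. \<not> {s, t} \<subseteq> {i, j, k, l})" by blast
  qed
  moreover have "(s, t) \<in> set (labels n (i, j, k)) \<longleftrightarrow> s = k \<and> 1 \<le> t \<and> t < k \<or> (s, t) = (j, k) \<or>
    (s, t) \<in> edges n \<and> \<not> {s, t} \<subseteq> {i, j, k} \<and> (\<forall>l\<in>{1..<k}. \<not> {s, t} \<subseteq> {i, j, k, l})"
    by (auto simp del: edges_iff)
  ultimately show ?thesis unfolding edges_iff by meson
qed

text \<open>Four indices contain four triangles. Each of them has two pairs of edges of the form
  \<open>(i, j), (i, k)\<close> or \<open>(i, j), (j, k)\<close>, and three edges lead to the fourth
  index, which makes 24 identities. All triangles of the quadruple interact here; these identities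
  determine the entries in \<open>off_diag\<close>.\<close>

lemma jac_quadruple:
  assumes "s < r" "r < q" "q < p"
  shows
    "jac (p, q) (p, r) (p, s) = (\<lambda>T. colvec (p, r, s) (p, q) T - colvec (p, q, s) (p, r) T + colvec (p, q, r) (r, s) T)"
    "jac (p, q) (p, r) (q, s) = (\<lambda>T. colvec (p, q, s) (p, r) T)"
    "jac (p, q) (p, r) (r, s) = (\<lambda>T. - colvec (p, r, s) (p, q) T)"
    "jac (p, q) (q, r) (p, s) = (\<lambda>T. - colvec (p, q, s) (q, r) T)"
    "jac (p, q) (q, r) (q, s) = (\<lambda>T. colvec (q, r, s) (p, q) T + colvec (p, q, s) (q, r) T - colvec (p, q, r) (r, s) T)"
    "jac (p, q) (q, r) (r, s) = (\<lambda>T. - colvec (q, r, s) (p, q) T)"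
    "jac (p, q) (p, s) (p, r) = (\<lambda>T. - colvec (p, r, s) (p, q) T + colvec (p, q, s) (p, r) T - colvec (p, q, r) (r, s) T)"
    "jac (p, q) (p, s) (q, r) = (\<lambda>T. colvec (p, q, s) (q, r) T)"
    "jac (p, q) (p, s) (r, s) = (\<lambda>T. colvec (p, q, s) (r, s) T)"
    "jac (p, q) (q, s) (p, r) = (\<lambda>T. - colvec (p, q, s) (p, r) T)"
    "jac (p, q) (q, s) (q, r) = (\<lambda>T. - colvec (q, r, s) (p, q) T - colvec (p, q, s) (q, r) T + colvec (p, q, r) (r, s) T)"
    "jac (p, q) (q, s) (r, s) = (\<lambda>T. - colvec (p, q, s) (r, s) T)"
    "jac (p, r) (p, s) (p, q) = (\<lambda>T. colvec (p, r, s) (p, q) T - colvec (p, q, s) (p, r) T + colvec (p, q, r) (r, s) T)"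
    "jac (p, r) (p, s) (q, r) = (\<lambda>T. colvec (p, r, s) (q, r) T)"
    "jac (p, r) (p, s) (q, s) = (\<lambda>T. colvec (p, r, s) (q, s) T)"
    "jac (p, r) (r, s) (p, q) = (\<lambda>T. - colvec (p, r, s) (p, q) T)"
    "jac (p, r) (r, s) (q, r) = (\<lambda>T. colvec (q, r, s) (p, r) T - colvec (p, r, s) (q, r) T)"
    "jac (p, r) (r, s) (q, s) = (\<lambda>T. - colvec (p, r, s) (q, s) T)"
    "jac (q, r) (q, s) (p, q) = (\<lambda>T. colvec (q, r, s) (p, q) T + colvec (p, q, s) (q, r) T - colvec (p, q, r) (r, s) T)"
    "jac (q, r) (q, s) (p, r) = (\<lambda>T. colvec (q, r, s) (p, r) T)"
    "jac (q, r) (q, s) (p, s) = (\<lambda>T. colvec (q, r, s) (p, s) T)"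
    "jac (q, r) (r, s) (p, q) = (\<lambda>T. - colvec (q, r, s) (p, q) T)"
    "jac (q, r) (r, s) (p, r) = (\<lambda>T. - colvec (q, r, s) (p, r) T + colvec (p, r, s) (q, r) T)"
    "jac (q, r) (r, s) (p, s) = (\<lambda>T. - colvec (q, r, s) (p, s) T)"
  using assms by (intro ext; simp add: jac_def colvec_def algebra_simps)+

declare labels.simps [simp del]

lemma jac_triangle:
  assumes "k < j" "j < i"
  shows "jac (i, j) (i, k) (j, k) = colvec (i, j, k) (j, k)"
    "jac (i, j) (j, k) (i, k) = (\<lambda>T. - colvec (i, j, k) (j, k) T)"
  using assms by (intro ext; simp add: jac_def colvec_def algebra_simps)+

text \<open>The edge \<open>(s, t)\<close> has no index in common with the triangle, so its brackets
  with the other two edges vanish and only the term with the variable of \<open>(s, t)\<close>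
  survives.\<close>

lemma jac_disjoint:
  assumes "k < j" "j < i" "t < s" "s \<notin> {i, j, k}" "t \<notin> {i, j, k}"
  shows "jac (i, j) (i, k) (s, t) = colvec (i, j, k) (s, t)"
    "jac (i, j) (j, k) (s, t) = (\<lambda>T. - colvec (i, j, k) (s, t) T)"
  using assms by (intro ext; simp add: jac_def colvec_def algebra_simps)+

lemma edge_bracket_antisym:
  assumes "a \<in> edges n" "b \<in> edges n" shows "edge_bracket b a T = - edge_bracket a b T"
  by (cases a; cases b; insert assms; auto)

lemma jac_antisym:
  assumes "a \<in> edges n" "b \<in> edges n" "c \<in> edges n" shows "jac b a c T = - jac a b c T"
  unfolding jac_def edge_bracket_antisym[OF assms(1,2)] edge_bracket_antisym[OF assms(2,3)]
    edge_bracket_antisym[OF assms(3,1)] by (simp add: algebra_simps)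

lemma jac_cyclic: "jac b c a T = jac a b c T"
  by (simp add: jac_def algebra_simps)

lemma edge_bracket_nonzero:
  assumes "a \<in> edges n" "b \<in> edges n" "edge_bracket a b T \<noteq> 0"
  obtains i j k where "k < j" "j < i" "a = (i, j)" "b = (i, k) \<or> b = (j, k)"
  | i j k where "k < j" "j < i" "b = (i, j)" "a = (i, k) \<or> a = (j, k)"
proof -
  obtain p q r s where "a = (p, q)" "b = (r, s)" by (metis prod.exhaust)
  then show ?thesis using assms that by (auto split: if_splits)
qed

lemma position:
  fixes i j k l :: nat
  assumes "k < j" "j < i"
  shows "l < k \<or> l = k \<or> k < l \<and> l < j \<or> l = j \<or> j < l \<and> l < i \<or> l = i \<or> i < l"
  using assms by arith

text \<open>If all three brackets are zero, so is the vector. Otherwise cyclic symmetry and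
  antisymmetry bring a nonzero bracket to the front as \<open>(i, j), (i, k)\<close> or
  \<open>(i, j), (j, k)\<close>, and the position of the third edge relative to
  \<open>i > j > k\<close> decides which identity applies. Only integral combinations occur, so
  \<open>P\<close> need only be closed under differences.\<close>

lemma jac_in_column_span:
  fixes P :: "(triple \<Rightarrow> (nat \<times> nat) cpoly) \<Rightarrow> bool"
  assumes zero: "P (\<lambda>T. 0)" and diff: "\<And>u v. P u \<Longrightarrow> P v \<Longrightarrow> P (\<lambda>T. u T - v T)"
    and col: "\<And>T e. T \<in> triples n \<Longrightarrow> e \<in> set (labels n T) \<Longrightarrow> P (colvec T e)"
    and abc: "a \<in> edges n" "b \<in> edges n" "c \<in> edges n"
  shows "P (jac a b c)"
proof -
  have neg: "P (\<lambda>T. - u T)" if "P u" for u using diff[OF zero that] by simp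
  have add: "P (\<lambda>T. u T + v T)" if "P u" "P v" for u v using diff[OF that(1) neg[OF that(2)]] by simp
  have C: "P (\<lambda>T'. colvec (i, j, k) (s, t) T')" if "(i, j, k) \<in> triples n" "(s, t) \<in> set (labels n (i, j, k))" for i j k s t
    using col[OF that] by simp
  have wedge: "P (jac (i, j) b c)"
    if ijk: "k < j" "j < i" "(i, j) \<in> edges n" and b: "b = (i, k) \<or> b = (j, k)" "b \<in> edges n" and c: "c \<in> edges n" for i j k b c
  proof -
    have T: "(i, j, k) \<in> triples n" using ijk b by auto
    obtain s t where st: "c = (s, t)" "t < s" "1 \<le> t" "s \<le> n" using c by (metis edges_iff prod.exhaust)
    have self: "jac a b a = (\<lambda>T. 0)" "jac a b b = (\<lambda>T. 0)" if "a \<in> edges n" "b \<in> edges n" for a b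
    proof -
      have "edge_bracket e e T = 0" for e T by (cases e) simp
      then show "jac a b a = (\<lambda>T. 0)" "jac a b b = (\<lambda>T. 0)"
        using edge_bracket_antisym[OF that] by (intro ext; simp add: jac_def)+
    qed
    note Q = jac_quadruple
    consider "s \<in> {i, j, k}" "t \<in> {i, j, k}" | "s \<notin> {i, j, k}" "t \<notin> {i, j, k}"
      | "s \<in> {i, j, k}" "t < k" | "s \<in> {i, j}" "k < t" "t < j" | "s = t" | "s = i" "j < t" "t < i"
      | "t = k" "k < s" "s < j" | "t \<in> {j, k}" "j < s" "s < i" | "t \<in> {i, j, k}" "i < s"
      using position[OF ijk(1,2), of s] position[OF ijk(1,2), of t] st(2) ijk(1,2)
      by (elim disjE conjE) auto
    then show ?thesis
    proof cases
      case 1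
      then have "c = (i, j) \<or> c = (i, k) \<or> c = (j, k)" using st ijk by auto
      then show ?thesis
        using b ijk self[OF ijk(3) b(2)] zero col[OF T, of "(j, k)"] T
        by (auto simp: jac_triangle labels_iff intro: neg)
    next
      case 2
      then have "(s, t) \<in> set (labels n (i, j, k))" using T st by (auto simp: labels_iff)
      then show ?thesis using b ijk st 2 C[OF T, of s t] neg[OF C[OF T, of s t]] by (auto simp: jac_disjoint)
    next
      case 3
      then show ?thesis using b ijk st Q[of t k j i] T by (auto simp: labels_iff intro!: zero neg add diff C)
    next
      case 4
      then show ?thesis using b ijk st Q[of k t j i] T by (auto simp: labels_iff intro!: zero neg add diff C)
    next
      case 6
      then show ?thesis using b ijk st Q[of k j t i] T by (auto simp: labels_iff intro!: zero neg add diff C)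
    next
      case 7
      then show ?thesis using b ijk st Q[of k s j i] T by (auto simp: labels_iff intro!: zero neg add diff C)
    next
      case 8
      then show ?thesis using b ijk st Q[of k j s i] T by (auto simp: labels_iff intro!: zero neg add diff C)
    next
      case 9
      then show ?thesis using b ijk st Q[of k j i s] T by (auto simp: labels_iff intro!: zero neg add diff C)
    qed (use st in simp)
  qed
  have nonzero: "P (jac a b c)" if e: "a \<in> edges n" "b \<in> edges n" "c \<in> edges n" "edge_bracket a b T \<noteq> 0" for a b c T
    using e(1,2,4)
  proof (cases rule: edge_bracket_nonzero)
    case (1 i j k)
    then show ?thesis using wedge[of k j i b c] e by simp
  next
    case (2 i j k)
    then have "P (jac b a c)" using wedge[of k j i a c] e by simp
    moreover have "jac a b c = (\<lambda>T. - jac b a c T)" by (rule ext) (rule jac_antisym[OF e(2,1,3)])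
    ultimately show ?thesis using neg by simp
  qed
  have cyc: "jac b c a = jac a b c" for a b c by (rule ext) (rule jac_cyclic)
  show ?thesis
  proof (cases "\<exists>T. edge_bracket a b T \<noteq> 0 \<or> edge_bracket b c T \<noteq> 0 \<or> edge_bracket c a T \<noteq> 0")
    case True
    then show ?thesis using nonzero[OF abc] nonzero[OF abc(2,3,1)] nonzero[OF abc(3,1,2)] cyc by metis
  next
    case False
    then have "jac a b c = (\<lambda>T. 0)" by (auto simp: jac_def)
    then show ?thesis using zero by simp
  qed
qed

text \<open>The converse of \<open>jac_in_column_span\<close>, which is needed to see that the
  columns are relations in the invariant. Up to sign every column is a single Jacobi vector, except
  for those with a three-term diagonal entry.\<close>

lemma column_in_jac_span:
  fixes P :: "(triple \<Rightarrow> (nat \<times> nat) cpoly) \<Rightarrow> bool"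
  assumes diff: "\<And>u v. P u \<Longrightarrow> P v \<Longrightarrow> P (\<lambda>T. u T - v T)"
    and jac: "\<And>a b c. a \<in> edges n \<Longrightarrow> b \<in> edges n \<Longrightarrow> c \<in> edges n \<Longrightarrow> P (jac a b c)"
    and T: "(i, j, k) \<in> triples n" and e: "(s, t) \<in> set (labels n (i, j, k))"
  shows "P (colvec (i, j, k) (s, t))"
proof -
  have zero: "P (\<lambda>T. 0)"
    using diff[OF jac jac, of "(i, j)" "(i, j)" "(i, j)" "(i, j)" "(i, j)" "(i, j)"] T by auto
  have neg: "P (\<lambda>T. - u T)" if "P u" for u using diff[OF zero that] by simp
  have add: "P (\<lambda>T. u T + v T)" if "P u" "P v" for u v using diff[OF that(1) neg[OF that(2)]] by simp
  have by_jac: "P (colvec (i, j, k) (s, t))"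
    if "a \<in> edges n" "b \<in> edges n" "c \<in> edges n" "jac a b c = colvec (i, j, k) (s, t)" for a b c
    using jac[OF that(1-3)] that(4) by simp
  have by_neg_jac: "P (colvec (i, j, k) (s, t))"
    if "a \<in> edges n" "b \<in> edges n" "c \<in> edges n" "jac a b c = (\<lambda>T. - colvec (i, j, k) (s, t) T)" for a b c
    using neg[OF jac[OF that(1-3)]] that(4) by simp
  note ijk = T[unfolded triples_iff]
  have "s = k \<and> 1 \<le> t \<and> t < k \<or> (s, t) = (j, k) \<or>
    (s, t) \<in> edges n \<and> (s \<in> {i, j, k} \<longrightarrow> t \<notin> {i, j, k} \<and> k < t)"
    using e unfolding labels_iff[OF T] .
  then consider "s = k" "1 \<le> t" "t < k" | "s = j" "t = k"
    | "(s, t) \<in> edges n" "s \<notin> {i, j, k}" "t \<notin> {i, j, k}"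
    | "s = i" "k < t" "t < j" | "s = j" "k < t" "t < j" | "t = k" "k < s" "s < j"
    | "s = i" "j < t" "t < i" | "t \<in> {j, k}" "j < s" "s < i" | "t \<in> {i, j, k}" "i < s" "s \<le> n"
    using position[of k j i s] position[of k j i t] ijk by (elim disjE conjE) auto
  then show ?thesis
  proof cases
    case 1
    note Q = jac_quadruple[of t k j i]
    \<comment> \<open>With \<open>t < k\<close>, the first of the three vectors is
      \<open>colvec (i, j, k) (k, t)\<close> plus two columns from other blocks, and the other two
      vectors are the negatives of exactly these columns. The variables \<open>x_it\<close>,
      \<open>x_kt\<close>, \<open>x_jt\<close> add up to the diagonal entry.\<close>
    have "P (\<lambda>T. (jac (i, j) (i, k) (i, t) T + jac (i, j) (i, k) (k, t) T) + jac (i, j) (i, k) (j, t) T)"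
      using 1 ijk by (intro add jac) auto
    then show ?thesis using 1 ijk by (simp add: Q)
  next
    case 2
    then show ?thesis using ijk by (intro by_jac[of "(i, j)" "(i, k)" "(j, k)"]) (auto simp: jac_triangle)
  next
    case 3
    then show ?thesis using ijk by (intro by_jac[of "(i, j)" "(i, k)" "(s, t)"] jac_disjoint) auto
  next
    case 4
    then show ?thesis using ijk by (intro by_neg_jac[of "(i, j)" "(j, k)" "(i, t)"]) (auto simp: jac_quadruple[of k t j i])
  next
    case 5
    then show ?thesis using ijk by (intro by_jac[of "(i, j)" "(i, k)" "(j, t)"]) (auto simp: jac_quadruple[of k t j i])
  next
    case 6
    then show ?thesis using ijk by (intro by_jac[of "(i, j)" "(i, k)" "(s, k)"]) (auto simp: jac_quadruple[of k s j i])
  next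
    case 7
    then show ?thesis using ijk by (intro by_neg_jac[of "(i, j)" "(j, k)" "(i, t)"]) (auto simp: jac_quadruple[of k j t i])
  next
    case 8
    then show ?thesis using ijk by (intro by_jac[of "(i, j)" "(i, k)" "(s, t)"]) (auto simp: jac_quadruple[of k j s i])
  next
    case 9
    show ?thesis
    proof (cases "t = i")
      case True
      then show ?thesis using 9 ijk by (intro by_neg_jac[of "(i, j)" "(j, k)" "(s, i)"]) (auto simp: jac_quadruple[of k j i s])
    next
      case False
      then show ?thesis using 9 ijk by (intro by_jac[of "(i, j)" "(i, k)" "(s, t)"]) (auto simp: jac_quadruple[of k j i s])
    qed
  qed
qed

section \<open>The shape of the matrix\<close>

lemma finite_triples [simp]: "finite (triples n)"
  by (rule finite_subset[of _ "{..n} \<times> {..n} \<times> {..n}"]) auto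

lemma finite_columns [simp]: "finite (columns n)"
  by (auto simp: columns_def)

lemma triples_0 [simp]: "triples 0 = {}"
  by (auto simp: triples_def)

lemma triples_Suc: "triples (Suc n) = triples n \<union> Pair (Suc n) ` edges n"
  by (auto simp: image_iff le_Suc_eq)

lemma edges_Suc: "edges (Suc n) = edges n \<union> Pair (Suc n) ` {1..n}"
  by (auto simp: image_iff le_Suc_eq)

lemma sum_edges_Suc:
  "sum f (edges (Suc n)) = sum f (edges n) + (\<Sum>k\<in>{1..n}. f (Suc n, k))"
proof -
  have "sum f (edges (Suc n)) = sum f (edges n) + sum f (Pair (Suc n) ` {1..n})"
    unfolding edges_Suc by (rule sum.union_disjoint) auto
  also have "sum f (Pair (Suc n) ` {1..n}) = (\<Sum>k\<in>{1..n}. f (Suc n, k))"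
    by (subst sum.reindex) (auto simp: inj_on_def)
  finally show ?thesis .
qed

lemma sum_triples_Suc:
  "sum f (triples (Suc n)) = sum f (triples n) + (\<Sum>e\<in>edges n. f (Suc n, e))"
proof -
  have "sum f (triples (Suc n)) = sum f (triples n) + sum f (Pair (Suc n) ` edges n)"
    unfolding triples_Suc by (rule sum.union_disjoint) auto
  also have "sum f (Pair (Suc n) ` edges n) = (\<Sum>e\<in>edges n. f (Suc n, e))"
    by (subst sum.reindex) (auto simp: inj_on_def)
  finally show ?thesis .
qed

lemma card_edges: "card (edges n) = n choose 2"
proof (induction n)
  case (Suc n)
  have "card (edges (Suc n)) = card (edges n) + n"
    using sum_edges_Suc[of "\<lambda>_. 1::nat" n] by simp
  with Suc show ?case by (simp add: numeral_2_eq_2)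
qed (simp add: index_pairs_def)

lemma card_triples: "card (triples n) = n choose 3"
proof (induction n)
  case (Suc n)
  have "card (triples (Suc n)) = card (triples n) + card (edges n)"
    using sum_triples_Suc[of "\<lambda>_. 1::nat" n] by simp
  with Suc show ?case by (simp add: card_edges numeral_3_eq_3 numeral_2_eq_2)
qed simp

lemma sum_edges_snd: "(\<Sum>e\<in>edges n. real (snd e)) = real n * (real n + 1) * (real n - 1) / 6"
proof (induction n)
  case (Suc n)
  have "(\<Sum>k\<in>{1..n}. real k) = real n * (real n + 1) / 2"
    by (induction n) (auto simp: field_simps)
  with Suc show ?case by (simp add: sum_edges_Suc field_simps)
qed (simp add: index_pairs_def)

text \<open>The right-hand side is the binomial coefficient \<open>n + 1\<close> over 4. With it the
  number of columns becomes \<open>(n choose 3) (n choose 2) - 2 (n + 1 choose 4)\<close>.\<close>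

lemma sum_triples_last:
  "(\<Sum>T\<in>triples n. real (snd (snd T))) = real n * (real n + 1) * (real n - 1) * (real n - 2) / 24"
proof (induction n)
  case (Suc n)
  then show ?case by (simp add: sum_triples_Suc sum_edges_snd field_simps)
qed simp

lemma real_choose_2: "real (n choose 2) = real n * (real n - 1) / 2"
proof (induction n)
  case (Suc n)
  then show ?case by (simp add: numeral_2_eq_2 field_simps)
qed simp

lemma real_choose_3: "real (n choose 3) = real n * (real n - 1) * (real n - 2) / 6"
proof (induction n)
  case (Suc n)
  have "Suc n choose 3 = (n choose 2) + (n choose 3)" by (simp add: numeral_3_eq_3 numeral_2_eq_2)
  with Suc show ?case by (simp add: real_choose_2 field_simps)
qed simp

lemma block_width_real:
  assumes "T \<in> triples n"
  shows "real (block_width n T) = real (n choose 2) - 2 * real (snd (snd T))"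
proof -
  obtain i j k where T: "T = (i, j, k)" by (cases T)
  have k: "k + 2 \<le> n" using assms T by auto
  \<comment> \<open>Completing the square in \<open>n^2 - 5 n + 8\<close>, whose positivity gives
    \<open>2 (n - 2) \<le> n choose 2\<close>. Since \<open>k \<le> n - 2\<close>, the
    natural-number subtraction in \<open>block_width\<close> is not truncated.\<close>
  have "0 \<le> (real n - 5 / 2)\<^sup>2 + 7 / 4" by simp
  then have "2 * (real n - 2) \<le> real n * (real n - 1) / 2" by (simp add: power2_eq_square field_simps)
  moreover have "real k + 2 \<le> real n" using k by (metis of_nat_add of_nat_le_iff of_nat_numeral)
  then have "2 * real k \<le> 2 * (real n - 2)" by simp
  ultimately have "2 * real k \<le> real (n choose 2)" unfolding real_choose_2 by (rule order_trans[rotated])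
  then have "real (2 * k) \<le> real (n choose 2)" by simp
  then have "2 * k \<le> n choose 2" by (simp only: of_nat_le_iff)
  then show ?thesis using T by (simp add: of_nat_diff)
qed

lemma card_columns:
  "real (card (columns n)) = 1 / 12 * real n * (real n ^ 4 - 5 * real n ^ 3 + 7 * real n ^ 2 - real n - 2)"
proof -
  have "card (columns n) = (\<Sum>T\<in>triples n. block_width n T)"
    unfolding columns_def by (subst card_SigmaI) auto
  then have "real (card (columns n)) = (\<Sum>T\<in>triples n. real (block_width n T))" by simp
  also have "\<dots> = (\<Sum>T\<in>triples n. real (n choose 2) - 2 * real (snd (snd T)))"
    by (intro sum.cong refl block_width_real)
  also have "\<dots> = real (n choose 3) * real (n choose 2) - 2 * (\<Sum>T\<in>triples n. real (snd (snd T)))"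
    by (simp add: sum_subtractf sum_distrib_left card_triples)
  finally show ?thesis
    unfolding sum_triples_last real_choose_2 real_choose_3
    by (simp add: field_simps power2_eq_square power3_eq_cube power4_eq_xxxx)
qed

section \<open>Labels of a block: their number, the diagonal entries and triangularity\<close>

lemma distinct_labels:
  assumes "T \<in> triples n" shows "distinct (labels n T)"
proof -
  obtain i j k where T: "T = (i, j, k)" by (cases T)
  then show ?thesis using assms
    by (auto simp: labels.simps distinct_map inj_on_def distinct_index_pairs simp del: edges_iff)
qed

lemma length_labels:
  assumes "T \<in> triples n" shows "length (labels n T) = block_width n T"
proof -
  obtain i j k where T: "T = (i, j, k)" by (cases T)
  note ijk = assms[unfolded T triples_iff]
  \<comment> \<open>\<open>?A\<close> consists of the \<open>k + k + (k - 1) + 1 = 3 k\<close> edges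
    that the filter in \<open>labels\<close> rejects. \<open>?B\<close> consists of the
    \<open>k\<close> labels attached to sums of variables, all of them rejected edges, so that
    \<open>2 k\<close> edges of the full set are missing in the end.\<close>
  let ?A = "Pair i ` {1..k} \<union> Pair j ` {1..k} \<union> Pair k ` {1..<k} \<union> {(i, j)}"
  let ?B = "Pair k ` {1..<k} \<union> {(j, k)}"
  have d: "card ?A = 3 * k"
    using ijk by (subst card_Un_disjoint; (subst card_Un_disjoint)?; (subst card_Un_disjoint)?)
      (auto simp: card_image inj_on_def)
  have A: "?A \<subseteq> edges n" using ijk by auto
  have "set (labels n T) = ?B \<union> (edges n - ?A)"
  proof (rule Set.set_eqI)
    fix e :: "nat \<times> nat"
    obtain s t where e: "e = (s, t)" by (cases e)
    have B: "(s, t) \<in> ?B \<longleftrightarrow> s = k \<and> 1 \<le> t \<and> t < k \<or> (s, t) = (j, k)" by auto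
    have A: "(s \<in> {i, j, k} \<longrightarrow> t \<notin> {i, j, k} \<and> k < t) \<longleftrightarrow> (s, t) \<notin> ?A" if "(s, t) \<in> edges n"
      by (cases "s = i"; cases "s = j"; cases "s = k") (use that ijk in \<open>auto simp: image_iff\<close>)
    show "e \<in> set (labels n T) \<longleftrightarrow> e \<in> ?B \<union> (edges n - ?A)"
      unfolding e T labels_iff[OF assms[unfolded T]] Un_iff[of _ ?B] Diff_iff B using A by blast
  qed
  moreover have "card (?B \<union> (edges n - ?A)) = card ?B + card (edges n - ?A)"
    using ijk by (intro card_Un_disjoint) (auto simp: image_iff)
  moreover have "card ?B = k"
    using ijk by (subst card_Un_disjoint) (auto simp: card_image inj_on_def)
  moreover have "card (edges n - ?A) = (n choose 2) - 3 * k" "3 * k \<le> n choose 2"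
    using card_Diff_subset[OF finite_subset[OF A finite_set] A] card_mono[OF finite_set A]
    by (simp_all only: card_edges d)
  ultimately show ?thesis
    using distinct_card[OF distinct_labels[OF assms]] by (simp add: T)
qed

lemma concat_map_filter: "concat (map (\<lambda>x. if P x then [f x] else []) xs) = map f (filter P xs)"
  by (induction xs) auto

lemma v_row_eq:
  assumes "T \<in> triples n" shows "v_row n T = map (diag_entry T) (labels n T)"
proof -
  obtain i j k where T: "T = (i, j, k)" by (cases T)
  note ijk = assms[unfolded T triples_iff]
  let ?P = "\<lambda>(s, t). \<not> {s, t} \<subseteq> {i, j, k} \<and> (\<forall>l\<in>{1..<k}. \<not> {s, t} \<subseteq> {i, j, k, l})"
  have "concat (map (\<lambda>(s, t). if \<not> {s, t} \<subseteq> {i, j, k} \<and> (\<forall>l\<in>{1..<k}. \<not> {s, t} \<subseteq> {i, j, k, l}) then [x_var s t] else []) (index_pairs n))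
    = map (\<lambda>e. poly_var e) (filter ?P (index_pairs n))"
    unfolding concat_map_filter[symmetric] by (intro arg_cong[of _ _ concat] map_cong refl) (auto split: prod.split)
  also have "\<dots> = map (diag_entry T) (filter ?P (index_pairs n))"
  proof (rule map_cong[OF refl])
    fix e assume *: "e \<in> set (filter ?P (index_pairs n))"
    obtain s t where st: "e = (s, t)" by (meson prod.exhaust)
    with * have e: "e = (s, t)" "(s, t) \<in> edges n" "?P (s, t)" by (simp_all only: set_filter mem_Collect_eq)
    have "s \<noteq> k \<or> t \<notin> {1..<k}" using e(3) by auto
    then have "s \<noteq> k" "(s, t) \<noteq> (j, k)" using e(2,3) by auto
    then show "poly_var e = diag_entry T e" by (auto simp: e(1) T)
  qed
  finally show ?thesis using ijk by (simp add: T labels.simps)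
qed

lemma off_diag_precedes:
  assumes "T \<in> triples n" "e \<in> set (labels n T)" "off_diag T e T' \<noteq> 0"
  shows "precedes T' T"
proof -
  obtain i j k where T: "T = (i, j, k)" by (cases T)
  obtain s t where e: "e = (s, t)" by (cases e)
  show ?thesis
    using assms(2,3) unfolding T e labels_iff[OF assms(1)[unfolded T]]
    using assms(1)[unfolded T triples_iff] by (auto simp: unit_vec_def split: if_splits)
qed

lemma not_precedes_self: "\<not> precedes T T"
  by (cases T) auto

lemma precedes_asym: "precedes T T' \<Longrightarrow> \<not> precedes T' T"
  by (cases T; cases T') auto

lemma precedes_total: "T \<noteq> T' \<Longrightarrow> precedes T T' \<or> precedes T' T"
  by (cases T; cases T') auto

lemma colvec_diag: "T \<in> triples n \<Longrightarrow> e \<in> set (labels n T) \<Longrightarrow> colvec T e T = diag_entry T e"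
  using off_diag_precedes[of T n e T] not_precedes_self[of T] by (auto simp: colvec_def unit_vec_def)

lemma colvec_lower_zero:
  "T \<in> triples n \<Longrightarrow> e \<in> set (labels n T) \<Longrightarrow> precedes T T' \<Longrightarrow> colvec T e T' = 0"
  using off_diag_precedes[of T n e T'] precedes_asym[of T T'] not_precedes_self[of T]
  by (auto simp: colvec_def unit_vec_def)

definition Psi :: "nat \<Rightarrow> triple \<Rightarrow> triple \<times> nat \<Rightarrow> (nat \<times> nat) cpoly"
  where "Psi n T' = (\<lambda>(T, q). colvec T (labels n T ! q) T')"

lemma columns_label: "(T, q) \<in> columns n \<Longrightarrow> T \<in> triples n \<and> q < length (labels n T)"
  by (auto simp: columns_def length_labels simp del: block_width.simps)

lemma Psi_block_upper_triangular: "block_upper_triangular n (Psi n)"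
  unfolding block_upper_triangular_def
  using columns_label by (force simp: Psi_def intro: colvec_lower_zero nth_mem)

lemma Psi_diagonal_block:
  assumes T: "T \<in> triples n" shows "diagonal_block n (Psi n) T = v_row n T"
proof -
  have "diagonal_block n (Psi n) T = map (\<lambda>q. diag_entry T (labels n T ! q)) [0..<length (labels n T)]"
    unfolding diagonal_block_def length_labels[OF T, symmetric]
    by (intro map_cong refl) (simp add: Psi_def colvec_diag[OF T])
  also have "\<dots> = map (diag_entry T) (map ((!) (labels n T)) [0..<length (labels n T)])" by simp
  finally show ?thesis by (simp only: map_nth v_row_eq[OF T])
qed

section \<open>Independence of the columns\<close>

abbreviation var_coeff :: "'v cpoly \<Rightarrow> 'v \<Rightarrow> complex"
  where "var_coeff p v \<equiv> coef p (Poly_Mapping.single v 1)"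

lemma exponent_add_eq_0: "(a :: 'v \<Rightarrow>\<^sub>0 nat) + b = 0 \<longleftrightarrow> a = 0 \<and> b = 0"
  by (auto simp: poly_mapping_eq_iff lookup_add fun_eq_iff)

lemma exponent_add_eq_single:
  "(a :: 'v \<Rightarrow>\<^sub>0 nat) + b = Poly_Mapping.single v 1 \<longleftrightarrow>
    a = 0 \<and> b = Poly_Mapping.single v 1 \<or> a = Poly_Mapping.single v 1 \<and> b = 0"
proof
  assume eq: "a + b = Poly_Mapping.single v 1"
  have "coef a w + coef b w = (if w = v then 1 else 0)" for w
    using arg_cong[OF eq, of "\<lambda>c. coef c w"] by (auto simp: lookup_add lookup_single when_def)
  then have w: "coef a w = 0" "coef b w = 0" if "w \<noteq> v" for w using that by (metis add_is_0)+
  have "coef a v + coef b v = 1" using arg_cong[OF eq, of "\<lambda>c. coef c v"] by (simp add: lookup_add)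
  then have "coef a v = 0 \<and> coef b v = 1 \<or> coef a v = 1 \<and> coef b v = 0" by linarith
  moreover have "c = 0" if "coef c v = 0" "\<And>w. w \<noteq> v \<Longrightarrow> coef c w = 0" for c :: "'v \<Rightarrow>\<^sub>0 nat"
    using that by (intro poly_mapping_eqI) (metis lookup_zero)
  moreover have "c = Poly_Mapping.single v 1" if "coef c v = 1" "\<And>w. w \<noteq> v \<Longrightarrow> coef c w = 0" for c :: "'v \<Rightarrow>\<^sub>0 nat"
    using that by (intro poly_mapping_eqI) (metis lookup_single_eq lookup_single_not_eq)
  ultimately show "a = 0 \<and> b = Poly_Mapping.single v 1 \<or> a = Poly_Mapping.single v 1 \<and> b = 0"
    using w by blast
qed auto

lemma exponent_single_nonzero: "Poly_Mapping.single v (1::nat) \<noteq> 0" "0 \<noteq> Poly_Mapping.single v (1::nat)"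
  by (metis lookup_single_eq lookup_zero zero_neq_one)+

text \<open>The product modulo the square of the augmentation ideal. Minimality is decided entirely
  by these constant and linear coefficients.\<close>

lemma coef_mult:
  fixes p q :: "'v cpoly"
  shows "coef (p * q) 0 = coef p 0 * coef q 0"
    and "var_coeff (p * q) v = coef p 0 * var_coeff q v + var_coeff p v * coef q 0"
proof -
  let ?H = "\<lambda>p q. coef (p * q) 0 = coef p 0 * coef q 0 \<and>
    var_coeff (p * q) v = coef p 0 * var_coeff q v + var_coeff p v * coef q 0"
  have scale: "pm_scale c p * q = pm_scale c (p * q)" "q * pm_scale c p = pm_scale c (q * p)" for c and p q :: "'v cpoly"
    by (simp_all add: mult_map_scale_conv_mult mult.assoc mult.left_commute)
  have "q \<in> {q. ?H (Poly_Mapping.single t 1) q}" for t q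
    by (rule pm_span_induct[of q UNIV])
      (auto simp: distrib_left distrib_right lookup_add scale algebra_simps mult_single lookup_single
        when_def exponent_add_eq_0 exponent_add_eq_single exponent_single_nonzero simp del: One_nat_def)
  then have "p \<in> {p. ?H p q}"
    by (intro pm_span_induct[of p UNIV]) (auto simp: distrib_left distrib_right lookup_add scale algebra_simps)
  then show "coef (p * q) 0 = coef p 0 * coef q 0"
    "var_coeff (p * q) v = coef p 0 * var_coeff q v + var_coeff p v * coef q 0" by auto
qed

lemma coef_poly_var [simp]: "coef (poly_var v) 0 = 0" "var_coeff (poly_var v) w = (if v = w then 1 else 0)"
proof -
  have "Poly_Mapping.single v (1::nat) = Poly_Mapping.single w 1 \<longleftrightarrow> v = w"
    by (metis lookup_single_eq lookup_single_not_eq zero_neq_one)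
  then show "coef (poly_var v) 0 = 0" "var_coeff (poly_var v) w = (if v = w then 1 else 0)"
    using exponent_single_nonzero[of v]
    by (simp_all add: poly_var_def lookup_single when_def del: One_nat_def)
qed

lemma colvec_no_constant: "coef (colvec T e T') 0 = 0"
  by (cases T; cases e) (auto simp: colvec_def lookup_add coef_mult)

text \<open>Apart from its own label, a diagonal entry contains at most the variable
  \<open>x_ik\<close>, or the variables \<open>x_il\<close> and \<open>x_jl\<close> with
  \<open>l < k\<close>, and none of these is a label of the block. The labels thus form a dual
  system to the diagonal entries.\<close>

lemma var_coeff_diag_entry:
  assumes "T \<in> triples n" "e \<in> set (labels n T)" "e' \<in> set (labels n T)"
  shows "var_coeff (diag_entry T e) e' = (if e = e' then 1 else 0)"
proof -
  obtain i j k where T: "T = (i, j, k)" by (cases T)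
  obtain s t s' t' where e: "e = (s, t)" "e' = (s', t')" by (meson prod.exhaust)
  note ijk = assms(1)[unfolded T triples_iff]
  have "var_coeff (diag_entry (i, j, k) (s, t)) e' =
    (if s = k then (if (i, t) = e' then 1 else 0) + (if (j, t) = e' then 1 else 0) + (if (k, t) = e' then 1 else 0)
     else if (s, t) = (j, k) then (if (i, k) = e' then 1 else 0) + (if (j, k) = e' then 1 else 0)
     else if (s, t) = e' then 1 else 0)"
    by (simp add: lookup_add del: One_nat_def)
  moreover have "t < k" if "s = k"
    using assms(2) ijk that unfolding T e labels_iff[OF assms(1)[unfolded T]] by auto
  moreover have "(s', t') \<noteq> (i, k)"
    using assms(3) ijk unfolding T e labels_iff[OF assms(1)[unfolded T]] by auto
  moreover have "s' \<noteq> i \<and> s' \<noteq> j" if "t' < k"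
    using assms(3) ijk that unfolding T e labels_iff[OF assms(1)[unfolded T]] by auto
  ultimately show ?thesis unfolding T e using ijk by (auto simp del: One_nat_def diag_entry.simps)
qed

lemma wf_precedes: "wf {(T', T). precedes T T'}"
proof -
  have "{(T', T). precedes T T'} = less_than <*lex*> less_than <*lex*> less_than"
    by (auto simp: in_lex_prod)
  then show ?thesis by (simp add: wf_lex_prod)
qed

text \<open>Back substitution, starting from the last block: in row \<open>T\<close> the blocks
  before \<open>T\<close> vanish by triangularity, those after \<open>T\<close> have zero
  coefficients by induction, and inside the block the linear coefficient at a label isolates one
  column. The well-founded order is oriented accordingly, later triples being smaller.\<close>

lemma columns_independent:
  assumes "\<And>T v. T \<in> triples n \<Longrightarrow> (\<Sum>x\<in>columns n. var_coeff (Psi n T x) v * c x) = 0"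
    and "x \<in> columns n"
  shows "c x = 0"
proof -
  have "\<forall>q. (T, q) \<in> columns n \<longrightarrow> c (T, q) = 0" for T
  proof (induction T rule: wf_induct[OF wf_precedes])
    case (1 T)
    then have IH: "c (T', q) = 0" if "precedes T T'" "(T', q) \<in> columns n" for T' q
      using that by blast
    show ?case
    proof (intro allI impI)
      fix q assume q: "(T, q) \<in> columns n"
      then have T: "T \<in> triples n" and ql: "q < length (labels n T)" using columns_label by auto
      let ?e = "labels n T ! q"
      have "var_coeff (Psi n T x) ?e * c x = (if x = (T, q) then c x else 0)" if "x \<in> columns n" for x
      proof -
        obtain T' q' where x: "x = (T', q')" by (cases x)
        have x': "T' \<in> triples n" "q' < length (labels n T')" using that columns_label x by auto
        consider "T' = T" | "precedes T T'" | "precedes T' T" using precedes_total by blast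
        then show ?thesis
        proof cases
          case 1
          have "labels n T ! q' = ?e \<longleftrightarrow> q' = q"
            using distinct_labels[OF T] ql x' 1 by (auto simp: nth_eq_iff_index_eq)
          then show ?thesis using 1 x x' T ql
            by (auto simp: Psi_def colvec_diag[OF T] var_coeff_diag_entry[OF T] simp del: One_nat_def)
        next
          case 2
          then have "c x = 0" using IH that x by blast
          then show ?thesis by auto
        next
          case 3
          then have "Psi n T x = 0" using x x' by (auto simp: Psi_def intro!: colvec_lower_zero)
          then show ?thesis using 3 not_precedes_self[of T] x by auto
        qed
      qed
      then have "(\<Sum>x\<in>columns n. var_coeff (Psi n T x) ?e * c x) = (\<Sum>x\<in>columns n. if x = (T, q) then c x else 0)"
        by (intro sum.cong refl)
      with assms(1)[OF T] q show "c (T, q) = 0" by simp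
    qed
  qed
  with assms(2) show ?thesis by (cases x) auto
qed

section \<open>The metabelian model\<close>

text \<open>Membership in the image of the matrix, tested on \<open>triples n\<close> only. Vectors
  remain ordinary total functions, and calculating modulo the image replaces the quotient
  module.\<close>

definition in_im :: "nat \<Rightarrow> (triple \<Rightarrow> (nat \<times> nat) cpoly) \<Rightarrow> bool"
  where "in_im n m \<longleftrightarrow> (\<exists>c. (\<forall>x\<in>columns n. c x \<in> polys (edges n)) \<and>
    (\<forall>T\<in>triples n. m T = (\<Sum>x\<in>columns n. Psi n T x * c x)))"

lemma in_im_zero: "(\<And>T. T \<in> triples n \<Longrightarrow> m T = 0) \<Longrightarrow> in_im n m"
  unfolding in_im_def by (rule exI[of _ "\<lambda>_. 0"]) auto

lemma in_im_cong: "in_im n m \<Longrightarrow> (\<And>T. T \<in> triples n \<Longrightarrow> m T = m' T) \<Longrightarrow> in_im n m'"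
  unfolding in_im_def by simp

lemma in_im_add:
  assumes "in_im n m" "in_im n m'" shows "in_im n (\<lambda>T. m T + m' T)"
proof -
  obtain c c' where "\<forall>x\<in>columns n. c x \<in> polys (edges n)" "\<forall>T\<in>triples n. m T = (\<Sum>x\<in>columns n. Psi n T x * c x)"
    "\<forall>x\<in>columns n. c' x \<in> polys (edges n)" "\<forall>T\<in>triples n. m' T = (\<Sum>x\<in>columns n. Psi n T x * c' x)"
    using assms by (auto simp: in_im_def)
  then show ?thesis unfolding in_im_def
    by (intro exI[of _ "\<lambda>x. c x + c' x"]) (auto simp: distrib_left sum.distrib)
qed

lemma in_im_scale:
  assumes "in_im n m" "p \<in> polys (edges n)" shows "in_im n (\<lambda>T. p * m T)"
proof -
  obtain c where "\<forall>x\<in>columns n. c x \<in> polys (edges n)" "\<forall>T\<in>triples n. m T = (\<Sum>x\<in>columns n. Psi n T x * c x)"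
    using assms by (auto simp: in_im_def)
  then show ?thesis unfolding in_im_def using assms(2)
    by (intro exI[of _ "\<lambda>x. p * c x"]) (auto simp: sum_distrib_left mult.left_commute)
qed

lemma in_im_uminus: "in_im n m \<Longrightarrow> in_im n (\<lambda>T. - m T)"
  using in_im_scale[of n m "- 1"] by (simp add: polys_uminus)

lemma in_im_diff: "in_im n m \<Longrightarrow> in_im n m' \<Longrightarrow> in_im n (\<lambda>T. m T - m' T)"
  using in_im_add[OF _ in_im_uminus, of n m m'] by simp

lemma in_im_sum: "(\<And>a. a \<in> A \<Longrightarrow> in_im n (f a)) \<Longrightarrow> in_im n (\<lambda>T. \<Sum>a\<in>A. f a T)"
  by (induction A rule: infinite_finite_induct) (auto intro: in_im_zero in_im_add)

lemma in_im_colvec: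
  assumes "T \<in> triples n" "e \<in> set (labels n T)" shows "in_im n (colvec T e)"
proof -
  obtain q where q: "q < length (labels n T)" "labels n T ! q = e" using assms(2) by (auto simp: in_set_conv_nth)
  have x: "(T, q) \<in> columns n" using assms(1) q(1) by (simp add: columns_def length_labels)
  have "(\<Sum>x\<in>columns n. Psi n T' x * (if x = (T, q) then 1 else 0)) = (\<Sum>x\<in>columns n. if x = (T, q) then Psi n T' x else 0)" for T'
    by (intro sum.cong) auto
  then have "(\<Sum>x\<in>columns n. Psi n T' x * (if x = (T, q) then 1 else 0)) = Psi n T' (T, q)" for T'
    using x by simp
  then show ?thesis unfolding in_im_def
    by (intro exI[of _ "\<lambda>x. if x = (T, q) then 1 else 0"]) (simp add: Psi_def q(2))
qed

lemma in_im_jac: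
  "a \<in> edges n \<Longrightarrow> b \<in> edges n \<Longrightarrow> c \<in> edges n \<Longrightarrow> in_im n (jac a b c)"
  by (rule jac_in_column_span) (auto intro: in_im_zero in_im_diff in_im_colvec simp del: edges_iff)

section \<open>Jacobi relations for arbitrary linear combinations of edges\<close>

definition lin :: "nat \<Rightarrow> (nat \<times> nat \<Rightarrow> (nat \<times> nat) cpoly) \<Rightarrow> (nat \<times> nat) cpoly"
  where "lin n p = (\<Sum>e\<in>edges n. p e * poly_var e)"

text \<open>The value of the 2-form \<open>u_ij \<and> (u_ik - u_jk)\<close> on
  \<open>p \<and> q\<close>, where \<open>p\<close> and \<open>q\<close> are coordinate vectors in
  the basis of edges. The same forms describe the known relations of the cohomology ring.
  Coordinates are polynomials so that bilinearity holds over the whole ring.\<close>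

fun beta :: "(nat \<times> nat \<Rightarrow> (nat \<times> nat) cpoly) \<Rightarrow> (nat \<times> nat \<Rightarrow> (nat \<times> nat) cpoly) \<Rightarrow> triple \<Rightarrow> (nat \<times> nat) cpoly"
  where "beta p q (i, j, k) = p (i, j) * q (i, k) - q (i, j) * p (i, k) - (p (i, j) * q (j, k) - q (i, j) * p (j, k))"

definition jac_lin :: "nat \<Rightarrow> (nat \<times> nat \<Rightarrow> (nat \<times> nat) cpoly) \<Rightarrow> (nat \<times> nat \<Rightarrow> (nat \<times> nat) cpoly) \<Rightarrow>
    (nat \<times> nat \<Rightarrow> (nat \<times> nat) cpoly) \<Rightarrow> triple \<Rightarrow> (nat \<times> nat) cpoly"
  where "jac_lin n p q r T = lin n p * beta q r T + lin n q * beta r p T + lin n r * beta p q T"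

definition delta :: "nat \<times> nat \<Rightarrow> nat \<times> nat \<Rightarrow> (nat \<times> nat) cpoly"
  where "delta a e = (if e = a then 1 else 0)"

lemma lin_delta: "a \<in> edges n \<Longrightarrow> lin n (delta a) = poly_var a"
proof -
  assume a: "a \<in> edges n"
  have "lin n (delta a) = (\<Sum>e\<in>edges n. if e = a then poly_var e else 0)"
    unfolding lin_def by (intro sum.cong) (auto simp: delta_def)
  with a show ?thesis by simp
qed

lemma beta_delta:
  assumes "T \<in> triples n" "a \<in> edges n" "b \<in> edges n" shows "beta (delta a) (delta b) T = edge_bracket a b T"
proof -
  obtain i j k where T: "T = (i, j, k)" by (cases T)
  obtain p q r s where ab: "a = (p, q)" "b = (r, s)" by (meson prod.exhaust)
  show ?thesis using assms unfolding T ab by (auto simp: delta_def unit_vec_def)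
qed

lemma sum_delta:
  assumes "e \<in> edges n" shows "(\<Sum>a\<in>edges n. p a * delta a e) = p e"
proof -
  have "(\<Sum>a\<in>edges n. p a * delta a e) = (\<Sum>a\<in>edges n. if a = e then p a else 0)"
    by (intro sum.cong) (auto simp: delta_def)
  with assms show ?thesis by simp
qed

lemma beta_expand:
  assumes "T \<in> triples n"
  shows "beta p q T = (\<Sum>a\<in>edges n. p a * beta (delta a) q T)" "beta q p T = (\<Sum>a\<in>edges n. p a * beta q (delta a) T)"
proof -
  obtain i j k where T: "T = (i, j, k)" by (cases T)
  have e: "(i, j) \<in> edges n" "(i, k) \<in> edges n" "(j, k) \<in> edges n" using assms unfolding T by auto
  have s: "p e * x = (\<Sum>a\<in>edges n. p a * (delta a e * x))" "x * p e = (\<Sum>a\<in>edges n. p a * (x * delta a e))"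
    if "e \<in> edges n" for e x
  proof -
    have "(\<Sum>a\<in>edges n. p a * (delta a e * x)) = (\<Sum>a\<in>edges n. p a * delta a e) * x"
      by (simp only: sum_distrib_right mult.assoc)
    then show "p e * x = (\<Sum>a\<in>edges n. p a * (delta a e * x))" by (simp only: sum_delta[OF that])
    have "(\<Sum>a\<in>edges n. p a * (x * delta a e)) = x * (\<Sum>a\<in>edges n. p a * delta a e)"
      by (simp only: sum_distrib_left mult.left_commute)
    then show "x * p e = (\<Sum>a\<in>edges n. p a * (x * delta a e))" by (simp only: sum_delta[OF that])
  qed
  show "beta p q T = (\<Sum>a\<in>edges n. p a * beta (delta a) q T)" "beta q p T = (\<Sum>a\<in>edges n. p a * beta q (delta a) T)"
    unfolding T beta.simps s(1)[OF e(1)] s(2)[OF e(1)] s(1)[OF e(2)] s(2)[OF e(2)] s(1)[OF e(3)] s(2)[OF e(3)]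
    by (simp_all only: sum_subtractf[symmetric] right_diff_distrib)
qed

lemma jac_lin_expand:
  assumes "T \<in> triples n"
  shows "jac_lin n p q r T = (\<Sum>a\<in>edges n. p a * jac_lin n (delta a) q r T)"
proof -
  have "lin n p = (\<Sum>a\<in>edges n. p a * lin n (delta a))" by (simp add: lin_delta lin_def[of n p] cong: sum.cong)
  then show ?thesis
    unfolding jac_lin_def beta_expand(1)[OF assms, where p = p] beta_expand(2)[OF assms, where p = p]
    by (simp add: sum_distrib_left sum_distrib_right sum.distrib algebra_simps)
qed

lemma jac_lin_cyclic: "jac_lin n q r p T = jac_lin n p q r T"
  by (simp add: jac_lin_def algebra_simps)

lemma in_im_jac_lin_step:
  assumes "\<And>a. a \<in> edges n \<Longrightarrow> p a \<in> polys (edges n)" "\<And>a. a \<in> edges n \<Longrightarrow> in_im n (jac_lin n (delta a) q r)"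
  shows "in_im n (jac_lin n p q r)"
proof (rule in_im_cong)
  show "in_im n (\<lambda>T. \<Sum>a\<in>edges n. p a * jac_lin n (delta a) q r T)"
    using assms by (intro in_im_sum in_im_scale)
qed (simp add: jac_lin_expand[of _ n p])

text \<open>The expression is linear over the polynomial ring in each of the three vectors. Each
  vector in turn is brought to the first place by cyclic symmetry and expanded in the basis of
  edges, until only Jacobi vectors of edges are left.\<close>

lemma in_im_jac_lin:
  assumes "\<And>a. a \<in> edges n \<Longrightarrow> p a \<in> polys (edges n)" "\<And>a. a \<in> edges n \<Longrightarrow> q a \<in> polys (edges n)"
    "\<And>a. a \<in> edges n \<Longrightarrow> r a \<in> polys (edges n)"
  shows "in_im n (jac_lin n p q r)"
proof -
  have cyc: "jac_lin n q r p = jac_lin n p q r" for p q r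
    by (rule ext) (rule jac_lin_cyclic)
  have 0: "in_im n (jac_lin n (delta a) (delta b) (delta c))" if "a \<in> edges n" "b \<in> edges n" "c \<in> edges n" for a b c
    by (rule in_im_cong[OF in_im_jac[OF that]]) (use that in \<open>simp add: jac_lin_def jac_def lin_delta beta_delta del: edges_iff\<close>)
  have 1: "in_im n (jac_lin n p (delta b) (delta c))" if "b \<in> edges n" "c \<in> edges n" for b c
    by (rule in_im_jac_lin_step[OF assms(1)]) (use 0 that in blast)+
  have 2: "in_im n (jac_lin n q (delta c) p)" if c: "c \<in> edges n" for c
  proof (rule in_im_jac_lin_step[OF assms(2)])
    show "in_im n (jac_lin n (delta b) (delta c) p)" if "b \<in> edges n" for b
      unfolding cyc[where p = p] by (rule 1[OF that c])
  qed
  have "in_im n (jac_lin n r p q)"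
  proof (rule in_im_jac_lin_step[OF assms(3)])
    show "in_im n (jac_lin n (delta c) p q)" if "c \<in> edges n" for c
      unfolding cyc[where p = q] by (rule 2[OF that])
  qed
  then show ?thesis by (simp only: cyc[where p = r])
qed

lemma lin_add: "lin n (\<lambda>e. p e + q e) = lin n p + lin n q"
  by (simp add: lin_def sum.distrib distrib_right)

lemma lin_scale: "lin n (\<lambda>e. c * p e) = c * lin n p"
  by (simp add: lin_def sum_distrib_left mult.assoc)

lemma lin_zero: "(\<And>e. e \<in> edges n \<Longrightarrow> p e = 0) \<Longrightarrow> lin n p = 0"
  by (simp add: lin_def)

lemma beta_bilinear:
  "beta (\<lambda>e. p e + p' e) q T = beta p q T + beta p' q T" "beta p (\<lambda>e. q e + q' e) T = beta p q T + beta p q' T"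
  "beta (\<lambda>e. c * p e) q T = c * beta p q T" "beta p (\<lambda>e. c * q e) T = c * beta p q T"
  by (cases T; simp add: algebra_simps)+

lemma beta_self: "beta p p T = 0"
  by (cases T) (simp add: algebra_simps)

lemma beta_zero:
  assumes "T \<in> triples n" "\<And>e. e \<in> edges n \<Longrightarrow> p e = 0" shows "beta p q T = 0" "beta q p T = 0"
  unfolding beta_expand(1)[OF assms(1), where p = p] beta_expand(2)[OF assms(1), where p = p]
  using assms(2) by (simp_all del: edges_iff)

lemma polys_lin: "(\<And>e. e \<in> edges n \<Longrightarrow> p e \<in> polys (edges n)) \<Longrightarrow> lin n p \<in> polys (edges n)"
  unfolding lin_def by (intro polys_sum polys_mult) auto

text \<open>The extension of \<open>V\<close> by \<open>S\<^sup>T\<close> with the bracket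
  \<open>[(p, m), (q, m')] = (0, p m' - q m + \<beta> p q)\<close> is a Lie algebra modulo the image of \<^const>\<open>Psi\<close>.
  The functions \<open>mag_V\<close>, \<open>mag_S\<close> are the components of the map from the free magma into it
  that is given by coordinates \<open>\<kappa>\<close> on the generators.\<close>

fun mag_V :: "('v \<Rightarrow> nat \<times> nat \<Rightarrow> complex) \<Rightarrow> 'v mag \<Rightarrow> nat \<times> nat \<Rightarrow> (nat \<times> nat) cpoly"
  where
    "mag_V \<kappa> (Gen v) e = const_poly (\<kappa> v e)"
  | "mag_V \<kappa> (Node s t) e = 0"

fun mag_S :: "nat \<Rightarrow> ('v \<Rightarrow> nat \<times> nat \<Rightarrow> complex) \<Rightarrow> 'v mag \<Rightarrow> triple \<Rightarrow> (nat \<times> nat) cpoly"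
  where
    "mag_S n \<kappa> (Gen v) T = 0"
  | "mag_S n \<kappa> (Node s t) T = lin n (mag_V \<kappa> s) * mag_S n \<kappa> t T - lin n (mag_V \<kappa> t) * mag_S n \<kappa> s T
      + beta (mag_V \<kappa> s) (mag_V \<kappa> t) T"

definition mod_V :: "('v \<Rightarrow> nat \<times> nat \<Rightarrow> complex) \<Rightarrow> ('v mag \<Rightarrow>\<^sub>0 complex) \<Rightarrow> nat \<times> nat \<Rightarrow> (nat \<times> nat) cpoly"
  where "mod_V \<kappa> a e = lin_ext (\<lambda>t. mag_V \<kappa> t e) a"

definition mod_S :: "nat \<Rightarrow> ('v \<Rightarrow> nat \<times> nat \<Rightarrow> complex) \<Rightarrow> ('v mag \<Rightarrow>\<^sub>0 complex) \<Rightarrow> triple \<Rightarrow> (nat \<times> nat) cpoly"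
  where "mod_S n \<kappa> a T = lin_ext (\<lambda>t. mag_S n \<kappa> t T) a"

lemma polys_lin_ext: "(\<And>t. f t \<in> polys Z) \<Longrightarrow> lin_ext f a \<in> polys Z"
  unfolding lin_ext_def by (intro polys_sum polys_mult) auto

lemma polys_mag_V: "mag_V \<kappa> t e \<in> polys Z"
  by (cases t) auto

lemma polys_mod_V: "mod_V \<kappa> a e \<in> polys Z"
  unfolding mod_V_def by (intro polys_lin_ext polys_mag_V)

lemma mod_V_linear:
  "mod_V \<kappa> (a + b) e = mod_V \<kappa> a e + mod_V \<kappa> b e" "mod_V \<kappa> (a - b) e = mod_V \<kappa> a e - mod_V \<kappa> b e"
  "mod_V \<kappa> (pm_scale c a) e = const_poly c * mod_V \<kappa> a e" "mod_V \<kappa> 0 e = 0"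
  "mod_V \<kappa> (Poly_Mapping.single t c) e = const_poly c * mag_V \<kappa> t e"
  by (simp_all add: mod_V_def lin_ext_add lin_ext_diff lin_ext_scale)

lemma mod_S_linear:
  "mod_S n \<kappa> (a + b) T = mod_S n \<kappa> a T + mod_S n \<kappa> b T" "mod_S n \<kappa> (a - b) T = mod_S n \<kappa> a T - mod_S n \<kappa> b T"
  "mod_S n \<kappa> (pm_scale c a) T = const_poly c * mod_S n \<kappa> a T" "mod_S n \<kappa> 0 T = 0"
  "mod_S n \<kappa> (Poly_Mapping.single t c) T = const_poly c * mag_S n \<kappa> t T"
  by (simp_all add: mod_S_def lin_ext_add lin_ext_diff lin_ext_scale)

lemma free_nonassoc_mult_linear:
  fixes Z :: "'v set"
  shows "(p + p') \<otimes>\<^bsub>free_nonassoc Z\<^esub> q = p \<otimes>\<^bsub>free_nonassoc Z\<^esub> q + p' \<otimes>\<^bsub>free_nonassoc Z\<^esub> q"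
    "q \<otimes>\<^bsub>free_nonassoc Z\<^esub> (p + p') = q \<otimes>\<^bsub>free_nonassoc Z\<^esub> p + q \<otimes>\<^bsub>free_nonassoc Z\<^esub> p'"
    "pm_scale c p \<otimes>\<^bsub>free_nonassoc Z\<^esub> q = pm_scale c (p \<otimes>\<^bsub>free_nonassoc Z\<^esub> q)"
    "q \<otimes>\<^bsub>free_nonassoc Z\<^esub> pm_scale c p = pm_scale c (q \<otimes>\<^bsub>free_nonassoc Z\<^esub> p)"
    "0 \<otimes>\<^bsub>free_nonassoc Z\<^esub> q = 0" "q \<otimes>\<^bsub>free_nonassoc Z\<^esub> 0 = 0"
  by (auto intro!: poly_mapping_eqI simp: lookup_add lookup_free_nonassoc_mult algebra_simps split: mag.splits)

lemma mod_V_mult: "mod_V \<kappa> (a \<otimes>\<^bsub>free_nonassoc Z\<^esub> b) e = 0"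
  by (simp add: mod_V_def lin_ext_mult)

lemma mod_S_mult:
  "mod_S n \<kappa> (a \<otimes>\<^bsub>free_nonassoc Z\<^esub> b) T = lin n (mod_V \<kappa> a) * mod_S n \<kappa> b T - lin n (mod_V \<kappa> b) * mod_S n \<kappa> a T
    + beta (mod_V \<kappa> a) (mod_V \<kappa> b) T"
proof -
  let ?P = "\<lambda>a b. mod_S n \<kappa> (a \<otimes>\<^bsub>free_nonassoc Z\<^esub> b) T =
    lin n (mod_V \<kappa> a) * mod_S n \<kappa> b T - lin n (mod_V \<kappa> b) * mod_S n \<kappa> a T + beta (mod_V \<kappa> a) (mod_V \<kappa> b) T"
  \<comment> \<open>The zero function is written with \<open>0 * 0\<close> so that it has the shape
    of a scalar multiple and the homogeneity rules for \<open>lin\<close> and \<open>beta\<close>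
    apply to it.\<close>
  have V: "mod_V \<kappa> (a + b) = (\<lambda>e. mod_V \<kappa> a e + mod_V \<kappa> b e)" "mod_V \<kappa> (pm_scale c a) = (\<lambda>e. const_poly c * mod_V \<kappa> a e)"
    "mod_V \<kappa> (Poly_Mapping.single t 1) = mag_V \<kappa> t" "mod_V \<kappa> 0 = (\<lambda>e. 0 * 0)" for a b c t
    by (auto simp: mod_V_linear)
  have zero: "lin n (\<lambda>e. 0) = 0" "beta p (\<lambda>e. 0) T = 0" "beta (\<lambda>e. 0) p T = 0" for p
    by (cases T; simp add: lin_def)+
  have "b \<in> {b. ?P (Poly_Mapping.single s 1) b}" for s b
  proof (rule pm_span_induct[of b UNIV])
  qed (simp_all only: mem_Collect_eq free_nonassoc_mult_linear mod_S_linear V lin_add lin_scale beta_bilinear,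
    simp_all add: zero free_nonassoc_single_mult mod_S_linear algebra_simps)
  then have "a \<in> {a. ?P a b}"
  proof (intro pm_span_induct[of a UNIV])
  qed (simp_all only: mem_Collect_eq free_nonassoc_mult_linear mod_S_linear V lin_add lin_scale beta_bilinear,
    simp_all add: zero algebra_simps)
  then show ?thesis by simp
qed

text \<open>The kernel of the map from the free non-associative algebra to the metabelian model: the
  component in \<open>V\<close> has to vanish, and the component in \<open>S^T\<close> only modulo
  the columns.\<close>

definition model_kernel :: "nat \<Rightarrow> ('v \<Rightarrow> nat \<times> nat \<Rightarrow> complex) \<Rightarrow> 'v set \<Rightarrow> ('v mag \<Rightarrow>\<^sub>0 complex) set"
  where "model_kernel n \<kappa> Z = {a \<in> carrier (free_nonassoc Z). (\<forall>e\<in>edges n. mod_V \<kappa> a e = 0) \<and> in_im n (mod_S n \<kappa> a)}"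

lemma model_kernel_ideal: "alg_ideal_of (free_nonassoc Z) (model_kernel n \<kappa> Z)"
proof -
  interpret nonassoc_algebra "free_nonassoc Z" by (rule free_nonassoc_algebra)
  have diff: "a - b \<in> model_kernel n \<kappa> Z" if "a \<in> model_kernel n \<kappa> Z" "b \<in> model_kernel n \<kappa> Z" for a b
  proof -
    have "in_im n (mod_S n \<kappa> (a - b))"
      by (rule in_im_cong[OF in_im_diff]) (use that in \<open>auto simp: model_kernel_def mod_S_linear\<close>)
    then show ?thesis using that free_nonassoc_diff_closed[of a Z b]
      by (simp add: model_kernel_def mod_V_linear del: free_nonassoc_simps(1))
  qed
  have zero: "0 \<in> model_kernel n \<kappa> Z"
    by (auto simp: model_kernel_def mod_V_linear intro!: in_im_zero mod_S_linear)
  have "submodule (model_kernel n \<kappa> Z) Cx (free_nonassoc Z)"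
  proof (rule submoduleI)
    show "model_kernel n \<kappa> Z \<subseteq> carrier (free_nonassoc Z)" by (auto simp: model_kernel_def)
    show "\<zero>\<^bsub>free_nonassoc Z\<^esub> \<in> model_kernel n \<kappa> Z" using zero by simp
  next
    fix a assume a: "a \<in> model_kernel n \<kappa> Z"
    then have "a \<in> carrier (free_nonassoc Z)" by (simp add: model_kernel_def)
    from free_nonassoc_minus[OF this] show "\<ominus>\<^bsub>free_nonassoc Z\<^esub> a \<in> model_kernel n \<kappa> Z" using diff[OF zero a] by simp
  next
    fix a b assume ab: "a \<in> model_kernel n \<kappa> Z" "b \<in> model_kernel n \<kappa> Z"
    show "a \<oplus>\<^bsub>free_nonassoc Z\<^esub> b \<in> model_kernel n \<kappa> Z" using diff[OF ab(1) diff[OF zero ab(2)]] by simp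
  next
    fix c a assume a: "a \<in> model_kernel n \<kappa> Z"
    then have "c \<odot>\<^bsub>free_nonassoc Z\<^esub> a \<in> carrier (free_nonassoc Z)" by (intro smult_closed) (auto simp: model_kernel_def)
    moreover have "in_im n (mod_S n \<kappa> (pm_scale c a))"
      by (rule in_im_cong[OF in_im_scale[of n "mod_S n \<kappa> a" "const_poly c"]])
        (use a in \<open>auto simp: model_kernel_def mod_S_linear\<close>)
    ultimately show "c \<odot>\<^bsub>free_nonassoc Z\<^esub> a \<in> model_kernel n \<kappa> Z"
      using a by (simp add: model_kernel_def mod_V_linear del: free_nonassoc_simps(1))
  qed
  moreover have "x \<otimes>\<^bsub>free_nonassoc Z\<^esub> k \<in> model_kernel n \<kappa> Z \<and> k \<otimes>\<^bsub>free_nonassoc Z\<^esub> x \<in> model_kernel n \<kappa> Z"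
    if x: "x \<in> carrier (free_nonassoc Z)" and k: "k \<in> model_kernel n \<kappa> Z" for x k
  proof -
    have V: "mod_V \<kappa> k e = 0" if "e \<in> edges n" for e using k that by (simp add: model_kernel_def)
    have S: "in_im n (mod_S n \<kappa> k)" and kc: "k \<in> carrier (free_nonassoc Z)" using k by (simp_all add: model_kernel_def)
    have l: "lin n (mod_V \<kappa> x) \<in> polys (edges n)" by (intro polys_lin polys_mod_V)
    have L: "lin n (mod_V \<kappa> k) = 0" by (rule lin_zero[OF V])
    have "in_im n (mod_S n \<kappa> (x \<otimes>\<^bsub>free_nonassoc Z\<^esub> k))"
      by (rule in_im_cong[OF in_im_scale[OF S l]]) (simp add: mod_S_mult L beta_zero[OF _ V])
    moreover have "in_im n (mod_S n \<kappa> (k \<otimes>\<^bsub>free_nonassoc Z\<^esub> x))"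
      by (rule in_im_cong[OF in_im_uminus[OF in_im_scale[OF S l]]]) (simp add: mod_S_mult L beta_zero[OF _ V])
    ultimately show ?thesis using mult_closed[OF x kc] mult_closed[OF kc x]
      by (simp add: model_kernel_def mod_V_mult del: free_nonassoc_simps(1))
  qed
  ultimately show ?thesis by (simp add: alg_ideal_of_def)
qed

text \<open>A product has no component in \<open>V\<close>, so in a nested product only the linear
  form of the outer factor and the \<open>S^T\<close> component of the inner product survive. The
  terms quadratic in the linear forms cancel cyclically, and the Jacobi defect is exactly
  \<open>jac_lin\<close>. This is where the columns make the model a Lie algebra.\<close>

lemma lie_identities_model_kernel:
  assumes "x \<in> carrier (free_nonassoc Z)" "y \<in> carrier (free_nonassoc Z)" "z \<in> carrier (free_nonassoc Z)"
  shows "x \<otimes>\<^bsub>free_nonassoc Z\<^esub> x \<in> model_kernel n \<kappa> Z"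
    "x \<otimes>\<^bsub>free_nonassoc Z\<^esub> (y \<otimes>\<^bsub>free_nonassoc Z\<^esub> z) + y \<otimes>\<^bsub>free_nonassoc Z\<^esub> (z \<otimes>\<^bsub>free_nonassoc Z\<^esub> x)
      + z \<otimes>\<^bsub>free_nonassoc Z\<^esub> (x \<otimes>\<^bsub>free_nonassoc Z\<^esub> y) \<in> model_kernel n \<kappa> Z" (is "?J \<in> _")
proof -
  interpret nonassoc_algebra "free_nonassoc Z" by (rule free_nonassoc_algebra)
  have "in_im n (mod_S n \<kappa> (x \<otimes>\<^bsub>free_nonassoc Z\<^esub> x))" by (rule in_im_zero) (simp add: mod_S_mult beta_self)
  then show "x \<otimes>\<^bsub>free_nonassoc Z\<^esub> x \<in> model_kernel n \<kappa> Z"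
    using mult_closed[OF assms(1,1)] by (simp add: model_kernel_def mod_V_mult del: free_nonassoc_simps(1))
  have "lin n (mod_V \<kappa> (a \<otimes>\<^bsub>free_nonassoc Z\<^esub> b)) = 0" for a b by (rule lin_zero) (rule mod_V_mult)
  then have "mod_S n \<kappa> ?J T = jac_lin n (mod_V \<kappa> x) (mod_V \<kappa> y) (mod_V \<kappa> z) T" if "T \<in> triples n" for T
    by (simp add: mod_S_linear mod_S_mult beta_zero[OF that] mod_V_mult
        jac_lin_def algebra_simps)
  then have "in_im n (mod_S n \<kappa> ?J)"
    by (intro in_im_cong[OF in_im_jac_lin[of n "mod_V \<kappa> x" "mod_V \<kappa> y" "mod_V \<kappa> z"]] polys_mod_V) auto
  moreover have "?J \<in> carrier (free_nonassoc Z)"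
  proof -
    have "x \<otimes>\<^bsub>free_nonassoc Z\<^esub> (y \<otimes>\<^bsub>free_nonassoc Z\<^esub> z) \<oplus>\<^bsub>free_nonassoc Z\<^esub> y \<otimes>\<^bsub>free_nonassoc Z\<^esub> (z \<otimes>\<^bsub>free_nonassoc Z\<^esub> x)
      \<oplus>\<^bsub>free_nonassoc Z\<^esub> z \<otimes>\<^bsub>free_nonassoc Z\<^esub> (x \<otimes>\<^bsub>free_nonassoc Z\<^esub> y) \<in> carrier (free_nonassoc Z)"
      by (intro M.a_closed mult_closed assms)
    then show ?thesis by (simp only: free_nonassoc_simps(2))
  qed
  ultimately show "?J \<in> model_kernel n \<kappa> Z"
    by (simp add: model_kernel_def mod_V_linear mod_V_mult del: free_nonassoc_simps(1))
qed

text \<open>Splitting off one variable lowers the total degree of a monomial. The rule is adapted to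
  the module structure, in which the action of a single variable, a bracket with a generator, is the
  explicit one.\<close>

lemma polys_induct [consumes 1, case_names const add var]:
  assumes "p \<in> polys Z" and const: "\<And>c. P (const_poly c)" and add: "\<And>p q. P p \<Longrightarrow> P q \<Longrightarrow> P (p + q)"
    and var: "\<And>v p. v \<in> Z \<Longrightarrow> p \<in> polys Z \<Longrightarrow> P p \<Longrightarrow> P (poly_var v * p)"
  shows "P p"
proof -
  have mono: "P (Poly_Mapping.single t c)" if "supp t \<subseteq> Z" for t c
    using that
  proof (induction "\<Sum>w\<in>supp t. coef t w" arbitrary: t rule: less_induct)
    case less
    show ?case
    proof (cases "t = 0")
      case True
      then show ?thesis using const[of c] by (simp add: const_poly_def)
    next
      case False
      then obtain v where v: "coef t v \<noteq> 0" by (metis lookup_zero poly_mapping_eqI)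
      define t' where "t' = t - Poly_Mapping.single v 1"
      have t: "t = Poly_Mapping.single v 1 + t'"
        using v by (intro poly_mapping_eqI) (auto simp: t'_def lookup_add lookup_minus lookup_single when_def)
      have le: "coef t' w \<le> coef t w" for w by (simp add: t'_def lookup_minus)
      then have sub: "supp t' \<subseteq> supp t" by (metis in_keys_iff le_zero_eq subsetI)
      have "(\<Sum>w\<in>supp t'. coef t' w) = (\<Sum>w\<in>supp t. coef t' w)"
        using sub by (intro sum.mono_neutral_left) (auto simp: in_keys_iff)
      also have "\<dots> < (\<Sum>w\<in>supp t. coef t w)"
        using v le by (intro sum_strict_mono_ex1) (auto simp: in_keys_iff t'_def lookup_minus intro!: bexI[of _ v])
      finally have "P (Poly_Mapping.single t' c)" using less.hyps[of t'] sub less.prems by auto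
      moreover have "v \<in> Z" using v less.prems by (auto simp: in_keys_iff)
      moreover have "Poly_Mapping.single t' c \<in> polys Z" using sub less.prems by (auto simp: polys_def)
      ultimately have "P (poly_var v * Poly_Mapping.single t' c)" by (intro var)
      then show ?thesis by (simp add: poly_var_def mult_single t[symmetric] del: One_nat_def)
    qed
  qed
  have zero: "P 0" using const[of 0] by simp
  have "P (\<Sum>t\<in>A. Poly_Mapping.single t (coef p t))" if "finite A" "A \<subseteq> supp p" for A
    using that assms(1) by (induction A rule: finite_induct) (auto intro!: zero add mono simp: polys_def)
  from this[of "supp p"] show ?thesis by (simp add: pm_sum_monomials)
qed

section \<open>The infinitesimal Alexander invariant of the upper McCool groups\<close>

locale upper_McCool_homology =
  fixes n :: nat
begin

sublocale group_homology "upper_McCool n"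
  by (intro group_homology.intro upper_McCool_group)

abbreviation G :: "(word \<Rightarrow> word) monoid" where "G \<equiv> upper_McCool n"
abbreviation E :: "(nat \<times> nat) set" where "E \<equiv> edges n"

definition xe :: "nat \<times> nat \<Rightarrow> ((word \<Rightarrow> word) \<Rightarrow>\<^sub>0 complex) set"
  where "xe = (\<lambda>(i, j). class1 G (alpha n i j))"

definition he :: "nat \<times> nat \<Rightarrow> (word \<Rightarrow> word) lieH1 set"
  where "he e = holonomy_gen G (xe e)"

lemma xe_closed: "e \<in> E \<Longrightarrow> xe e \<in> carrier V"
  using alpha_carrier class1_closed by (auto simp: xe_def simp del: edges_iff split: prod.split)

lemma he_closed: "e \<in> E \<Longrightarrow> he e \<in> carrier HL"
  unfolding he_def by (intro holonomy_gen_closed xe_closed)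

text \<open>The basis of the first cohomology dual to the classes of the \<alpha>\<open>_ij\<close>,
  realised by exponent sums in the conjugating words; see \<open>pairing_ue_xe\<close>.\<close>

definition ue :: "nat \<times> nat \<Rightarrow> (word \<Rightarrow> word) \<Rightarrow> complex"
  where "ue = (\<lambda>(i, j). \<lambda>g\<in>carrier G. mc2 i j g)"

lemma ue_H1: "e \<in> E \<Longrightarrow> ue e \<in> H1_coh G"
  by (cases e) (auto simp: ue_def H1_coh_def upper_McCool_mc2_mult)

lemma pairing_ue_xe:
  assumes "e \<in> E" "f \<in> E" shows "pairing (ue e) (xe f) = (if e = f then 1 else 0)"
proof -
  obtain i j s t where ef: "e = (i, j)" "f = (s, t)" by (meson prod.exhaust)
  have "pairing (ue e) (xe f) = ue e (alpha n s t)"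
    unfolding ef xe_def using assms[unfolded ef] by (simp add: pairing_class1[OF ue_H1] alpha_carrier del: edges_iff)
  also have "\<dots> = mc2 i j (alpha n s t)" using assms(2) alpha_carrier[of s t n] by (simp add: ef ue_def del: edges_iff)
  finally show ?thesis using mc2_alpha[of s t n i j] assms by (simp add: ef del: edges_iff)
qed

lemma H_1_edge_span:
  assumes W: "submodule W Cx V" and x: "\<And>e. e \<in> E \<Longrightarrow> xe e \<in> W" shows "W = carrier V"
proof (rule H_1_span[OF W])
  interpret H: module Cx V by (rule H_1_module)
  note WE = H.submoduleE[OF W]
  have class_one: "class1 G \<one>\<^bsub>G\<^esub> = \<zero>\<^bsub>V\<^esub>"
    using class1_mult[of "\<one>\<^bsub>G\<^esub>" "\<one>\<^bsub>G\<^esub>"] class1_closed[of "\<one>\<^bsub>G\<^esub>"] by simp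
  have one_eq: "\<one>\<^bsub>Aut_F n\<^esub> = \<one>\<^bsub>G\<^esub>" by (simp add: upper_McCool_def)
  fix g assume "g \<in> carrier G"
  then have "g \<in> carrier G \<and> class1 G g \<in> W"
  proof (induction rule: upper_McCool_induct)
    case one
    then show ?case using class_one H.submodule_zero[OF W] by (simp add: one_eq)
  next
    case (alpha i j)
    then show ?case using x[of "(i, j)"] alpha_carrier[of i j n] by (simp add: xe_def del: edges_iff)
  next
    case (inv i j)
    then have e: "(i, j) \<in> E" "i \<noteq> j" "i \<in> {1..n}" "j \<in> {1..n}" by auto
    have i: "conj_aut n i j False = inv\<^bsub>Aut_F n\<^esub> (alpha n i j)" using inv_alpha[OF e(2-4)] by simp
    have c: "conj_aut n i j False \<in> carrier G"
      unfolding i upper_McCool_carrier by (rule generate.inv) (use e(1) in auto)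
    have "conj_aut n i j False \<otimes>\<^bsub>G\<^esub> alpha n i j = \<one>\<^bsub>G\<^esub>"
      unfolding i upper_McCool_mult one_eq[symmetric] using alpha_auto[OF e(1)] by (intro AutF.l_inv) (simp add: Aut_F_carrier)
    then have "class1 G (conj_aut n i j False) \<oplus>\<^bsub>V\<^esub> xe (i, j) = \<zero>\<^bsub>V\<^esub>"
      using class1_mult[OF c alpha_carrier[OF e(1)]] class_one by (simp add: xe_def)
    then have "class1 G (conj_aut n i j False) = \<ominus>\<^bsub>V\<^esub> xe (i, j)"
      using H.M.minus_equality[OF _ xe_closed[OF e(1)] class1_closed[OF c]] by simp
    then show ?case using c WE(3)[OF x[OF e(1)]] by simp
  next
    case (mult g h)
    then show ?case using WE(5)[of "class1 G g" "class1 G h"] by (simp add: class1_mult)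
  qed
  then show "class1 G g \<in> W" by blast
qed

lemma he_commute:
  assumes "(i, j) \<in> E" "(s, t) \<in> E" "alpha n i j \<otimes>\<^bsub>G\<^esub> alpha n s t = alpha n s t \<otimes>\<^bsub>G\<^esub> alpha n i j"
  shows "he (i, j) \<otimes>\<^bsub>HL\<^esub> he (s, t) = \<zero>\<^bsub>HL\<^esub>"
  using holonomy_gen_commute[OF alpha_carrier[OF assms(1)] alpha_carrier[OF assms(2)] assms(3)]
  by (simp add: he_def xe_def)

text \<open>The element \<alpha>\<open>_ij\<close> commutes with the product of
  \<alpha>\<open>_ik\<close> and \<alpha>\<open>_jk\<close>, whose homology class is the sum of the
  two edge classes; the torus relation then splits by bilinearity of the bracket.\<close>

lemma he_triangle:
  assumes "(i, j) \<in> E" "(j, k) \<in> E"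
  shows "he (i, j) \<otimes>\<^bsub>HL\<^esub> he (j, k) = \<ominus>\<^bsub>HL\<^esub> (he (i, j) \<otimes>\<^bsub>HL\<^esub> he (i, k))"
proof -
  have ik: "(i, k) \<in> E" using assms by auto
  note a = alpha_carrier[OF assms(1)] alpha_carrier[OF assms(2)] alpha_carrier[OF ik]
  note x = xe_closed[OF assms(2)] xe_closed[OF ik]
  note h = he_closed[OF assms(1)] he_closed[OF assms(2)] he_closed[OF ik]
  have "he (i, j) \<otimes>\<^bsub>HL\<^esub> holonomy_gen G (class1 G (alpha n i k \<otimes>\<^bsub>G\<^esub> alpha n j k)) = \<zero>\<^bsub>HL\<^esub>"
    using holonomy_gen_commute[OF a(1) m_closed[OF a(3,2)] alpha_commute_triangle[OF assms]]
    by (simp add: he_def xe_def)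
  moreover have "class1 G (alpha n i k \<otimes>\<^bsub>G\<^esub> alpha n j k) = xe (i, k) \<oplus>\<^bsub>V\<^esub> xe (j, k)"
    unfolding class1_mult[OF a(3,2)] by (simp add: xe_def)
  ultimately have "he (i, j) \<otimes>\<^bsub>HL\<^esub> he (i, k) \<oplus>\<^bsub>HL\<^esub> he (i, j) \<otimes>\<^bsub>HL\<^esub> he (j, k) = \<zero>\<^bsub>HL\<^esub>"
    using holonomy_gen_add[OF x(2,1)] HL.mult_r_distr[OF h(3,2,1)] by (simp add: he_def)
  then show ?thesis
    using h HL.M.minus_equality[of "he (i, j) \<otimes>\<^bsub>HL\<^esub> he (j, k)" "he (i, j) \<otimes>\<^bsub>HL\<^esub> he (i, k)"]
    by (simp add: HL.M.a_comm)
qed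

abbreviation B :: "(complex, (word \<Rightarrow> word) lieH1 set set) module"
  where "B \<equiv> alexander_space G"

lemma B_eq: "B = mod_quot (derived_alg HL) HL.D2"
  by (simp add: alexander_space_def)

lemma alexander_ad_eq: "alexander_ad G u = HL.adj (holonomy_gen G u)"
  by (intro ext) (simp add: alexander_ad_def HL.adj_def)

sublocale A: commuting_ops B "index_pairs n" "\<lambda>e. alexander_ad G (xe e)"
proof (intro commuting_ops.intro commuting_ops_axioms.intro)
  show "module Cx B" unfolding B_eq by (rule HL.D.quotient_module)
qed (unfold B_eq alexander_ad_eq he_def[symmetric],
    (intro HL.adj_linear HL.adj_commute he_closed; assumption)+)

lemma B_module_eq: "B_module n = A.act_module"
proof -
  have "B_module n = inf_alexander G (index_pairs n) xe" by (simp add: B_module_def xe_def)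
  also have "\<dots> = A.act_module" by (rule inf_alexander_act_module) (rule A.commuting_ops_axioms)
  finally show ?thesis .
qed

lemma act_var_cls:
  assumes "e \<in> E" "z \<in> HL.D1"
  shows "A.act (poly_var e) (HL.cls z) = HL.cls (he e \<otimes>\<^bsub>HL\<^esub> z)"
  using A.act_var[OF distinct_index_pairs assms(1), of "HL.cls z"] HL.cls_closed[OF assms(2)]
    HL.adj_cls[OF he_closed[OF assms(1)] assms(2)]
  by (simp add: B_eq alexander_ad_eq he_def)

section \<open>The presentation map and its vanishing on the columns\<close>

definition gT :: "triple \<Rightarrow> (word \<Rightarrow> word) lieH1 set set"
  where "gT = (\<lambda>(i, j, k). HL.cls (he (i, j) \<otimes>\<^bsub>HL\<^esub> he (i, k)))"

lemma gT_closed: "T \<in> triples n \<Longrightarrow> gT T \<in> carrier B"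
  by (cases T) (auto simp: gT_def B_eq intro!: HL.cls_closed HL.mult_D1 he_closed)

definition pres :: "(triple \<Rightarrow> (nat \<times> nat) cpoly) \<Rightarrow> (word \<Rightarrow> word) lieH1 set set"
  where "pres f = (\<Oplus>\<^bsub>B\<^esub>T\<in>triples n. A.act (f T) (gT T))"

lemma pres_closed: "pres f \<in> carrier B"
  unfolding pres_def by (intro A.M.finsum_closed) (auto intro: gT_closed simp del: triples_iff)

lemma pres_cong: "(\<And>T. T \<in> triples n \<Longrightarrow> f T = g T) \<Longrightarrow> pres f = pres g"
  unfolding pres_def by (intro A.M.finsum_cong') (auto intro: gT_closed simp del: triples_iff)

lemma pres_add: "pres (\<lambda>T. f T + g T) = pres f \<oplus>\<^bsub>B\<^esub> pres g"
proof -
  have "pres (\<lambda>T. f T + g T) = (\<Oplus>\<^bsub>B\<^esub>T\<in>triples n. A.act (f T) (gT T) \<oplus>\<^bsub>B\<^esub> A.act (g T) (gT T))"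
    unfolding pres_def using gT_closed by (intro A.M.finsum_cong') (auto simp: A.act_add_left A.act_closed simp del: triples_iff)
  also have "\<dots> = pres f \<oplus>\<^bsub>B\<^esub> pres g"
    unfolding pres_def using gT_closed by (intro A.M.finsum_addf) (auto simp: A.act_closed simp del: triples_iff)
  finally show ?thesis .
qed

lemma act_zero_right: "A.act p \<zero>\<^bsub>B\<^esub> = \<zero>\<^bsub>B\<^esub>"
  using A.act_mult[of "\<zero>\<^bsub>B\<^esub>" p 0] by simp

lemma pres_mult: "pres (\<lambda>T. p * f T) = A.act p (pres f)"
proof -
  have "A.act p (\<Oplus>\<^bsub>B\<^esub>T\<in>S. A.act (f T) (gT T)) = (\<Oplus>\<^bsub>B\<^esub>T\<in>S. A.act (p * f T) (gT T))" if "finite S" "S \<subseteq> triples n" for S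
    using that
  proof (induction S rule: finite_induct)
    case (insert T S)
    have c: "gT T' \<in> carrier B" if "T' \<in> insert T S" for T' using gT_closed insert.prems that by blast
    have "(\<Oplus>\<^bsub>B\<^esub>T\<in>S. A.act (f T) (gT T)) \<in> carrier B" using c by (intro A.M.finsum_closed) auto
    then show ?case
      using insert c by (simp add: A.M.finsum_insert A.act_add_right A.act_mult Pi_def A.act_closed)
  qed (simp add: act_zero_right)
  then show ?thesis unfolding pres_def by simp
qed

text \<open>The constant zero is written as \<open>0 * 0\<close> to be an instance of
  \<open>pres_mult\<close> with the scalar 0, which acts as the zero map.\<close>

lemma pres_zero: "(\<And>T. T \<in> triples n \<Longrightarrow> f T = 0) \<Longrightarrow> pres f = \<zero>\<^bsub>B\<^esub>"
  using pres_cong[of f "\<lambda>T. 0 * 0"] pres_mult[of 0 "\<lambda>_. 0"] by simp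

lemma pres_uminus: "pres (\<lambda>T. - f T) = \<ominus>\<^bsub>B\<^esub> pres f"
proof -
  have "pres (\<lambda>T. - f T) \<oplus>\<^bsub>B\<^esub> pres f = \<zero>\<^bsub>B\<^esub>" unfolding pres_add[symmetric] by (rule pres_zero) simp
  then show ?thesis using A.M.minus_equality pres_closed by metis
qed

lemma pres_diff: "pres (\<lambda>T. f T - g T) = pres f \<ominus>\<^bsub>B\<^esub> pres g"
  using pres_add[of f "\<lambda>T. - g T"] by (simp add: pres_uminus a_minus_def)

lemma pres_unit_vec:
  assumes "T \<in> triples n" shows "pres (unit_vec T) = gT T"
proof -
  have "pres (unit_vec T) = (\<Oplus>\<^bsub>B\<^esub>T'\<in>triples n. if T = T' then gT T' else \<zero>\<^bsub>B\<^esub>)"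
    unfolding pres_def using gT_closed by (intro A.M.finsum_cong') (auto simp: unit_vec_def simp del: triples_iff)
  also have "\<dots> = gT T" using assms gT_closed by (intro A.M.finsum_singleton) (auto simp del: triples_iff)
  finally show ?thesis .
qed

lemma cls_minus: "z \<in> HL.D1 \<Longrightarrow> HL.cls (\<ominus>\<^bsub>HL\<^esub> z) = \<ominus>\<^bsub>B\<^esub> HL.cls z"
  by (simp add: HL.cls_minus B_eq)

lemma cls_zero: "HL.cls \<zero>\<^bsub>HL\<^esub> = \<zero>\<^bsub>B\<^esub>"
  by (simp add: HL.cls_zero B_eq)

text \<open>Two edges have seven relative positions. Torus relations kill the bracket of disjoint
  edges and of edges with the same lower index, the triangle relation turns
  \<open>[x_ij, x_jk]\<close> into \<open>- [x_ij, x_ik]\<close>, and the remaining cases are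
  antisymmetry or the definition of \<open>gT\<close>.\<close>

lemma cls_edge_bracket:
  assumes "a \<in> E" "b \<in> E" shows "HL.cls (he a \<otimes>\<^bsub>HL\<^esub> he b) = pres (edge_bracket a b)"
proof -
  obtain i j s t where ab: "a = (i, j)" "b = (s, t)" by (meson prod.exhaust)
  have e: "(i, j) \<in> E" "(s, t) \<in> E" using assms ab by auto
  note h = he_closed[OF e(1)] he_closed[OF e(2)]
  note d = HL.mult_D1[OF h] HL.mult_D1[OF h(2,1)]
  have anti: "HL.cls (he (i, j) \<otimes>\<^bsub>HL\<^esub> he (s, t)) = \<ominus>\<^bsub>B\<^esub> HL.cls (he (s, t) \<otimes>\<^bsub>HL\<^esub> he (i, j))"
    unfolding HL.mult_anticomm[OF h(2,1)] by (rule cls_minus[OF d(2)])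
  consider "i = s" "t < j" | "i = s" "j < t" | "i = s" "j = t" | "i \<noteq> s" "j = s" | "i \<noteq> s" "j \<noteq> s" "t = i"
    | "i \<noteq> s" "j \<noteq> s" "t \<noteq> i" "j = t" | "i \<noteq> s" "j \<noteq> s" "t \<noteq> i" "j \<noteq> t"
    by linarith
  then show ?thesis
  proof cases
    case 1
    then show ?thesis using e by (simp add: ab pres_unit_vec gT_def)
  next
    case 2
    then have "HL.cls (he (s, t) \<otimes>\<^bsub>HL\<^esub> he (i, j)) = pres (unit_vec (i, t, j))" using e by (simp add: pres_unit_vec gT_def)
    then show ?thesis using 2 anti by (simp add: ab pres_uminus)
  next
    case 3
    then show ?thesis using HL.mult_self[OF h(1)] by (simp add: ab cls_zero pres_zero)
  next
    case 4
    have ik: "(i, t) \<in> E" using 4 e by auto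
    have "HL.cls (he (i, j) \<otimes>\<^bsub>HL\<^esub> he (s, t)) = \<ominus>\<^bsub>B\<^esub> HL.cls (he (i, j) \<otimes>\<^bsub>HL\<^esub> he (i, t))"
      using he_triangle[of i j t] e 4 cls_minus[OF HL.mult_D1[OF h(1) he_closed[OF ik]]] by (simp del: edges_iff)
    also have "HL.cls (he (i, j) \<otimes>\<^bsub>HL\<^esub> he (i, t)) = pres (unit_vec (i, j, t))" using e 4 by (simp add: pres_unit_vec gT_def)
    finally show ?thesis using 4 by (simp add: ab pres_uminus)
  next
    case 5
    have sj: "(s, j) \<in> E" using 5 e by auto
    have "HL.cls (he (s, t) \<otimes>\<^bsub>HL\<^esub> he (i, j)) = \<ominus>\<^bsub>B\<^esub> HL.cls (he (s, t) \<otimes>\<^bsub>HL\<^esub> he (s, j))"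
      using he_triangle[of s t j] e 5 cls_minus[OF HL.mult_D1[OF h(2) he_closed[OF sj]]] by (simp del: edges_iff)
    also have "HL.cls (he (s, t) \<otimes>\<^bsub>HL\<^esub> he (s, j)) = pres (unit_vec (s, t, j))" using e 5 by (simp add: pres_unit_vec gT_def)
    finally show ?thesis using 5 anti pres_closed[of "unit_vec (s, t, j)"] by (simp add: ab)
  next
    case 6
    then show ?thesis using he_commute[OF e] alpha_commute_target[of i j n s] e
      by (simp add: ab cls_zero pres_zero del: edges_iff)
  next
    case 7
    then show ?thesis using he_commute[OF e alpha_commute_disjoint[OF e]] by (simp add: ab cls_zero pres_zero)
  qed
qed

text \<open>Each of the three summands is the class of a nested bracket in the holonomy Lie algebra,
  and the sum vanishes by the Jacobi identity there.\<close>

lemma pres_jac: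
  assumes "a \<in> E" "b \<in> E" "c \<in> E" shows "pres (jac a b c) = \<zero>\<^bsub>B\<^esub>"
proof -
  note h = he_closed[OF assms(1)] he_closed[OF assms(2)] he_closed[OF assms(3)]
  have summand: "pres (\<lambda>T. poly_var x * edge_bracket y z T) = HL.cls (he x \<otimes>\<^bsub>HL\<^esub> (he y \<otimes>\<^bsub>HL\<^esub> he z))"
    if "x \<in> E" "y \<in> E" "z \<in> E" for x y z
    unfolding pres_mult cls_edge_bracket[OF that(2,3), symmetric]
    by (rule act_var_cls[OF that(1) HL.mult_D1[OF he_closed[OF that(2)] he_closed[OF that(3)]]])
  have d: "he a \<otimes>\<^bsub>HL\<^esub> (he b \<otimes>\<^bsub>HL\<^esub> he c) \<in> HL.D1" "he b \<otimes>\<^bsub>HL\<^esub> (he c \<otimes>\<^bsub>HL\<^esub> he a) \<in> HL.D1" "he c \<otimes>\<^bsub>HL\<^esub> (he a \<otimes>\<^bsub>HL\<^esub> he b) \<in> HL.D1"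
    using h by (auto intro!: HL.mult_D1)
  have "jac a b c = (\<lambda>T. (\<lambda>T. poly_var a * edge_bracket b c T) T + (\<lambda>T. (\<lambda>T. poly_var b * edge_bracket c a T) T + (\<lambda>T. poly_var c * edge_bracket a b T) T) T)"
    by (rule ext) (simp add: jac_def)
  then have "pres (jac a b c) = HL.cls (he a \<otimes>\<^bsub>HL\<^esub> (he b \<otimes>\<^bsub>HL\<^esub> he c)) \<oplus>\<^bsub>B\<^esub>
    (HL.cls (he b \<otimes>\<^bsub>HL\<^esub> (he c \<otimes>\<^bsub>HL\<^esub> he a)) \<oplus>\<^bsub>B\<^esub> HL.cls (he c \<otimes>\<^bsub>HL\<^esub> (he a \<otimes>\<^bsub>HL\<^esub> he b)))"
    by (simp only: pres_add summand[OF assms] summand[OF assms(2,3,1)] summand[OF assms(3,1,2)])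
  also have "\<dots> = HL.cls (he a \<otimes>\<^bsub>HL\<^esub> (he b \<otimes>\<^bsub>HL\<^esub> he c) \<oplus>\<^bsub>HL\<^esub> (he b \<otimes>\<^bsub>HL\<^esub> (he c \<otimes>\<^bsub>HL\<^esub> he a) \<oplus>\<^bsub>HL\<^esub> he c \<otimes>\<^bsub>HL\<^esub> (he a \<otimes>\<^bsub>HL\<^esub> he b)))"
    using d HL.cls_add HL.D.M.a_closed[OF d(2,3)] by (simp add: B_eq HL.D1_simps)
  finally show ?thesis unfolding HL.jacobi[OF h] cls_zero .
qed

lemma pres_colvec:
  assumes "T \<in> triples n" "e \<in> set (labels n T)" shows "pres (colvec T e) = \<zero>\<^bsub>B\<^esub>"
proof -
  obtain i j k s t where T: "T = (i, j, k)" "e = (s, t)" by (cases T; cases e) blast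
  show ?thesis unfolding T
  proof (rule column_in_jac_span[where P = "\<lambda>m. pres m = \<zero>\<^bsub>B\<^esub>" and n = n])
    show "pres (\<lambda>T. u T - v T) = \<zero>\<^bsub>B\<^esub>" if "pres u = \<zero>\<^bsub>B\<^esub>" "pres v = \<zero>\<^bsub>B\<^esub>" for u v
      using that by (simp add: pres_diff A.M.r_neg a_minus_def)
  qed (use assms T pres_jac in auto)
qed

lemma pres_in_im:
  assumes "in_im n m" shows "pres m = \<zero>\<^bsub>B\<^esub>"
proof -
  obtain c where c: "\<forall>T\<in>triples n. m T = (\<Sum>x\<in>columns n. Psi n T x * c x)" using assms by (auto simp: in_im_def)
  have col: "pres (\<lambda>T. Psi n T x * c x) = \<zero>\<^bsub>B\<^esub>" if "x \<in> columns n" for x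
  proof -
    obtain T q where x: "x = (T, q)" by (cases x)
    have "pres (\<lambda>T'. Psi n T' x * c x) = A.act (c x) (pres (colvec T (labels n T ! q)))"
      unfolding pres_mult[symmetric] by (rule pres_cong) (simp add: x Psi_def mult.commute)
    then show ?thesis using pres_colvec[of T "labels n T ! q"] columns_label[of T q n] that x by (simp add: act_zero_right)
  qed
  have "pres (\<lambda>T. \<Sum>x\<in>A. Psi n T x * c x) = \<zero>\<^bsub>B\<^esub>" if "finite A" "A \<subseteq> columns n" for A
    using that by (induction A rule: finite_induct) (simp_all add: pres_add col pres_zero)
  from this[of "columns n"] show ?thesis using pres_cong[of m] c by simp
qed

section \<open>Generation of the invariant by the classes of the triples\<close>

definition covered :: "(word \<Rightarrow> word) lieH1 set set"
  where "covered = {z \<in> HL.D1. \<exists>f. (\<forall>T\<in>triples n. f T \<in> polys E) \<and> HL.cls z = pres f}"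

lemma coveredI:
  "z \<in> HL.D1 \<Longrightarrow> (\<And>T. T \<in> triples n \<Longrightarrow> f T \<in> polys E) \<Longrightarrow> HL.cls z = pres f \<Longrightarrow> z \<in> covered"
  unfolding covered_def by blast

lemma covered_D1: "z \<in> covered \<Longrightarrow> z \<in> HL.D1"
  by (simp add: covered_def)

lemma covered_carrier: "z \<in> covered \<Longrightarrow> z \<in> carrier HL"
  using covered_D1 HL.D1_subset by blast

lemma covered_zero: "\<zero>\<^bsub>HL\<^esub> \<in> covered"
  unfolding covered_def using HL.submodule_zero[OF HL.D1_submodule]
  by (auto intro!: exI[of _ "\<lambda>_. 0"] simp: cls_zero pres_zero)

lemma covered_D2:
  assumes "z \<in> HL.D2" shows "z \<in> covered"
proof -
  have "HL.cls z = pres (\<lambda>_. 0)"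
    using HL.cls_eq_zero_iff[OF HL.D2_subset[OF assms]] assms pres_zero[of "\<lambda>_. 0"] by (simp add: B_eq)
  then show ?thesis by (rule coveredI[OF HL.D2_subset[OF assms] polys_zero])
qed

lemma covered_add:
  assumes "y \<in> covered" "z \<in> covered" shows "y \<oplus>\<^bsub>HL\<^esub> z \<in> covered"
proof -
  obtain f g where f: "\<forall>T\<in>triples n. f T \<in> polys E" "HL.cls y = pres f"
    and g: "\<forall>T\<in>triples n. g T \<in> polys E" "HL.cls z = pres g" using assms by (auto simp: covered_def)
  note d = covered_D1[OF assms(1)] covered_D1[OF assms(2)]
  have "HL.cls (y \<oplus>\<^bsub>HL\<^esub> z) = pres (\<lambda>T. f T + g T)"
    using HL.cls_add[OF d] f g by (simp add: pres_add B_eq)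
  moreover have "y \<oplus>\<^bsub>HL\<^esub> z \<in> HL.D1" using HL.D.M.a_closed[OF d] by (simp add: HL.D1_simps)
  ultimately show ?thesis using f(1) g(1) by (intro coveredI[of _ "\<lambda>T. f T + g T"]) auto
qed

lemma covered_smult:
  assumes "z \<in> covered" shows "c \<odot>\<^bsub>HL\<^esub> z \<in> covered"
proof -
  obtain f where f: "\<forall>T\<in>triples n. f T \<in> polys E" "HL.cls z = pres f" using assms by (auto simp: covered_def)
  note d = covered_D1[OF assms]
  have "HL.cls (c \<odot>\<^bsub>HL\<^esub> z) = c \<odot>\<^bsub>B\<^esub> pres f" using HL.cls_smult[OF d, of c] f by (simp add: B_eq)
  also have "\<dots> = pres (\<lambda>T. const_poly c * f T)" by (simp add: pres_mult A.act_const pres_closed)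
  finally have "HL.cls (c \<odot>\<^bsub>HL\<^esub> z) = pres (\<lambda>T. const_poly c * f T)" .
  moreover have "c \<odot>\<^bsub>HL\<^esub> z \<in> HL.D1" using HL.D.smult_closed[OF _ d, of c] by (simp add: HL.D1_simps)
  ultimately show ?thesis using f(1) by (intro coveredI[of _ "\<lambda>T. const_poly c * f T"]) auto
qed

lemma covered_uminus: "z \<in> covered \<Longrightarrow> \<ominus>\<^bsub>HL\<^esub> z \<in> covered"
  using covered_smult[of z "- 1"] HL.smult_minus_one[OF covered_carrier] by simp

lemma covered_submodule: "submodule covered Cx HL"
  by (rule HL.submoduleI) (auto intro: covered_zero covered_add covered_smult covered_uminus covered_carrier)

lemma covered_he_mult:
  assumes "e \<in> E" "z \<in> covered" shows "he e \<otimes>\<^bsub>HL\<^esub> z \<in> covered"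
proof -
  obtain f where f: "\<forall>T\<in>triples n. f T \<in> polys E" "HL.cls z = pres f" using assms by (auto simp: covered_def)
  have "HL.cls (he e \<otimes>\<^bsub>HL\<^esub> z) = pres (\<lambda>T. poly_var e * f T)"
    using act_var_cls[OF assms(1) covered_D1[OF assms(2)]] f by (simp add: pres_mult)
  moreover have "he e \<otimes>\<^bsub>HL\<^esub> z \<in> HL.D1"
    by (rule HL.mult_D1[OF he_closed[OF assms(1)] covered_carrier[OF assms(2)]])
  ultimately show ?thesis
    using f(1) assms(1) by (intro coveredI[of _ "\<lambda>T. poly_var e * f T"]) (auto simp del: edges_iff)
qed

text \<open>All vectors of \<open>H_1\<close> occur as generators of the free Lie algebra, not only
  the edge classes. Properties stable under linear combinations are reduced to edges, which span
  \<open>H_1\<close>.\<close>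

lemma edge_linear_induct:
  assumes lin: "\<And>u v. u \<in> carrier V \<Longrightarrow> v \<in> carrier V \<Longrightarrow> P u \<Longrightarrow> P v \<Longrightarrow> P (u \<oplus>\<^bsub>V\<^esub> v)"
    "\<And>c u. u \<in> carrier V \<Longrightarrow> P u \<Longrightarrow> P (c \<odot>\<^bsub>V\<^esub> u)"
    and zero: "P \<zero>\<^bsub>V\<^esub>" and edge: "\<And>e. e \<in> E \<Longrightarrow> P (xe e)" and v: "v \<in> carrier V"
  shows "P v"
proof -
  interpret H: module Cx V by (rule H_1_module)
  have "{v \<in> carrier V. P v} = carrier V"
  proof (rule H_1_edge_span)
    show "submodule {v \<in> carrier V. P v} Cx V"
    proof (rule H.submoduleI)
      fix u assume u: "u \<in> {v \<in> carrier V. P v}"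
      have "\<ominus>\<^bsub>V\<^esub> u = (- 1) \<odot>\<^bsub>V\<^esub> u" using H.smult_l_minus[of 1 u] H.smult_one[of u] u by simp
      then show "\<ominus>\<^bsub>V\<^esub> u \<in> {v \<in> carrier V. P v}" using u lin(2)[of u "- 1"] by auto
    qed (use lin zero in auto)
  qed (use edge xe_closed in blast)
  with v show ?thesis by blast
qed

lemma holonomy_gen_zero: "holonomy_gen G \<zero>\<^bsub>V\<^esub> = \<zero>\<^bsub>HL\<^esub>"
proof -
  interpret H: module Cx V by (rule H_1_module)
  have "0 \<odot>\<^bsub>V\<^esub> \<zero>\<^bsub>V\<^esub> = \<zero>\<^bsub>V\<^esub>" using H.smult_r_null[of 0] by simp
  then have "holonomy_gen G \<zero>\<^bsub>V\<^esub> = 0 \<odot>\<^bsub>HL\<^esub> holonomy_gen G \<zero>\<^bsub>V\<^esub>"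
    using holonomy_gen_smult[OF H.M.zero_closed, of 0] by simp
  then show ?thesis using HL.smult_zero[OF holonomy_gen_closed[OF H.M.zero_closed]] by simp
qed

lemma covered_gen_mult:
  assumes "v \<in> carrier V" "z \<in> covered" shows "holonomy_gen G v \<otimes>\<^bsub>HL\<^esub> z \<in> covered"
  using assms(1)
proof (rule edge_linear_induct[rotated 4])
  fix u v assume "u \<in> carrier V" "v \<in> carrier V" "holonomy_gen G u \<otimes>\<^bsub>HL\<^esub> z \<in> covered" "holonomy_gen G v \<otimes>\<^bsub>HL\<^esub> z \<in> covered"
  then show "holonomy_gen G (u \<oplus>\<^bsub>V\<^esub> v) \<otimes>\<^bsub>HL\<^esub> z \<in> covered"
    using covered_carrier[OF assms(2)]
    by (simp add: holonomy_gen_add holonomy_gen_closed HL.mult_l_distr covered_add)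
next
  fix c u assume "u \<in> carrier V" "holonomy_gen G u \<otimes>\<^bsub>HL\<^esub> z \<in> covered"
  then show "holonomy_gen G (c \<odot>\<^bsub>V\<^esub> u) \<otimes>\<^bsub>HL\<^esub> z \<in> covered"
    using covered_carrier[OF assms(2)]
    by (simp add: holonomy_gen_smult holonomy_gen_closed HL.smult_mult_l covered_smult)
next
  show "holonomy_gen G \<zero>\<^bsub>V\<^esub> \<otimes>\<^bsub>HL\<^esub> z \<in> covered"
    using covered_carrier[OF assms(2)] by (simp add: holonomy_gen_zero covered_zero)
next
  show "holonomy_gen G (xe e) \<otimes>\<^bsub>HL\<^esub> z \<in> covered" if "e \<in> E" for e
    using covered_he_mult[OF that assms(2)] by (simp add: he_def)
qed

lemma covered_he_he:
  assumes "a \<in> E" "b \<in> E" shows "he a \<otimes>\<^bsub>HL\<^esub> he b \<in> covered"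
proof -
  have "edge_bracket a b T \<in> polys E" for T
  proof -
    have "unit_vec T' T \<in> polys E" for T' by (simp add: unit_vec_def)
    then show ?thesis by (cases a; cases b) (simp add: polys_uminus)
  qed
  then show ?thesis
    by (rule coveredI[OF HL.mult_D1[OF he_closed[OF assms(1)] he_closed[OF assms(2)]] _ cls_edge_bracket[OF assms]])
qed

lemma covered_gen_gen:
  assumes "u \<in> carrier V" "v \<in> carrier V" shows "holonomy_gen G u \<otimes>\<^bsub>HL\<^esub> holonomy_gen G v \<in> covered"
proof -
  have he: "holonomy_gen G u \<otimes>\<^bsub>HL\<^esub> he b \<in> covered" if b: "b \<in> E" "u \<in> carrier V" for u b
    using b(2)
  proof (rule edge_linear_induct[rotated 4])
    show "holonomy_gen G (xe e) \<otimes>\<^bsub>HL\<^esub> he b \<in> covered" if "e \<in> E" for e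
      using covered_he_he[OF that b(1)] by (simp add: he_def)
  qed (use he_closed[OF b(1)] in \<open>simp_all add: holonomy_gen_add holonomy_gen_smult holonomy_gen_zero holonomy_gen_closed
        HL.mult_l_distr HL.smult_mult_l covered_add covered_smult covered_zero\<close>)
  show ?thesis
    using assms(2)
  proof (rule edge_linear_induct[rotated 4])
    show "holonomy_gen G u \<otimes>\<^bsub>HL\<^esub> holonomy_gen G (xe e) \<in> covered" if "e \<in> E" for e
      using he[OF that assms(1)] by (simp add: he_def)
  qed (use holonomy_gen_closed[OF assms(1)] in \<open>simp_all add: holonomy_gen_add holonomy_gen_smult holonomy_gen_zero holonomy_gen_closed
        HL.mult_r_distr HL.smult_mult_r covered_add covered_smult covered_zero\<close>)
qed

text \<open>Every tree maps to a generator or to a covered element. Two generators reduce to edges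
  by bilinearity, a generator acts on a covered element as a linear form acts on its class, and the
  bracket of two covered elements lies in the second derived algebra, so its class is zero.\<close>

lemma covered_Node:
  assumes "set_mag s \<subseteq> carrier V" "set_mag t \<subseteq> carrier V"
  shows "proj (Poly_Mapping.single s 1) \<otimes>\<^bsub>HL\<^esub> proj (Poly_Mapping.single t 1) \<in> covered"
proof -
  have step: "x \<otimes>\<^bsub>HL\<^esub> y \<in> covered"
    if xy: "(\<exists>u\<in>carrier V. x = holonomy_gen G u) \<or> x \<in> covered" "(\<exists>u\<in>carrier V. y = holonomy_gen G u) \<or> y \<in> covered" for x y
  proof -
    consider u v where "u \<in> carrier V" "v \<in> carrier V" "x = holonomy_gen G u" "y = holonomy_gen G v"
      | u where "u \<in> carrier V" "x = holonomy_gen G u" "y \<in> covered"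
      | v where "v \<in> carrier V" "y = holonomy_gen G v" "x \<in> covered" | "x \<in> covered" "y \<in> covered"
      using xy by blast
    then show ?thesis
    proof cases
      case (3 v)
      have "x \<otimes>\<^bsub>HL\<^esub> y = \<ominus>\<^bsub>HL\<^esub> (y \<otimes>\<^bsub>HL\<^esub> x)"
        using HL.mult_anticomm[of y x] 3 covered_carrier holonomy_gen_closed by simp
      then show ?thesis using covered_uminus[OF covered_gen_mult[OF 3(1,3)]] 3(2) by simp
    next
      case 4
      then show ?thesis by (rule covered_D2[OF HL.mult_D2[OF covered_D1 covered_D1]])
    qed (simp_all add: covered_gen_gen covered_gen_mult)
  qed
  have tree: "(\<exists>u\<in>carrier V. proj (Poly_Mapping.single t 1) = holonomy_gen G u) \<or> proj (Poly_Mapping.single t 1) \<in> covered"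
    if "set_mag t \<subseteq> carrier V" for t
    using that
  proof (induction t)
    case (Gen v)
    then show ?case by (auto simp: holonomy_gen_eq)
  next
    case (Node s t)
    have c: "Poly_Mapping.single s 1 \<in> carrier FN" "Poly_Mapping.single t 1 \<in> carrier FN" using Node.prems by auto
    have "proj (Poly_Mapping.single s 1) \<otimes>\<^bsub>HL\<^esub> proj (Poly_Mapping.single t 1) \<in> covered"
      using Node by (intro step) auto
    then show ?case using proj_mult[OF c] by (simp add: free_nonassoc_single_mult)
  qed
  show ?thesis using tree assms by (intro step) auto
qed

lemma covered_mult:
  assumes "x \<in> carrier HL" "y \<in> carrier HL" shows "x \<otimes>\<^bsub>HL\<^esub> y \<in> covered"
proof -
  have single: "Poly_Mapping.single t 1 \<in> carrier FN" if "set_mag t \<subseteq> carrier V" for t using that by simp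
  have left: "{x \<in> carrier HL. x \<otimes>\<^bsub>HL\<^esub> proj (Poly_Mapping.single t 1) \<in> covered} = carrier HL"
    if t: "set_mag t \<subseteq> carrier V" for t
  proof (rule proj_spanning)
    show "submodule {x \<in> carrier HL. x \<otimes>\<^bsub>HL\<^esub> proj (Poly_Mapping.single t 1) \<in> covered} Cx HL"
      by (rule HL.submoduleI) (use proj_closed[OF single[OF t]] in
        \<open>auto simp: HL.mult_l_distr HL.smult_mult_l HL.mult_minus_l covered_add covered_smult covered_uminus covered_zero
          simp del: free_nonassoc_simps\<close>)
    show "proj (Poly_Mapping.single s 1) \<in> {x \<in> carrier HL. x \<otimes>\<^bsub>HL\<^esub> proj (Poly_Mapping.single t 1) \<in> covered}"
      if "set_mag s \<subseteq> carrier V" for s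
      using covered_Node[OF that t] proj_closed[OF single[OF that]] by simp
  qed
  have "{y \<in> carrier HL. x \<otimes>\<^bsub>HL\<^esub> y \<in> covered} = carrier HL"
  proof (rule proj_spanning)
    show "submodule {y \<in> carrier HL. x \<otimes>\<^bsub>HL\<^esub> y \<in> covered} Cx HL"
      by (rule HL.submoduleI) (use assms(1) in
        \<open>auto simp: HL.mult_r_distr HL.smult_mult_r HL.mult_minus_r covered_add covered_smult covered_uminus covered_zero\<close>)
    show "proj (Poly_Mapping.single t 1) \<in> {y \<in> carrier HL. x \<otimes>\<^bsub>HL\<^esub> y \<in> covered}" if "set_mag t \<subseteq> carrier V" for t
      using left[OF that] assms(1) proj_closed[OF single[OF that]] by blast
  qed
  with assms(2) show ?thesis by blast
qed

lemma D1_covered: "HL.D1 \<subseteq> covered"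
  unfolding HL.D1_eq by (rule HL.lin_span_least[OF covered_submodule]) (use covered_mult in blast)

lemma pres_surj:
  assumes "b \<in> carrier B" obtains f where "\<forall>T\<in>triples n. f T \<in> polys E" "b = pres f"
proof -
  obtain z where z: "z \<in> HL.D1" "b = HL.cls z" using assms unfolding B_eq HL.cls_carrier by blast
  then have "z \<in> covered" using D1_covered by blast
  then show ?thesis using z(2) that unfolding covered_def by blast
qed

section \<open>The kernel of the presentation\<close>

definition coord :: "((word \<Rightarrow> word) \<Rightarrow>\<^sub>0 complex) set \<Rightarrow> nat \<times> nat \<Rightarrow> complex"
  where "coord v e = pairing (ue e) v"

abbreviation MK :: "(((word \<Rightarrow> word) \<Rightarrow>\<^sub>0 complex) set mag \<Rightarrow>\<^sub>0 complex) set"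
  where "MK \<equiv> model_kernel n coord (carrier V)"

lemma lie_rels_model_kernel: "lie_rels V \<subseteq> MK"
proof -
  interpret H: module Cx V by (rule H_1_module)
  have lin1: "gen (u \<oplus>\<^bsub>V\<^esub> v) - gen u - gen v \<in> MK" if uv: "u \<in> carrier V" "v \<in> carrier V" for u v
  proof -
    have "gen (u \<oplus>\<^bsub>V\<^esub> v) - gen u - gen v \<in> carrier FN"
      using uv by (intro free_nonassoc_diff_closed gen_closed H.M.a_closed)
    moreover have "mod_V coord (gen (u \<oplus>\<^bsub>V\<^esub> v) - gen u - gen v) e = 0" if "e \<in> E" for e
      using pairing_add[OF ue_H1[OF that] uv] by (simp add: mod_V_linear coord_def)
    ultimately show ?thesis
      unfolding model_kernel_def by (auto simp: mod_S_linear intro!: in_im_zero simp del: edges_iff free_nonassoc_simps)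
  qed
  have lin2: "gen (c \<odot>\<^bsub>V\<^esub> u) - c \<odot>\<^bsub>FN\<^esub> gen u \<in> MK" if u: "u \<in> carrier V" for c u
  proof -
    have "c \<odot>\<^bsub>FN\<^esub> gen u \<in> carrier FN" by (rule FNQ.smult_closed[OF _ gen_closed[OF u]]) simp
    then have "gen (c \<odot>\<^bsub>V\<^esub> u) - c \<odot>\<^bsub>FN\<^esub> gen u \<in> carrier FN"
      using u by (intro free_nonassoc_diff_closed gen_closed H.smult_closed) simp_all
    moreover have "mod_V coord (gen (c \<odot>\<^bsub>V\<^esub> u) - c \<odot>\<^bsub>FN\<^esub> gen u) e = 0" if "e \<in> E" for e
      using pairing_smult[OF ue_H1[OF that] u, of c] by (simp add: mod_V_linear coord_def)
    moreover have "in_im n (mod_S n coord (gen (c \<odot>\<^bsub>V\<^esub> u) - c \<odot>\<^bsub>FN\<^esub> gen u))"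
      by (rule in_im_zero) (simp add: mod_S_linear)
    ultimately show ?thesis
      unfolding model_kernel_def by (simp del: edges_iff free_nonassoc_simps)
  qed
  show ?thesis
    unfolding lie_rels_def Let_def
    by (intro Un_least subsetI; elim CollectE exE conjE; hypsubst;
        intro lin1 lin2 lie_identities_model_kernel; assumption)
qed

lemma pairing_ue_diff:
  assumes "(i, k) \<in> E" "(j, k) \<in> E" "v \<in> carrier V"
  shows "(\<lambda>g\<in>carrier G. ue (i, k) g - ue (j, k) g) \<in> H1_coh G"
    and "pairing (\<lambda>g\<in>carrier G. ue (i, k) g - ue (j, k) g) v = pairing (ue (i, k)) v - pairing (ue (j, k)) v"
proof -
  let ?a = "\<lambda>g\<in>carrier G. ue (i, k) g - ue (j, k) g"
  show a: "?a \<in> H1_coh G"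
    using H1_coh_mult[OF ue_H1[OF assms(1)]] H1_coh_mult[OF ue_H1[OF assms(2)]] by (simp add: H1_coh_def)
  obtain c where c: "supp c \<subseteq> carrier G" "v = boundaries1 G +>\<^bsub>chains1 G\<^esub> c"
    using assms(3) by (auto simp: H_1_carrier)
  have "pm_eval ?a c = pm_eval (ue (i, k)) c - pm_eval (ue (j, k)) c"
    unfolding pm_eval_def sum_subtractf[symmetric] using c(1) by (intro sum.cong) (auto simp: algebra_simps)
  then show "pairing ?a v = pairing (ue (i, k)) v - pairing (ue (j, k)) v"
    using c by (simp only: pairing_coset[OF a] pairing_coset[OF ue_H1[OF assms(1)]] pairing_coset[OF ue_H1[OF assms(2)]])
qed

lemma cup_relation:
  assumes "(i, j) \<in> E" "(j, k) \<in> E" "\<phi> \<in> H2_dual G"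
  shows "\<phi> (cup G (ue (i, j)) (\<lambda>g\<in>carrier G. ue (i, k) g - ue (j, k) g)) = 0"
proof (rule H2_dual_cup_zero[OF assms(3)])
  \<comment> \<open>The coboundary of \<open>- mc3\<close> is
    \<open>u_jk(g) u_ij(h) + u_ij(g) u_ik(h)\<close>, whose first summand has its factors in the
    wrong order. The coboundary of the product of \<open>u_ij\<close> and \<open>u_jk\<close> is
    \<open>- u_ij(g) u_jk(h) - u_jk(g) u_ij(h)\<close>; it removes this summand and supplies the
    missing one.\<close>
  let ?c = "\<lambda>g. mc2 i j g * mc2 j k g - mc3 i j k g"
  fix g h assume gh: "g \<in> carrier G" "h \<in> carrier G"
  have "mc2 i j (g \<otimes>\<^bsub>G\<^esub> h) = mc2 i j g + mc2 i j h" "mc2 j k (g \<otimes>\<^bsub>G\<^esub> h) = mc2 j k g + mc2 j k h"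
    using gh assms by (simp_all add: upper_McCool_mc2_mult del: edges_iff)
  then show "ue (i, j) g * (\<lambda>g\<in>carrier G. ue (i, k) g - ue (j, k) g) h = ?c h - ?c (g \<otimes>\<^bsub>G\<^esub> h) + ?c g"
    using gh upper_McCool_mc3_mult[OF assms(1,2) gh] by (simp add: ue_def algebra_simps)
qed

text \<open>The component of the model at \<open>(i, j, k)\<close> pairs the wedge with
  \<open>u_ij \<and> (u_ik - u_jk)\<close>. For an element of the image of \<partial> this is the
  value of \<phi> on a cup product that is a coboundary, hence zero. So these relations hold in the
  model exactly, not merely modulo the columns.\<close>

lemma wedge_lift_model_kernel:
  assumes "ws \<in> wedge_rels" shows "wedge_lift ws \<in> MK"
proof -
  obtain \<phi> where \<phi>: "\<phi> \<in> H2_dual G" and rep: "represents_dual_cup G \<phi> ws" using assms by (auto simp: wedge_rels_def)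
  have ws: "set ws \<subseteq> carrier V \<times> carrier V" using wedge_rels_closed[OF assms] .
  have V0: "mod_V coord (wedge_lift ws) e = 0" for e
    by (induction ws) (auto simp: wedge_lift_def mod_V_linear)
  have "mod_S n coord (wedge_lift ws) T = 0" if T: "T \<in> triples n" for T
  proof -
    obtain i j k where ijk: "T = (i, j, k)" by (cases T)
    have e: "(i, j) \<in> E" "(j, k) \<in> E" "(i, k) \<in> E" using T ijk by auto
    let ?a = "ue (i, j)"
    define b where "b = (\<lambda>g\<in>carrier G. ue (i, k) g - ue (j, k) g)"
    note pb = pairing_ue_diff(2)[OF e(3,2), folded b_def]
    have "mod_S n coord (wedge_lift ws) T =
      const_poly (\<Sum>(u, v)\<leftarrow>ws. pairing ?a u * pairing b v - pairing ?a v * pairing b u)"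
      using ws
    proof (induction ws)
      case (Cons w ws)
      obtain u v where w: "w = (u, v)" "u \<in> carrier V" "v \<in> carrier V" using Cons.prems by (cases w) auto
      have "mod_S n coord (wedge_lift (w # ws)) T = beta (mag_V coord (Gen u)) (mag_V coord (Gen v)) T + mod_S n coord (wedge_lift ws) T"
        by (simp add: wedge_lift_def w(1) mod_S_linear)
      also have "beta (mag_V coord (Gen u)) (mag_V coord (Gen v)) T = const_poly (pairing ?a u * pairing b v - pairing ?a v * pairing b u)"
        by (simp add: ijk pb[OF w(2)] pb[OF w(3)] coord_def algebra_simps)
      finally show ?case using Cons w(1) by simp
    qed (simp add: wedge_lift_def mod_S_linear)
    also have "(\<Sum>(u, v)\<leftarrow>ws. pairing ?a u * pairing b v - pairing ?a v * pairing b u) = \<phi> (cup G ?a b)"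
    proof -
      interpret H: module Cx V by (rule H_1_module)
      show ?thesis
        using rep ue_H1[OF e(1)] pairing_ue_diff(1)[OF e(3,2) H.M.zero_closed, folded b_def] unfolding represents_dual_cup_def by simp
    qed
    also have "\<dots> = 0" unfolding b_def by (rule cup_relation[OF e(1,2) \<phi>])
    finally show ?thesis by simp
  qed
  then show ?thesis
    unfolding model_kernel_def using V0 wedge_to_lie_eq(1)[OF ws] by (auto intro: in_im_zero simp del: free_nonassoc_simps)
qed

lemma proj_zero_model_kernel: "p \<in> carrier FN \<Longrightarrow> proj p = \<zero>\<^bsub>HL\<^esub> \<Longrightarrow> p \<in> MK"
  by (rule proj_zero_in_ideal[OF model_kernel_ideal lie_rels_model_kernel wedge_lift_model_kernel])

text \<open>Some lift of the class \<open>b\<close> to the free non-associative algebra has model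
  value \<open>(0, m)\<close>. This is a relation and not a function because \<open>m\<close> is
  determined by \<open>b\<close> only modulo the columns.\<close>

definition represents :: "(word \<Rightarrow> word) lieH1 set set \<Rightarrow> (triple \<Rightarrow> (nat \<times> nat) cpoly) \<Rightarrow> bool"
  where "represents b m \<longleftrightarrow> (\<exists>a\<in>carrier FN. (\<forall>e\<in>E. mod_V coord a e = 0) \<and> proj a \<in> HL.D1 \<and>
    b = HL.cls (proj a) \<and> (\<forall>T\<in>triples n. mod_S n coord a T = m T))"

lemma FN_add_closed: "a \<in> carrier FN \<Longrightarrow> b \<in> carrier FN \<Longrightarrow> a + b \<in> carrier FN"
  using FNQ.M.a_closed[of a b] by (simp only: free_nonassoc_simps(2))

lemma FN_scale_closed: "a \<in> carrier FN \<Longrightarrow> pm_scale c a \<in> carrier FN"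
  using FNQ.smult_closed[of c a] by (simp only: free_nonassoc_simps(4) Cx_simps UNIV_I)

lemma FN_zero_closed: "0 \<in> carrier FN"
  by simp

lemma represents_closed: "represents b m \<Longrightarrow> b \<in> carrier B"
  unfolding represents_def B_eq using HL.cls_closed by blast

lemma represents_cong: "represents b m \<Longrightarrow> (\<And>T. T \<in> triples n \<Longrightarrow> m T = m' T) \<Longrightarrow> represents b m'"
  unfolding represents_def by simp

lemma represents_zero: "represents \<zero>\<^bsub>B\<^esub> (\<lambda>T. 0)"
  unfolding represents_def
  by (rule bexI[OF _ FN_zero_closed])
    (simp add: mod_V_linear mod_S_linear proj_zero cls_zero HL.submodule_zero[OF HL.D1_submodule])

lemma represents_add:
  assumes "represents b m" "represents b' m'" shows "represents (b \<oplus>\<^bsub>B\<^esub> b') (\<lambda>T. m T + m' T)"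
proof -
  obtain a where a: "a \<in> carrier FN" "\<forall>e\<in>E. mod_V coord a e = 0" "proj a \<in> HL.D1" "b = HL.cls (proj a)"
    "\<forall>T\<in>triples n. mod_S n coord a T = m T" using assms(1) unfolding represents_def by blast
  obtain a' where a': "a' \<in> carrier FN" "\<forall>e\<in>E. mod_V coord a' e = 0" "proj a' \<in> HL.D1" "b' = HL.cls (proj a')"
    "\<forall>T\<in>triples n. mod_S n coord a' T = m' T" using assms(2) unfolding represents_def by blast
  have p: "proj (a + a') = proj a \<oplus>\<^bsub>HL\<^esub> proj a'" using proj_add[OF a(1) a'(1)] by simp
  have "proj (a + a') \<in> HL.D1" using HL.D.M.a_closed[OF a(3) a'(3)] by (simp add: p HL.D1_simps)
  moreover have "b \<oplus>\<^bsub>B\<^esub> b' = HL.cls (proj (a + a'))" using HL.cls_add[OF a(3) a'(3)] a(4) a'(4) by (simp add: p B_eq)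
  ultimately show ?thesis
    unfolding represents_def using a a'
    by (intro bexI[OF _ FN_add_closed[OF a(1) a'(1)]]) (simp add: mod_V_linear mod_S_linear)
qed

lemma represents_smult:
  assumes "represents b m" shows "represents (c \<odot>\<^bsub>B\<^esub> b) (\<lambda>T. const_poly c * m T)"
proof -
  obtain a where a: "a \<in> carrier FN" "\<forall>e\<in>E. mod_V coord a e = 0" "proj a \<in> HL.D1" "b = HL.cls (proj a)"
    "\<forall>T\<in>triples n. mod_S n coord a T = m T" using assms unfolding represents_def by blast
  have p: "proj (pm_scale c a) = c \<odot>\<^bsub>HL\<^esub> proj a" using proj_smult[OF a(1)] by simp
  have "proj (pm_scale c a) \<in> HL.D1" using HL.D.smult_closed[OF _ a(3), of c] by (simp add: p HL.D1_simps)
  moreover have "c \<odot>\<^bsub>B\<^esub> b = HL.cls (proj (pm_scale c a))" using HL.cls_smult[OF a(3), of c] a(4) by (simp add: p B_eq)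
  ultimately show ?thesis
    unfolding represents_def using a
    by (intro bexI[OF _ FN_scale_closed[OF a(1), of c]]) (simp add: mod_V_linear mod_S_linear)
qed

lemma mag_V_xe:
  assumes "e \<in> E" "f \<in> E" shows "mag_V coord (Gen (xe e)) f = delta e f"
  using pairing_ue_xe[OF assms(2,1)] by (auto simp: coord_def delta_def)

lemma mod_V_gen: "mod_V \<kappa> (gen v) = mag_V \<kappa> (Gen v)"
  by (rule ext) (simp add: mod_V_linear)

lemma lin_xe: "e \<in> E \<Longrightarrow> lin n (mag_V coord (Gen (xe e))) = poly_var e"
  using lin_delta[of e n] by (simp add: lin_def mag_V_xe del: mag_V.simps cong: sum.cong)

lemma represents_var:
  assumes e: "e \<in> E" and "represents b m"
  shows "represents (A.act (poly_var e) b) (\<lambda>T. poly_var e * m T)"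
proof -
  obtain a where a: "a \<in> carrier FN" "\<forall>e\<in>E. mod_V coord a e = 0" "proj a \<in> HL.D1" "b = HL.cls (proj a)"
    "\<forall>T\<in>triples n. mod_S n coord a T = m T" using assms(2) unfolding represents_def by blast
  have a0: "mod_V coord a e = 0" if "e \<in> E" for e using a(2) that by blast
  note g = gen_closed[OF xe_closed[OF e]]
  let ?a = "gen (xe e) \<otimes>\<^bsub>FN\<^esub> a"
  have p: "proj ?a = he e \<otimes>\<^bsub>HL\<^esub> proj a" using proj_mult[OF g a(1)] by (simp add: he_def holonomy_gen_eq)
  have "proj ?a \<in> HL.D1" unfolding p by (rule HL.mult_D1[OF he_closed[OF e] proj_closed[OF a(1)]])
  moreover have "A.act (poly_var e) b = HL.cls (proj ?a)" using act_var_cls[OF e a(3)] a(4) by (simp add: p)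
  moreover have "mod_S n coord ?a T = poly_var e * m T" if "T \<in> triples n" for T
    using a(5) that by (simp add: mod_S_mult mod_V_gen lin_xe[OF e] lin_zero[OF a0] beta_zero[OF that a0] del: mag_V.simps)
  ultimately show ?thesis
    unfolding represents_def by (intro bexI[OF _ FNQ.mult_closed[OF g a(1)]]) (simp add: mod_V_mult)
qed

lemma represents_gT:
  assumes T: "T \<in> triples n" shows "represents (gT T) (unit_vec T)"
proof -
  obtain i j k where ijk: "T = (i, j, k)" by (cases T)
  have e: "(i, j) \<in> E" "(i, k) \<in> E" using T ijk by auto
  note g = gen_closed[OF xe_closed[OF e(1)]] gen_closed[OF xe_closed[OF e(2)]]
  let ?a = "gen (xe (i, j)) \<otimes>\<^bsub>FN\<^esub> gen (xe (i, k))"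
  have p: "proj ?a = he (i, j) \<otimes>\<^bsub>HL\<^esub> he (i, k)" using proj_mult[OF g] by (simp add: he_def holonomy_gen_eq)
  have "proj ?a \<in> HL.D1" unfolding p by (rule HL.mult_D1[OF he_closed[OF e(1)] he_closed[OF e(2)]])
  moreover have "mod_S n coord ?a T' = unit_vec T T'" if T': "T' \<in> triples n" for T'
  proof -
    have "beta (mag_V coord (Gen (xe (i, j)))) (mag_V coord (Gen (xe (i, k)))) T' = beta (delta (i, j)) (delta (i, k)) T'"
      using T' by (cases T') (simp add: mag_V_xe[OF e(1)] mag_V_xe[OF e(2)] del: mag_V.simps)
    also have "\<dots> = unit_vec T T'" using beta_delta[OF T' e] T ijk by simp
    finally show ?thesis by (simp add: mod_S_mult mod_V_gen mod_S_linear del: mag_V.simps)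
  qed
  ultimately show ?thesis
    unfolding represents_def by (intro bexI[OF _ FNQ.mult_closed[OF g]]) (simp add: mod_V_mult p gT_def ijk)
qed

lemma represents_act:
  assumes "p \<in> polys E" "represents b m" shows "represents (A.act p b) (\<lambda>T. p * m T)"
  using assms(1)
proof (induction p rule: polys_induct)
  case (const c)
  then show ?case using represents_smult[OF assms(2)] A.act_const[OF represents_closed[OF assms(2)]] by simp
next
  case (add p q)
  then show ?case using represents_add[OF add] A.act_add_left[OF represents_closed[OF assms(2)]]
    by (simp add: distrib_right)
next
  case (var e p)
  then show ?case using represents_var[OF var(1,3)] A.act_mult[OF represents_closed[OF assms(2)]]
    by (simp add: mult.assoc)
qed

text \<open>The model sends the generator at a triple to the corresponding basis vector, and a
  bracket with an edge class becomes multiplication by its variable. Hence the coefficient vector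
  \<open>f\<close> is recovered from its image under \<open>pres\<close>.\<close>

lemma represents_pres:
  assumes "\<And>T. T \<in> triples n \<Longrightarrow> f T \<in> polys E" shows "represents (pres f) f"
proof -
  have "represents (\<Oplus>\<^bsub>B\<^esub>T\<in>S. A.act (f T) (gT T)) (\<lambda>T'. \<Sum>T\<in>S. f T * unit_vec T T')" if "finite S" "S \<subseteq> triples n" for S
    using that
  proof (induction S rule: finite_induct)
    case empty
    then show ?case using represents_zero by simp
  next
    case (insert T S)
    have c: "A.act (f T') (gT T') \<in> carrier B" if "T' \<in> insert T S" for T'
      using gT_closed insert.prems that by (intro A.act_closed) blast
    have "represents (A.act (f T) (gT T)) (\<lambda>T'. f T * unit_vec T T')"
      using insert.prems assms by (intro represents_act represents_gT) auto
    from represents_add[OF this insert.IH] show ?case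
      using insert c by (simp add: A.M.finsum_insert Pi_def)
  qed
  from this[of "triples n"] show ?thesis unfolding pres_def
  proof (rule represents_cong)
    show "(\<Sum>T\<in>triples n. f T * unit_vec T T') = f T'" if "T' \<in> triples n" for T'
    proof -
      have "(\<Sum>T\<in>triples n. f T * unit_vec T T') = (\<Sum>T\<in>triples n. if T = T' then f T else 0)"
        by (intro sum.cong) (auto simp: unit_vec_def)
      with that show ?thesis by simp
    qed
  qed simp_all
qed

text \<open>The derived algebra is spanned by images of products, and products of formal sums of
  trees have no component in \<open>V\<close>.\<close>

lemma D1_lift:
  assumes "z \<in> HL.D1" shows "\<exists>a\<in>carrier FN. (\<forall>e\<in>E. mod_V coord a e = 0) \<and> proj a = z"
proof -
  define W where "W = {z \<in> carrier HL. \<exists>a\<in>carrier FN. (\<forall>e\<in>E. mod_V coord a e = 0) \<and> proj a = z}"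
  have W_I: "proj a \<in> W" if "a \<in> carrier FN" "\<forall>e\<in>E. mod_V coord a e = 0" for a
    unfolding W_def using that proj_closed by blast
  have W_E: "\<exists>a\<in>carrier FN. (\<forall>e\<in>E. mod_V coord a e = 0) \<and> proj a = z" if "z \<in> W" for z
    using that unfolding W_def by blast
  have W_carrier: "W \<subseteq> carrier HL" unfolding W_def by blast
  have add: "x \<oplus>\<^bsub>HL\<^esub> y \<in> W" if xy: "x \<in> W" "y \<in> W" for x y
  proof -
    obtain a b where "a \<in> carrier FN" "\<forall>e\<in>E. mod_V coord a e = 0" "proj a = x" "b \<in> carrier FN" "\<forall>e\<in>E. mod_V coord b e = 0" "proj b = y"
      using xy[THEN W_E] by blast
    then show ?thesis using W_I[of "a + b"] FN_add_closed[of a b] proj_add[of a b]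
      by (simp add: mod_V_linear del: free_nonassoc_simps)
  qed
  have smult: "c \<odot>\<^bsub>HL\<^esub> x \<in> W" if x: "x \<in> W" for c x
  proof -
    obtain a where "a \<in> carrier FN" "\<forall>e\<in>E. mod_V coord a e = 0" "proj a = x" using W_E[OF x] by blast
    then show ?thesis using W_I[of "pm_scale c a"] FN_scale_closed[of a c] proj_smult[of a c]
      by (simp add: mod_V_linear del: free_nonassoc_simps)
  qed
  have "submodule W Cx HL"
  proof (rule HL.submoduleI[OF W_carrier])
    show "\<zero>\<^bsub>HL\<^esub> \<in> W" using W_I[OF FN_zero_closed] by (simp add: proj_zero mod_V_linear)
  next
    fix x assume x: "x \<in> W"
    have "(- 1) \<odot>\<^bsub>HL\<^esub> x \<in> W" by (rule smult[OF x])
    then show "\<ominus>\<^bsub>HL\<^esub> x \<in> W" unfolding HL.smult_minus_one[OF subsetD[OF W_carrier x]] .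
  qed (rule add smult, assumption+)+
  then have "HL.D1 \<subseteq> W" unfolding HL.D1_eq
  proof (rule HL.lin_span_least)
    show "{x \<otimes>\<^bsub>HL\<^esub> y | x y. x \<in> carrier HL \<and> y \<in> carrier HL} \<subseteq> W"
    proof
      fix w assume "w \<in> {x \<otimes>\<^bsub>HL\<^esub> y | x y. x \<in> carrier HL \<and> y \<in> carrier HL}"
      then obtain a b where ab: "a \<in> carrier FN" "b \<in> carrier FN" "w = proj a \<otimes>\<^bsub>HL\<^esub> proj b" unfolding HL_carrier by blast
      then have "w = proj (a \<otimes>\<^bsub>FN\<^esub> b)" by (simp add: proj_mult del: free_nonassoc_simps)
      moreover have "\<forall>e\<in>E. mod_V coord (a \<otimes>\<^bsub>FN\<^esub> b) e = 0" by (simp add: mod_V_mult)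
      ultimately show "w \<in> W" using W_I[OF FNQ.mult_closed[OF ab(1,2)]] by simp
    qed
  qed
  with assms show ?thesis by (intro W_E) blast
qed

lemma model_kernel_module_closed:
  "a \<in> MK \<Longrightarrow> a \<in> carrier FN" "0 \<in> MK" "a \<in> MK \<Longrightarrow> b \<in> MK \<Longrightarrow> a + b \<in> MK" "a \<in> MK \<Longrightarrow> pm_scale c a \<in> MK"
proof -
  note S = conjunct1[OF model_kernel_ideal[unfolded alg_ideal_of_def], of n coord "carrier V"]
  show "a \<in> MK \<Longrightarrow> a \<in> carrier FN" by (simp add: model_kernel_def)
  show "0 \<in> MK" using FNQ.submodule_zero[OF S] by simp
  show "a \<in> MK \<Longrightarrow> b \<in> MK \<Longrightarrow> a + b \<in> MK" using FNQ.submoduleE(5)[OF S] by simp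
  show "a \<in> MK \<Longrightarrow> pm_scale c a \<in> MK" using FNQ.submoduleE(4)[OF S, of c a] by simp
qed

text \<open>The part \<open>S^T\<close> of the model is abelian: if both factors have no component
  in \<open>V\<close>, then the linear forms and the 2-form vanish, and so does the product. Thus
  the second derived algebra is trivial in the model.\<close>

lemma D2_lift:
  assumes "z \<in> HL.D2" shows "\<exists>k\<in>MK. proj k = z"
proof -
  have "z \<in> {z \<in> HL.D1. \<exists>k\<in>MK. proj k = z}"
  proof (rule HL.D2_induct[OF _ _ assms], rule HL.derived_submoduleI)
    show "\<zero>\<^bsub>HL\<^esub> \<in> {z \<in> HL.D1. \<exists>k\<in>MK. proj k = z}"
      using HL.submodule_zero[OF HL.D1_submodule] proj_zero model_kernel_module_closed(2) by blast
  next
    fix x y assume *: "x \<in> {z \<in> HL.D1. \<exists>k\<in>MK. proj k = z}" "y \<in> {z \<in> HL.D1. \<exists>k\<in>MK. proj k = z}"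
    then obtain k l where kl: "k \<in> MK" "proj k = x" "l \<in> MK" "proj l = y" by blast
    have "proj (k + l) = x \<oplus>\<^bsub>HL\<^esub> y"
      using proj_add[OF model_kernel_module_closed(1)[OF kl(1)] model_kernel_module_closed(1)[OF kl(3)]] kl by simp
    moreover have "x \<oplus>\<^bsub>HL\<^esub> y \<in> HL.D1" using * HL.D.M.a_closed[of x y] by (simp add: HL.D1_simps)
    ultimately show "x \<oplus>\<^bsub>HL\<^esub> y \<in> {z \<in> HL.D1. \<exists>k\<in>MK. proj k = z}"
      using model_kernel_module_closed(3)[OF kl(1,3)] by blast
  next
    fix c x assume *: "x \<in> {z \<in> HL.D1. \<exists>k\<in>MK. proj k = z}"
    then obtain k where k: "k \<in> MK" "proj k = x" by blast
    have "proj (pm_scale c k) = c \<odot>\<^bsub>HL\<^esub> x" using proj_smult[OF model_kernel_module_closed(1)[OF k(1)]] k by simp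
    moreover have "c \<odot>\<^bsub>HL\<^esub> x \<in> HL.D1" using * HL.D.smult_closed[of c x] by (simp add: HL.D1_simps)
    ultimately show "c \<odot>\<^bsub>HL\<^esub> x \<in> {z \<in> HL.D1. \<exists>k\<in>MK. proj k = z}"
      using model_kernel_module_closed(4)[OF k(1)] by blast
  next
    fix x y assume xy: "x \<in> HL.D1" "y \<in> HL.D1"
    obtain a b where a: "a \<in> carrier FN" "\<forall>e\<in>E. mod_V coord a e = 0" "proj a = x"
      and b: "b \<in> carrier FN" "\<forall>e\<in>E. mod_V coord b e = 0" "proj b = y" using D1_lift xy by blast
    have a0: "mod_V coord a e = 0" "mod_V coord b e = 0" if "e \<in> E" for e using a(2) b(2) that by blast+
    have "in_im n (mod_S n coord (a \<otimes>\<^bsub>FN\<^esub> b))"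
      by (rule in_im_zero) (simp add: mod_S_mult lin_zero[OF a0(1)] lin_zero[OF a0(2)] beta_zero[OF _ a0(1)])
    then have "a \<otimes>\<^bsub>FN\<^esub> b \<in> MK"
      unfolding model_kernel_def using FNQ.mult_closed[OF a(1) b(1)] by (simp add: mod_V_mult del: free_nonassoc_simps)
    moreover have "proj (a \<otimes>\<^bsub>FN\<^esub> b) = x \<otimes>\<^bsub>HL\<^esub> y" using proj_mult[OF a(1) b(1)] a(3) b(3) by simp
    ultimately show "x \<otimes>\<^bsub>HL\<^esub> y \<in> {z \<in> HL.D1. \<exists>k\<in>MK. proj k = z}"
      using HL.mult_D1[OF HL.D1_subset[OF xy(1)] HL.D1_subset[OF xy(2)]] by blast
  qed auto
  then show ?thesis by blast
qed

text \<open>Take a lift \<open>a\<close> with model value \<open>(0, f)\<close>. Its image lies in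
  the second derived algebra and therefore also has a lift \<open>k\<close> in the model kernel. The
  difference of the two lifts maps to zero in the holonomy Lie algebra, so it lies in the model
  kernel as well. Then \<open>a\<close> does, which says that \<open>f\<close> is in the image of
  the matrix.\<close>

lemma pres_zero_in_im:
  assumes f: "\<And>T. T \<in> triples n \<Longrightarrow> f T \<in> polys E" and "pres f = \<zero>\<^bsub>B\<^esub>" shows "in_im n f"
proof -
  obtain b where b: "b = \<zero>\<^bsub>B\<^esub>" by simp
  have "represents b f" unfolding b assms(2)[symmetric] using f by (rule represents_pres)
  then obtain a where a: "a \<in> carrier FN" "\<forall>e\<in>E. mod_V coord a e = 0" "proj a \<in> HL.D1" "b = HL.cls (proj a)"
    "\<forall>T\<in>triples n. mod_S n coord a T = f T" unfolding represents_def by blast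
  have "HL.cls (proj a) = \<zero>\<^bsub>B\<^esub>" using a(4) b by (rule subst)
  then have "proj a \<in> HL.D2" unfolding B_eq by (rule iffD1[OF HL.cls_eq_zero_iff[OF a(3)]])
  then obtain k where k: "k \<in> MK" "proj k = proj a" using D2_lift by blast
  note kc = model_kernel_module_closed(1)[OF k(1)]
  have mk: "pm_scale (- 1) k \<in> carrier FN" by (rule FN_scale_closed[OF kc])
  have s: "proj (a + pm_scale (- 1) k) = proj a \<oplus>\<^bsub>HL\<^esub> (- 1) \<odot>\<^bsub>HL\<^esub> proj k"
    using proj_add[OF a(1) mk] proj_smult[OF kc, of "- 1"] by simp
  have "proj (a + pm_scale (- 1) k) = \<zero>\<^bsub>HL\<^esub>"
    unfolding s k(2) HL.smult_minus_one[OF proj_closed[OF a(1)]] by (rule HL.M.r_neg[OF proj_closed[OF a(1)]])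
  then have "a + pm_scale (- 1) k \<in> MK" by (rule proj_zero_model_kernel[OF FN_add_closed[OF a(1) mk]])
  then have "(a + pm_scale (- 1) k) + k \<in> MK" using k(1) by (rule model_kernel_module_closed(3))
  moreover have "(a + pm_scale (- 1) k) + k = a"
    by (rule poly_mapping_eqI) (simp add: lookup_add)
  ultimately have "in_im n (mod_S n coord a)" by (simp add: model_kernel_def)
  then show ?thesis by (rule in_im_cong) (use a(5) in blast)
qed

end

section \<open>The matrix as a map of polynomial modules, and minimality\<close>

lemma polys_Psi:
  assumes "T' \<in> triples n" "x \<in> columns n" shows "Psi n T' x \<in> polys (edges n)"
proof -
  obtain T q where x: "x = (T, q)" by (cases x)
  let ?e = "labels n T ! q"
  have T: "T \<in> triples n" and e: "?e \<in> set (labels n T)" using columns_label assms(2) x by auto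
  obtain i j k where ijk: "T = (i, j, k)" by (cases T)
  obtain s t where st: "?e = (s, t)" by (cases ?e)
  have u: "unit_vec T1 T' \<in> polys (edges n)" for T1 by (simp add: unit_vec_def)
  have v: "x_var j k \<in> polys (edges n)" "x_var i k \<in> polys (edges n)" using T ijk by auto
  have "(s, t) \<in> edges n" "s = k \<longrightarrow> t < k"
    using e T unfolding ijk st[unfolded ijk] labels_iff[OF T[unfolded ijk]] by auto
  then have "diag_entry (i, j, k) (s, t) \<in> polys (edges n)" using T ijk v by (auto intro!: polys_add)
  moreover have "off_diag (i, j, k) (s, t) T' \<in> polys (edges n)"
    using u v by (auto intro!: polys_mult polys_uminus)
  ultimately show ?thesis
    unfolding Psi_def x prod.case ijk st[unfolded ijk] colvec_def using u by (intro polys_add polys_mult)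
qed

text \<open>The map given by the matrix, with coefficients that may be arbitrary outside
  \<open>columns n\<close>; this makes sums and multiples of coefficient functions pointwise
  operations.\<close>

definition col_comb :: "nat \<Rightarrow> (triple \<times> nat \<Rightarrow> (nat \<times> nat) cpoly) \<Rightarrow> triple \<Rightarrow> (nat \<times> nat) cpoly"
  where "col_comb n c = (\<lambda>T\<in>triples n. \<Sum>x\<in>columns n. Psi n T x * c x)"

lemma mat_map_Psi:
  assumes "\<And>x. x \<in> columns n \<Longrightarrow> c x \<in> polys (edges n)"
  shows "mat_map (S_ring n) (triples n) (columns n) (Psi n) c = col_comb n c"
  unfolding mat_map_def col_comb_def S_ring_def
  by (intro restrict_ext, subst poly_ring_finsum) (auto intro!: polys_mult polys_Psi assms simp del: triples_iff)

lemma mat_map_image: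
  "mat_map (S_ring n) (triples n) (columns n) (Psi n) ` carrier (fun_module (S_ring n) (columns n)) =
    col_comb n ` {c. \<forall>x\<in>columns n. c x \<in> polys (edges n)}" (is "?L = ?R")
proof
  show "?L \<subseteq> ?R"
  proof
    fix m assume "m \<in> ?L"
    then obtain c where c: "c \<in> columns n \<rightarrow>\<^sub>E polys (edges n)" "m = mat_map (S_ring n) (triples n) (columns n) (Psi n) c"
      by (auto simp: S_ring_def)
    then have "\<forall>x\<in>columns n. c x \<in> polys (edges n)" by (auto dest: PiE_mem)
    then show "m \<in> ?R" using mat_map_Psi[of n c] c(2) by blast
  qed
  show "?R \<subseteq> ?L"
  proof
    fix m assume "m \<in> ?R"
    then obtain c where c: "\<forall>x\<in>columns n. c x \<in> polys (edges n)" "m = col_comb n c" by blast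
    have "col_comb n c = col_comb n (restrict c (columns n))" by (simp add: col_comb_def)
    then have "m = mat_map (S_ring n) (triples n) (columns n) (Psi n) (restrict c (columns n))"
      using mat_map_Psi[of n "restrict c (columns n)"] c by simp
    moreover have "restrict c (columns n) \<in> carrier (fun_module (S_ring n) (columns n))" using c(1) by (simp add: S_ring_def)
    ultimately show "m \<in> ?L" by blast
  qed
qed

lemma coef_sum: "coef (sum f A) m = (\<Sum>a\<in>A. coef (f a) m)"
  by (rule lookup_sum)

lemma Psi_no_constant: "coef (Psi n T x) 0 = 0"
  by (cases x) (simp add: Psi_def colvec_no_constant)

lemma in_im_no_constant:
  assumes "in_im n m" "T \<in> triples n" shows "coef (m T) 0 = 0"
  using assms by (auto simp: in_im_def coef_sum coef_mult Psi_no_constant simp del: triples_iff)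

text \<open>The entries of the matrix have no constant term, so the linear coefficients of a
  combination of columns see only the constant terms of its coefficients. These are determined
  because the columns are linearly independent over \<complex>.\<close>

lemma col_comb_eq_const:
  assumes eq: "col_comb n c = col_comb n c'" and x: "x \<in> columns n"
  shows "coef (c x) 0 = coef (c' x) 0"
proof -
  have "coef (c x) 0 - coef (c' x) 0 = 0"
  proof (rule columns_independent[OF _ x, where c = "\<lambda>x. coef (c x) 0 - coef (c' x) 0"])
    fix T v assume T: "T \<in> triples n"
    have "(\<Sum>x\<in>columns n. Psi n T x * c x) = (\<Sum>x\<in>columns n. Psi n T x * c' x)"
      using fun_cong[OF eq, of T] T by (simp add: col_comb_def del: triples_iff)
    then have "var_coeff (\<Sum>x\<in>columns n. Psi n T x * c x) v = var_coeff (\<Sum>x\<in>columns n. Psi n T x * c' x) v" by simp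
    then show "(\<Sum>x\<in>columns n. var_coeff (Psi n T x) v * (coef (c x) 0 - coef (c' x) 0)) = 0"
      unfolding coef_sum coef_mult(2) by (simp add: Psi_no_constant right_diff_distrib sum_subtractf del: One_nat_def)
  qed
  then show ?thesis by simp
qed

text \<open>The combinations whose coefficient at \<open>y\<close> has no constant term form a
  submodule that contains every other column. By \<open>col_comb_eq_const\<close> the column
  \<open>y\<close>, whose coefficient at \<open>y\<close> is 1, does not belong to it. This argument
  takes the place of a graded Nakayama lemma.\<close>

lemma columns_not_redundant:
  assumes y: "y \<in> columns n"
  shows "lin_span (S_ring n) (fun_module (S_ring n) (triples n)) (mat_col (triples n) (Psi n) ` (columns n - {y}))
    \<noteq> mat_map (S_ring n) (triples n) (columns n) (Psi n) ` carrier (fun_module (S_ring n) (columns n))"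
proof -
  interpret FM: module "S_ring n" "fun_module (S_ring n) (triples n)"
    unfolding S_ring_def by (intro fun_module_module poly_ring_cring)
  let ?C = "{c. (\<forall>x\<in>columns n. c x \<in> polys (edges n)) \<and> coef (c y) 0 = 0}"
  let ?N = "col_comb n ` ?C"
  let ?ind = "\<lambda>z x. if x = z then 1 else (0 :: (nat \<times> nat) cpoly)"
  have closed: "col_comb n c \<in> carrier (fun_module (S_ring n) (triples n))" if "\<forall>x\<in>columns n. c x \<in> polys (edges n)" for c
    using that by (auto simp: col_comb_def S_ring_def intro!: polys_sum polys_mult polys_Psi simp del: triples_iff)
  have add: "col_comb n c \<oplus>\<^bsub>fun_module (S_ring n) (triples n)\<^esub> col_comb n d = col_comb n (\<lambda>x. c x + d x)" for c d
    by (auto simp: col_comb_def S_ring_def distrib_left sum.distrib intro!: restrict_ext)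
  have smult: "p \<odot>\<^bsub>fun_module (S_ring n) (triples n)\<^esub> col_comb n c = col_comb n (\<lambda>x. p * c x)" for p c
    by (auto simp: col_comb_def S_ring_def sum_distrib_left mult.left_commute intro!: restrict_ext)
  have zero: "\<zero>\<^bsub>fun_module (S_ring n) (triples n)\<^esub> = col_comb n (\<lambda>x. 0)"
    by (auto simp: col_comb_def S_ring_def intro!: restrict_ext)
  have "submodule ?N (S_ring n) (fun_module (S_ring n) (triples n))"
  proof (rule FM.submoduleI)
    show "?N \<subseteq> carrier (fun_module (S_ring n) (triples n))" using closed by blast
    show "\<zero>\<^bsub>fun_module (S_ring n) (triples n)\<^esub> \<in> ?N" unfolding zero by (rule imageI) simp
  next
    fix m assume "m \<in> ?N"
    then obtain c where c: "c \<in> ?C" "m = col_comb n c" by blast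
    have "(\<lambda>x. - c x) \<in> ?C" using c(1) by (auto intro: polys_uminus)
    moreover have "\<ominus>\<^bsub>fun_module (S_ring n) (triples n)\<^esub> m = col_comb n (\<lambda>x. - c x)"
    proof (rule FM.M.minus_equality)
      show "col_comb n (\<lambda>x. - c x) \<oplus>\<^bsub>fun_module (S_ring n) (triples n)\<^esub> m = \<zero>\<^bsub>fun_module (S_ring n) (triples n)\<^esub>"
        unfolding c(2) add zero by simp
    qed (use c closed[of "\<lambda>x. - c x"] closed[of c] in \<open>auto intro: polys_uminus simp del: fun_module_simps\<close>)
    ultimately show "\<ominus>\<^bsub>fun_module (S_ring n) (triples n)\<^esub> m \<in> ?N" by blast
  next
    fix m m' assume "m \<in> ?N" "m' \<in> ?N"
    then obtain c d where c: "c \<in> ?C" "m = col_comb n c" "d \<in> ?C" "m' = col_comb n d" by blast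
    have "(\<lambda>x. c x + d x) \<in> ?C" using c(1,3) by (auto simp: lookup_add)
    then show "m \<oplus>\<^bsub>fun_module (S_ring n) (triples n)\<^esub> m' \<in> ?N" unfolding c(2,4) add by (rule imageI)
  next
    fix p m assume p: "p \<in> carrier (S_ring n)" and "m \<in> ?N"
    then obtain c where c: "c \<in> ?C" "m = col_comb n c" by blast
    have "(\<lambda>x. p * c x) \<in> ?C" using c(1) p by (auto simp: coef_mult S_ring_def)
    then show "p \<odot>\<^bsub>fun_module (S_ring n) (triples n)\<^esub> m \<in> ?N" unfolding c(2) smult by (rule imageI)
  qed
  moreover have col: "mat_col (triples n) (Psi n) z = col_comb n (?ind z)" if "z \<in> columns n" for z
  proof -
    have "(\<Sum>x\<in>columns n. Psi n T x * ?ind z x) = Psi n T z" for T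
    proof -
      have "(\<Sum>x\<in>columns n. Psi n T x * ?ind z x) = (\<Sum>x\<in>columns n. if x = z then Psi n T x else 0)"
        by (intro sum.cong) auto
      with that show ?thesis by simp
    qed
    then show ?thesis by (simp add: mat_col_def col_comb_def)
  qed
  have "mat_col (triples n) (Psi n) ` (columns n - {y}) \<subseteq> ?N"
  proof
    fix m assume "m \<in> mat_col (triples n) (Psi n) ` (columns n - {y})"
    then obtain z where z: "z \<in> columns n" "z \<noteq> y" "m = col_comb n (?ind z)" using col by auto
    moreover have "?ind z \<in> ?C" using z(2) by auto
    ultimately show "m \<in> ?N" by blast
  qed
  ultimately have sub: "lin_span (S_ring n) (fun_module (S_ring n) (triples n)) (mat_col (triples n) (Psi n) ` (columns n - {y})) \<subseteq> ?N"
    by (rule FM.lin_span_least)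
  have "col_comb n (?ind y) \<notin> ?N"
  proof
    assume "col_comb n (?ind y) \<in> ?N"
    then obtain c where c: "c \<in> ?C" "col_comb n (?ind y) = col_comb n c" by blast
    from col_comb_eq_const[OF c(2) y] c(1) show False by simp
  qed
  moreover have "col_comb n (?ind y) \<in> col_comb n ` {c. \<forall>x\<in>columns n. c x \<in> polys (edges n)}" by (rule imageI) auto
  ultimately show ?thesis unfolding mat_map_image using sub by blast
qed

context upper_McCool_homology
begin

lemma presentation_Psi: "presentation (S_ring n) (B_module n) (triples n) (columns n) (Psi n) pres"
  unfolding presentation_def
proof (intro conjI ballI)
  show "Psi n T x \<in> carrier (S_ring n)" if "T \<in> triples n" "x \<in> columns n" for T x
    using polys_Psi[OF that] by (simp add: S_ring_def)
  show "pres \<in> mod_hom (S_ring n) (fun_module (S_ring n) (triples n)) (B_module n)"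
    unfolding mod_hom_def
  proof (intro CollectI conjI ballI)
    show "pres \<in> carrier (fun_module (S_ring n) (triples n)) \<rightarrow> carrier (B_module n)"
      using pres_closed by (simp add: B_module_eq)
  next
    fix f g
    have "pres (f \<oplus>\<^bsub>fun_module (S_ring n) (triples n)\<^esub> g) = pres (\<lambda>T. f T + g T)"
      by (rule pres_cong) (simp add: S_ring_def del: triples_iff)
    then show "pres (f \<oplus>\<^bsub>fun_module (S_ring n) (triples n)\<^esub> g) = pres f \<oplus>\<^bsub>B_module n\<^esub> pres g"
      by (simp add: pres_add B_module_eq)
  next
    fix p f
    have "pres (p \<odot>\<^bsub>fun_module (S_ring n) (triples n)\<^esub> f) = pres (\<lambda>T. p * f T)"
      by (rule pres_cong) (simp add: S_ring_def del: triples_iff)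
    then show "pres (p \<odot>\<^bsub>fun_module (S_ring n) (triples n)\<^esub> f) = p \<odot>\<^bsub>B_module n\<^esub> pres f"
      by (simp add: pres_mult B_module_eq)
  qed
  show "pres ` carrier (fun_module (S_ring n) (triples n)) = carrier (B_module n)"
  proof
    show "pres ` carrier (fun_module (S_ring n) (triples n)) \<subseteq> carrier (B_module n)"
      using pres_closed by (auto simp: B_module_eq)
    show "carrier (B_module n) \<subseteq> pres ` carrier (fun_module (S_ring n) (triples n))"
    proof
      fix b assume "b \<in> carrier (B_module n)"
      then obtain f where f: "\<forall>T\<in>triples n. f T \<in> polys E" "b = pres f" using pres_surj by (auto simp: B_module_eq)
      have "pres f = pres (restrict f (triples n))" by (rule pres_cong) simp
      moreover have "restrict f (triples n) \<in> carrier (fun_module (S_ring n) (triples n))" using f(1) by (simp add: S_ring_def)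
      ultimately show "b \<in> pres ` carrier (fun_module (S_ring n) (triples n))" using f(2) by blast
    qed
  qed
  show "{f \<in> carrier (fun_module (S_ring n) (triples n)). pres f = \<zero>\<^bsub>B_module n\<^esub>} =
    mat_map (S_ring n) (triples n) (columns n) (Psi n) ` carrier (fun_module (S_ring n) (columns n))"
    unfolding mat_map_image
  proof (intro equalityI subsetI)
    fix f assume f: "f \<in> {f \<in> carrier (fun_module (S_ring n) (triples n)). pres f = \<zero>\<^bsub>B_module n\<^esub>}"
    then have fp: "f \<in> triples n \<rightarrow>\<^sub>E polys E" by (simp add: S_ring_def)
    have "in_im n f" by (rule pres_zero_in_im) (use f fp in \<open>auto simp: B_module_eq dest: PiE_mem simp del: triples_iff\<close>)
    then obtain c where c: "\<forall>x\<in>columns n. c x \<in> polys E" "\<forall>T\<in>triples n. f T = (\<Sum>x\<in>columns n. Psi n T x * c x)"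
      by (auto simp: in_im_def simp del: triples_iff)
    have "f = col_comb n c"
      using fp c(2) by (intro extensionalityI[of _ "triples n"]) (auto simp: col_comb_def PiE_def simp del: triples_iff)
    with c(1) show "f \<in> col_comb n ` {c. \<forall>x\<in>columns n. c x \<in> polys E}" by blast
  next
    fix f assume "f \<in> col_comb n ` {c. \<forall>x\<in>columns n. c x \<in> polys E}"
    then obtain c where c: "\<forall>x\<in>columns n. c x \<in> polys E" "f = col_comb n c" by blast
    have "f \<in> carrier (fun_module (S_ring n) (triples n))"
      using c by (auto simp: col_comb_def S_ring_def intro!: polys_sum polys_mult polys_Psi simp del: triples_iff)
    moreover have "in_im n f" unfolding in_im_def using c by (intro exI[of _ c]) (simp add: col_comb_def del: triples_iff)
    ultimately show "f \<in> {f \<in> carrier (fun_module (S_ring n) (triples n)). pres f = \<zero>\<^bsub>B_module n\<^esub>}"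
      using pres_in_im by (simp add: B_module_eq)
  qed
qed

text \<open>The images of vectors whose coordinate at \<open>T\<close> has no constant term form a
  submodule that contains every other generator. If it also contained the generator at
  \<open>T\<close>, a vector whose coordinate at \<open>T\<close> has constant term 1 would lie in
  the image of the matrix, but all vectors in that image have coordinates without constant
  term.\<close>

lemma generators_not_redundant:
  assumes T: "T \<in> triples n"
  shows "lin_span (S_ring n) (B_module n) ((\<lambda>T'. pres (std_vec (S_ring n) (triples n) T')) ` (triples n - {T})) \<noteq> carrier (B_module n)"
proof -
  interpret BM: module "S_ring n" "B_module n"
    unfolding B_module_eq S_ring_def by (rule A.act_module_module)
  let ?C = "{f. (\<forall>T\<in>triples n. f T \<in> polys E) \<and> coef (f T) 0 = 0}"
  have "submodule (pres ` ?C) (S_ring n) (B_module n)"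
  proof (rule BM.submoduleI)
    show "pres ` ?C \<subseteq> carrier (B_module n)" using pres_closed by (auto simp: B_module_eq)
    have "(\<lambda>_. 0) \<in> ?C" by simp
    then show "\<zero>\<^bsub>B_module n\<^esub> \<in> pres ` ?C" using pres_zero[of "\<lambda>_. 0"] unfolding B_module_eq A.act_module_simps by blast
  next
    fix b assume "b \<in> pres ` ?C"
    then obtain f where f: "f \<in> ?C" "b = pres f" by blast
    have "\<ominus>\<^bsub>B_module n\<^esub> b = pres (\<lambda>T. - f T)"
    proof (rule BM.M.minus_equality)
      show "pres (\<lambda>T. - f T) \<oplus>\<^bsub>B_module n\<^esub> b = \<zero>\<^bsub>B_module n\<^esub>"
        unfolding f(2) B_module_eq A.act_module_simps pres_add[symmetric] by (rule pres_zero) simp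
    qed (simp_all add: B_module_eq pres_closed f(2))
    moreover have "(\<lambda>T. - f T) \<in> ?C" using f(1) by (auto intro: polys_uminus simp del: triples_iff)
    ultimately show "\<ominus>\<^bsub>B_module n\<^esub> b \<in> pres ` ?C" by blast
  next
    fix b b' assume "b \<in> pres ` ?C" "b' \<in> pres ` ?C"
    then obtain f g where f: "f \<in> ?C" "b = pres f" "g \<in> ?C" "b' = pres g" by blast
    have "(\<lambda>T. f T + g T) \<in> ?C" using f(1,3) by (auto simp: lookup_add simp del: triples_iff)
    then show "b \<oplus>\<^bsub>B_module n\<^esub> b' \<in> pres ` ?C"
      unfolding f(2,4) B_module_eq A.act_module_simps pres_add[symmetric] by (rule imageI)
  next
    fix p b assume p: "p \<in> carrier (S_ring n)" and "b \<in> pres ` ?C"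
    then obtain f where f: "f \<in> ?C" "b = pres f" by blast
    have "(\<lambda>T. p * f T) \<in> ?C" using f(1) p by (auto simp: coef_mult S_ring_def simp del: triples_iff)
    then show "p \<odot>\<^bsub>B_module n\<^esub> b \<in> pres ` ?C"
      unfolding f(2) B_module_eq A.act_module_simps pres_mult[symmetric] by (rule imageI)
  qed
  moreover have "(\<lambda>T'. pres (std_vec (S_ring n) (triples n) T')) ` (triples n - {T}) \<subseteq> pres ` ?C"
  proof
    fix b assume "b \<in> (\<lambda>T'. pres (std_vec (S_ring n) (triples n) T')) ` (triples n - {T})"
    then obtain T' where T': "T' \<in> triples n" "T' \<noteq> T" "b = pres (std_vec (S_ring n) (triples n) T')" by blast
    have "std_vec (S_ring n) (triples n) T' \<in> ?C" using T' T by (auto simp: std_vec_def S_ring_def simp del: triples_iff)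
    then show "b \<in> pres ` ?C" using T'(3) by blast
  qed
  ultimately have sub: "lin_span (S_ring n) (B_module n) ((\<lambda>T'. pres (std_vec (S_ring n) (triples n) T')) ` (triples n - {T})) \<subseteq> pres ` ?C"
    by (rule BM.lin_span_least)
  have "pres (unit_vec T) \<notin> pres ` ?C"
  proof
    assume "pres (unit_vec T) \<in> pres ` ?C"
    then obtain f where f: "f \<in> ?C" "pres (unit_vec T) = pres f" by blast
    have u: "unit_vec T T' \<in> polys E" for T' by (simp add: unit_vec_def)
    have "pres (\<lambda>T'. unit_vec T T' - f T') = \<zero>\<^bsub>B\<^esub>"
      unfolding pres_diff f(2) using A.M.r_neg[OF pres_closed] by (simp add: a_minus_def)
    then have "in_im n (\<lambda>T'. unit_vec T T' - f T')"
      using f(1) u by (intro pres_zero_in_im) (auto intro: polys_diff simp del: triples_iff)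
    from in_im_no_constant[OF this T] f(1) show False by (simp add: unit_vec_def lookup_minus)
  qed
  moreover have "pres (unit_vec T) \<in> carrier (B_module n)" using pres_closed by (simp add: B_module_eq)
  ultimately show ?thesis using sub by blast
qed

lemma minimal_presentation_Psi: "minimal_presentation (S_ring n) (B_module n) (triples n) (columns n) (Psi n) pres"
  unfolding minimal_presentation_def
  using presentation_Psi generators_not_redundant columns_not_redundant by blast

end

theorem proposition3p5:
  fixes n :: nat
  assumes "n \<ge> 3"
  shows "card (triples n) = n choose 3 \<and>
    real (card (columns n)) =
      1 / 12 * real n * (real n ^ 4 - 5 * real n ^ 3 + 7 * real n ^ 2 - real n - 2) \<and>
    (\<exists>\<Psi> \<pi>. minimal_presentation (S_ring n) (B_module n) (triples n) (columns n) \<Psi> \<pi> \<and>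
      block_upper_triangular n \<Psi> \<and>
      (\<forall>T\<in>triples n. diagonal_block n \<Psi> T = v_row n T))"
proof -
  interpret upper_McCool_homology n .
  show ?thesis
    using card_triples card_columns minimal_presentation_Psi Psi_block_upper_triangular Psi_diagonal_block by blast
qed

end
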